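(* Let $d\ge1$ and let $X_1,\dots,X_d$ be centered Gaussian processes $X_i(t)$, $t\ge 0$, with covariances $B_i(t,s)=E\,X_i(t)X_i(s)$, such that for each $i=1,\dots,d$: (a) $X_i$ is self-similar with index $h_i>0$, $E X_i^2(1)=1$, and $X_i$ is time-invertible: the processes $X_i(t)$ and $t^{2h_i}X_i(1/t)$, $t>0$, have the same law; (b) $E|X_i(t)-X_i(s)|^2\le c|t-s|^{2\alpha_i}$ for all $t,s\in[0,1]$, for some constants $c>0$ and $0<\alpha_i\le 1$; (c) $B_i(t,s)\ge 0$ for all $t,s$; (d) for some $\varepsilon>0$ and some $s_0>1$, $B_i(1,s)\le s^{h_i}/(\ln s)^{1+\varepsilon}$ for all $s>s_0$; (e) there is a constant $c_i>0$ with $B_i(1,1+s)\ge c_i$ for all $s>0$. Let $X(\mathbf t)$, $\mathbf t\in\mathbb R_+^d$, be the tensor product of $X_1,\dots,X_d$, and let $Y(\mathbf t)$, $\mathbf t\in\mathbb R^d$, be its Lamperti transform. Put $\mathbf h=(h_1,\dots,h_d)$, $H=\sum_{i=1}^d h_i$, $K=[0,1]^d$ and $$S_{\mathbf h}=\{\mathbf t\in\mathbb R^d:\ t_i\ge 0\ (i=1,\dots,d),\ \textstyle\sum_{i=1}^d t_ih_i\le H\}.$$ Then the persistence exponents $$\theta_X(K)=\lim_{T\to\infty}\frac{-\ln P\big(X(\mathbf t)\le 1\ \forall\,\mathbf t\in[0,T]^d\big)}{(\ln T)^d}\quad\text{and}\quad \theta_Y(S_{\mathbf h})=\lim_{T\to\infty}\frac{-\ln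 P\big(Y(\mathbf t)\le 0\ \forall\,\mathbf t\in TS_{\mathbf h}\big)}{T^d}$$ exist, are equal, and are nontrivial (nonzero and finite). Moreover, if $d=2$, then also $$\theta_X(K)=\theta_Y(K)\cdot 2\,(h_a/h_g)^2=\theta_Y(\kappa K),$$ where $h_a=(h_1+h_2)/2$, $h_g=\sqrt{h_1h_2}$ and $\kappa=\sqrt2\,h_a/h_g$.
   Context: A process $X_i$ is self-similar with index $h_i$ if for each fixed $\lambda>0$ the processes $X_i(\lambda t)$ and $\lambda^{h_i}X_i(t)$ have the same law. The tensor product of $X_1,\dots,X_d$ is the centered Gaussian field $X(\mathbf t)$, $\mathbf t=(t_1,\dots,t_d)\in\mathbb R_+^d=[0,\infty)^d$, with covariance $E\,X(\mathbf t)X(\mathbf s)=\prod_{i=1}^d B_i(t_i,s_i)$. Its Lamperti transform (the dual field) is $Y(\mathbf t)=X(e^{t_1},\dots,e^{t_d})/[E X^2(e^{t_1},\dots,e^{t_d})]^{1/2}$, $\mathbf t\in\mathbb R^d$. The fields $X$ and $Y$ are taken with continuous sample paths. For a bounded region $G\subset\mathbb R^d$ (connected set with interior points and finite volume), $TG=\{T\mathbf t:\mathbf t\in G\}$ and $\theta_Y(G)=\lim_{T\to\infty}-T^{-d}\ln P(Y(\mathbf t)\le 0\ \forall\,\mathbf t\in TG)$. *)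

theory Defs
  imports "HOL-Probability.Probability"
begin

(* Includes the degenerate law concentrated at 0, which normal_density cannot represent. *)
definition centered_gaussian :: "'w measure \<Rightarrow> ('w \<Rightarrow> real) \<Rightarrow> bool" where
  "centered_gaussian M Z \<longleftrightarrow> Z \<in> borel_measurable M \<and>
     ((AE \<omega> in M. Z \<omega> = 0) \<or> (\<exists>\<sigma>>0. distributed M lborel Z (normal_density 0 \<sigma>)))"

definition centered_gaussian_process :: "'w measure \<Rightarrow> 't set \<Rightarrow> ('t \<Rightarrow> 'w \<Rightarrow> real) \<Rightarrow> bool" where
  "centered_gaussian_process M I X \<longleftrightarrow> prob_space M \<and>
     (\<forall>J a. finite J \<longrightarrow> J \<subseteq> I \<longrightarrow> centered_gaussian M (\<lambda>\<omega>. \<Sum>t\<in>J. a t * X t \<omega>))"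

definition covariance :: "'w measure \<Rightarrow> ('t \<Rightarrow> 'w \<Rightarrow> real) \<Rightarrow> 't \<Rightarrow> 't \<Rightarrow> real" where
  "covariance M X t s = (LINT \<omega>|M. X t \<omega> * X s \<omega>)"

definition process_law :: "'w measure \<Rightarrow> 't set \<Rightarrow> ('t \<Rightarrow> 'w \<Rightarrow> real) \<Rightarrow> ('t \<Rightarrow> real) measure" where
  "process_law M I X = distr M (PiM I (\<lambda>_. borel)) (\<lambda>\<omega>. \<lambda>t\<in>I. X t \<omega>)"

definition self_similar :: "'w measure \<Rightarrow> (real \<Rightarrow> 'w \<Rightarrow> real) \<Rightarrow> real \<Rightarrow> bool" where
  "self_similar M X h \<longleftrightarrow> (\<forall>c>0.
     process_law M {0..} (\<lambda>t. X (c * t)) = process_law M {0..} (\<lambda>t \<omega>. c powr h * X t \<omega>))"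

definition time_invertible :: "'w measure \<Rightarrow> (real \<Rightarrow> 'w \<Rightarrow> real) \<Rightarrow> real \<Rightarrow> bool" where
  "time_invertible M X h \<longleftrightarrow>
     process_law M {0<..} X = process_law M {0<..} (\<lambda>t \<omega>. t powr (2 * h) * X (1 / t) \<omega>)"

definition orthant :: "(real^'n) set" where
  "orthant = {t. \<forall>i. 0 \<le> t $ i}"

(* The tensor product is a field determined in law; X on N is any version of it. *)
definition tensor_product ::
    "('n::finite \<Rightarrow> 'w measure) \<Rightarrow> ('n \<Rightarrow> real \<Rightarrow> 'w \<Rightarrow> real) \<Rightarrow>
     'v measure \<Rightarrow> (real^'n \<Rightarrow> 'v \<Rightarrow> real) \<Rightarrow> bool" where
  "tensor_product M Xs N X \<longleftrightarrow> centered_gaussian_process N orthant X \<and>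
     (\<forall>t\<in>orthant. \<forall>s\<in>orthant.
        covariance N X t s = (\<Prod>i\<in>UNIV. covariance (M i) (Xs i) (t $ i) (s $ i)))"

definition continuous_paths ::
    "'v measure \<Rightarrow> 't::topological_space set \<Rightarrow> ('t \<Rightarrow> 'v \<Rightarrow> real) \<Rightarrow> bool" where
  "continuous_paths N I X \<longleftrightarrow> (\<forall>\<omega>\<in>space N. continuous_on I (\<lambda>t. X t \<omega>))"

definition lamperti ::
    "'v measure \<Rightarrow> (real^'n \<Rightarrow> 'v \<Rightarrow> real) \<Rightarrow> real^'n \<Rightarrow> 'v \<Rightarrow> real" where
  "lamperti N X t \<omega> =
     X (\<chi> i. exp (t $ i)) \<omega> / sqrt (LINT \<omega>'|N. (X (\<chi> i. exp (t $ i)) \<omega>')\<^sup>2)"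

definition stays_below_prob ::
    "'v measure \<Rightarrow> ('t \<Rightarrow> 'v \<Rightarrow> real) \<Rightarrow> real \<Rightarrow> 't set \<Rightarrow> real" where
  "stays_below_prob N X u S = measure N {\<omega> \<in> space N. \<forall>t\<in>S. X t \<omega> \<le> u}"

(* Existence of the finite limit with value theta. Positivity of the probability is required
   because ln 0 = 0 in HOL, whereas -ln 0 must count as infinite. *)
definition has_theta_X ::
    "'v measure \<Rightarrow> (real^'n \<Rightarrow> 'v \<Rightarrow> real) \<Rightarrow> (real^'n) set \<Rightarrow> real \<Rightarrow> bool" where
  "has_theta_X N X G \<theta> \<longleftrightarrow>
     (\<forall>\<^sub>F T in at_top. stays_below_prob N X 1 ((\<lambda>t. T *\<^sub>R t) ` G) > 0) \<and>
     ((\<lambda>T. - ln (stays_below_prob N X 1 ((\<lambda>t. T *\<^sub>R t) ` G)) / ln T ^ CARD('n)) \<longlongrightarrow> \<theta>) at_top"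

definition has_theta_Y ::
    "'v measure \<Rightarrow> (real^'n \<Rightarrow> 'v \<Rightarrow> real) \<Rightarrow> (real^'n) set \<Rightarrow> real \<Rightarrow> bool" where
  "has_theta_Y N Y G \<theta> \<longleftrightarrow>
     (\<forall>\<^sub>F T in at_top. stays_below_prob N Y 0 ((\<lambda>t. T *\<^sub>R t) ` G) > 0) \<and>
     ((\<lambda>T. - ln (stays_below_prob N Y 0 ((\<lambda>t. T *\<^sub>R t) ` G)) / T ^ CARD('n)) \<longlongrightarrow> \<theta>) at_top"

definition unit_cube :: "(real^'n) set" where
  "unit_cube = {t. \<forall>i. 0 \<le> t $ i \<and> t $ i \<le> 1}"

definition simplex_of :: "real^'n::finite \<Rightarrow> (real^'n) set" where
  "simplex_of h = {t. (\<forall>i. 0 \<le> t $ i) \<and> (\<Sum>i\<in>UNIV. t $ i * h $ i) \<le> (\<Sum>i\<in>UNIV. h $ i)}"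

end

theory Submission
  imports Defs
begin

text \<open>Only covariances matter. The law of a Gaussian vector, hence the probability of a lower orthant,
  is a function of its covariance, and Slepian's inequality makes the cost
  $-\ln P(Y \le 0 \mbox{ on } S)$ subadditive in $S$, because the covariance of $Y$ is nonnegative.
  Slepian's inequality itself is obtained without calculus: after adding white noise of variance
  $\delta$, a small increase of an off-diagonal covariance amounts to replacing two independent
  noise terms by a single common one, and $P(z \le a)\,P(z \le b) \le P(z \le \min(a, b))$.

  Self-similarity makes $Y$ stationary. Covering by a fine grid shows that the cost of a cube is
  asymptotic to $\psi$ times its volume; applying this to the simplex and to its complement in a
  large cube gives the exponent $\psi \cdot \mathrm{vol}(S_h)$. Positivity of $\psi$ comes from a
  sparse sublattice, on which the covariance matrix is close to the identity.

  In logarithmic coordinates $X \le 1$ on $[0,T]^d$ means $Y(t) \le e^{-h \cdot t}$ for all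
  $t \le \ln T$. The half space $h \cdot t \le -\delta\ln T$ is covered by a bounded number of orthants, each
  of which costs $O(1)$ by self-similarity. On the rest the level $e^{-h \cdot t}$ is lowered to 0
  by a Cameron--Martin shift, whose price $O((\ln T)^{d/2})$ is negligible. The rest is a
  reflected copy of $(\ln T) S_h$.\<close>

section \<open>Uniqueness of Gaussian orthant probabilities\<close>

text \<open>Slepian's inequality bounds costs only from above. Lower bounds have two sources. For
  cubes, \<open>\<psi>\<close> is the infimum of the cost per volume, so no cube pays less than
  \<open>\<psi>\<close> times its volume. For the simplex, its complement in a cube pays at most
  about \<open>\<psi>\<close> times its own volume, and what remains of the lower bound for the cube
  falls on the simplex.

  The constants for d = 2 are areas: the volume of S_h is H^d / (d! h_1 ... h_d), which for d = 2
  equals 2 (h_a/h_g)^2, the square of \<open>\<kappa>\<close>; hence the scaled square has the same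
  exponent.

  A Cameron-Martin density is unbounded, so it is truncated: outside an event of probability at most
  exp(-M^2/2), a shift by m costs a factor exp(M m + m^2/2). Since m stays bounded, M of order (ln
  T)^(d/2) makes the exceptional event comparable to the main term, while the logarithm of the
  factor has smaller order.

  Estimates are made on finite index sets only: a persistence probability is an infimum over these,
  and path continuity identifies it with the probability of the event.\<close>

lemma (in prob_space) weighted_law:
  fixes X w :: "'a \<Rightarrow> real"
  assumes [measurable]: "X \<in> borel_measurable M" "w \<in> borel_measurable M"
    and w: "\<And>\<omega>. 0 \<le> w \<omega>" "integrable M w" and m: "m = integral\<^sup>L M w" "0 < m"
  defines "\<nu> \<equiv> distr (density M (\<lambda>\<omega>. ennreal (w \<omega> / m))) borel X"
  shows "real_distribution \<nu>"
    and "char \<nu> b = (LINT \<omega>|M. complex_of_real (w \<omega>) * iexp (b * X \<omega>)) / m"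
    and "measure \<nu> {..u} = (LINT \<omega>|M. w \<omega> * indicator {..u} (X \<omega>)) / m"
proof -
  define D where "D = density M (\<lambda>\<omega>. ennreal (w \<omega> / m))"
  have [measurable]: "X \<in> borel_measurable D" by (auto simp: D_def)
  have "emeasure D (space D) = (\<integral>\<^sup>+\<omega>. ennreal (w \<omega> / m) \<partial>M)"
    by (auto simp: D_def emeasure_density cong: nn_integral_cong)
  also have "\<dots> = ennreal (integral\<^sup>L M (\<lambda>\<omega>. w \<omega> / m))"
    using w m by (intro nn_integral_eq_integral) auto
  also have "\<dots> = 1" using m by simp
  finally interpret D: prob_space D by (rule prob_spaceI)
  have \<nu>: "\<nu> = distr D borel X" by (simp add: \<nu>_def D_def)
  show "real_distribution \<nu>" unfolding \<nu> by (rule D.real_distribution_distr) simp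
  have "char \<nu> b = (LINT \<omega>|D. iexp (b * X \<omega>))" by (simp add: \<nu> char_def integral_distr)
  also have "\<dots> = (LINT \<omega>|M. (w \<omega> / m) *\<^sub>R iexp (b * X \<omega>))"
    unfolding D_def using w m by (intro integral_density) auto
  also have "\<dots> = (LINT \<omega>|M. complex_of_real (w \<omega>) * iexp (b * X \<omega>) / m)"
    by (intro Bochner_Integration.integral_cong) (auto simp: scaleR_conv_of_real)
  finally show "char \<nu> b = (LINT \<omega>|M. complex_of_real (w \<omega>) * iexp (b * X \<omega>)) / m" by simp
  have "measure \<nu> {..u} = (LINT x|\<nu>. indicator {..u} x)" by (simp add: \<nu>)
  also have "\<dots> = (LINT \<omega>|D. indicator {..u} (X \<omega>))" unfolding \<nu> by (rule integral_distr) auto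
  also have "\<dots> = (LINT \<omega>|M. (w \<omega> / m) *\<^sub>R indicator {..u} (X \<omega>))"
    unfolding D_def using w m by (intro integral_density) auto
  finally show "measure \<nu> {..u} = (LINT \<omega>|M. w \<omega> * indicator {..u} (X \<omega>)) / m" by simp
qed

text \<open>After division by its mass a weight is a probability density, so the weighted laws of
  \<open>X\<close> and \<open>X'\<close> are fixed by their characteristic functions. If the mass is
  zero, both sides vanish.\<close>

lemma weighted_Levy_uniqueness:
  fixes X :: "'a \<Rightarrow> real" and X' :: "'b \<Rightarrow> real" and w :: "'a \<Rightarrow> real" and w' :: "'b \<Rightarrow> real"
  assumes M: "prob_space M" and M': "prob_space M'"
    and m[measurable]: "X \<in> borel_measurable M" "X' \<in> borel_measurable M'"
      "w \<in> borel_measurable M" "w' \<in> borel_measurable M'"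
    and w: "\<And>\<omega>. 0 \<le> w \<omega>" "\<And>\<omega>. w \<omega> \<le> B" and w': "\<And>\<omega>. 0 \<le> w' \<omega>" "\<And>\<omega>. w' \<omega> \<le> B"
    and eq: "\<And>b. (LINT \<omega>|M. complex_of_real (w \<omega>) * iexp (b * X \<omega>))
               = (LINT \<omega>|M'. complex_of_real (w' \<omega>) * iexp (b * X' \<omega>))"
  shows "(LINT \<omega>|M. w \<omega> * indicator {..u} (X \<omega>)) = (LINT \<omega>|M'. w' \<omega> * indicator {..u} (X' \<omega>))"
proof -
  interpret M: prob_space M by fact
  interpret M': prob_space M' by fact
  have int: "integrable M w" "integrable M' w'"
    using w w' by (auto intro!: M.integrable_const_bound[where B=B] M'.integrable_const_bound[where B=B])
  \<comment> \<open>At b = 0 the hypothesis says that the two weights have the same mass; both are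
    normalised by it.\<close>
  have "complex_of_real (integral\<^sup>L M w) = complex_of_real (integral\<^sup>L M' w')"
    using eq[of 0] by simp
  then have same: "integral\<^sup>L M w = integral\<^sup>L M' w'" by simp
  show ?thesis
  proof (cases "integral\<^sup>L M w = 0")
    case True
    then have "AE \<omega> in M. w \<omega> = 0" "AE \<omega> in M'. w' \<omega> = 0"
      using w w' same integral_nonneg_eq_0_iff_AE[OF int(1)] integral_nonneg_eq_0_iff_AE[OF int(2)] by simp_all
    then have "(LINT \<omega>|M. w \<omega> * indicator {..u} (X \<omega>)) = 0" "(LINT \<omega>|M'. w' \<omega> * indicator {..u} (X' \<omega>)) = 0"
      by (auto intro!: integral_eq_zero_AE)
    then show ?thesis by simp
  next
    case False
    then have pos: "0 < integral\<^sup>L M w" using w by (simp add: less_le)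
    note L = M.weighted_law[OF m(1,3) w(1) int(1) refl pos]
      and L' = M'.weighted_law[OF m(2,4) w'(1) int(2) same pos]
    have "distr (density M (\<lambda>\<omega>. ennreal (w \<omega> / integral\<^sup>L M w))) borel X
      = distr (density M' (\<lambda>\<omega>. ennreal (w' \<omega> / integral\<^sup>L M w))) borel X'"
      by (intro Levy_uniqueness L(1) L'(1) ext) (simp only: L(2) L'(2) eq)
    then show ?thesis using L(3)[of u] L'(3)[of u] pos by simp
  qed
qed

text \<open>Euler's formulas turn a trigonometric weight into the phases \<open>X\<close>,
  \<open>X + \<theta>\<close> and \<open>X - \<theta>\<close>, about which joint characteristic
  functions give information. The summand 1 keeps the weights nonnegative.\<close>

lemma (in prob_space) iexp_cos_sin_weights:
  fixes X \<theta> :: "'a \<Rightarrow> real"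
  assumes [measurable]: "X \<in> borel_measurable M" "\<theta> \<in> borel_measurable M" "E \<in> sets M"
  shows "(LINT \<omega>|M. complex_of_real (indicator E \<omega> * (1 + cos (\<theta> \<omega>))) * iexp (X \<omega>)) =
      (LINT \<omega>|M. complex_of_real (indicator E \<omega>) * iexp (X \<omega>))
      + ((LINT \<omega>|M. complex_of_real (indicator E \<omega>) * iexp (X \<omega> + \<theta> \<omega>))
      + (LINT \<omega>|M. complex_of_real (indicator E \<omega>) * iexp (X \<omega> - \<theta> \<omega>))) / 2"
    and "(LINT \<omega>|M. complex_of_real (indicator E \<omega> * (1 + sin (\<theta> \<omega>))) * iexp (X \<omega>)) =
      (LINT \<omega>|M. complex_of_real (indicator E \<omega>) * iexp (X \<omega>))
      + ((LINT \<omega>|M. complex_of_real (indicator E \<omega>) * iexp (X \<omega> + \<theta> \<omega>))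
      - (LINT \<omega>|M. complex_of_real (indicator E \<omega>) * iexp (X \<omega> - \<theta> \<omega>))) / (2 * \<i>)"
proof -
  have I: "integrable M (\<lambda>\<omega>. complex_of_real (indicator E \<omega>) * iexp (f \<omega>))"
    if [measurable]: "f \<in> borel_measurable M" for f
    by (rule integrable_const_bound[where B=1]) (auto simp: norm_mult split: split_indicator)
  have "(LINT \<omega>|M. complex_of_real (indicator E \<omega> * (1 + cos (\<theta> \<omega>))) * iexp (X \<omega>)) =
    (LINT \<omega>|M. complex_of_real (indicator E \<omega>) * iexp (X \<omega>) +
       (complex_of_real (indicator E \<omega>) * iexp (X \<omega> + \<theta> \<omega>) + complex_of_real (indicator E \<omega>) * iexp (X \<omega> - \<theta> \<omega>)) / 2)"
    by (intro Bochner_Integration.integral_cong refl)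
      (auto simp: cos_of_real[symmetric] cos_exp_eq exp_add exp_diff exp_minus field_simps)
  also have "\<dots> = (LINT \<omega>|M. complex_of_real (indicator E \<omega>) * iexp (X \<omega>))
      + ((LINT \<omega>|M. complex_of_real (indicator E \<omega>) * iexp (X \<omega> + \<theta> \<omega>))
      + (LINT \<omega>|M. complex_of_real (indicator E \<omega>) * iexp (X \<omega> - \<theta> \<omega>))) / 2"
    by (subst Bochner_Integration.integral_add, (intro I integrable_divide Bochner_Integration.integrable_add; measurable),
       (intro I integrable_divide Bochner_Integration.integrable_add; measurable))
      (simp add: Bochner_Integration.integral_add[OF I I] del: of_real_add of_real_diff)
  finally show "(LINT \<omega>|M. complex_of_real (indicator E \<omega> * (1 + cos (\<theta> \<omega>))) * iexp (X \<omega>)) = \<dots>" .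
  have "(LINT \<omega>|M. complex_of_real (indicator E \<omega> * (1 + sin (\<theta> \<omega>))) * iexp (X \<omega>)) =
    (LINT \<omega>|M. complex_of_real (indicator E \<omega>) * iexp (X \<omega>) +
       (complex_of_real (indicator E \<omega>) * iexp (X \<omega> + \<theta> \<omega>) - complex_of_real (indicator E \<omega>) * iexp (X \<omega> - \<theta> \<omega>)) / (2 * \<i>))"
    by (intro Bochner_Integration.integral_cong refl)
      (auto simp: sin_of_real[symmetric] sin_exp_eq exp_add exp_diff exp_minus field_simps)
  also have "\<dots> = (LINT \<omega>|M. complex_of_real (indicator E \<omega>) * iexp (X \<omega>))
      + ((LINT \<omega>|M. complex_of_real (indicator E \<omega>) * iexp (X \<omega> + \<theta> \<omega>))
      - (LINT \<omega>|M. complex_of_real (indicator E \<omega>) * iexp (X \<omega> - \<theta> \<omega>))) / (2 * \<i>)"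
    by (subst Bochner_Integration.integral_add, (intro I integrable_divide Bochner_Integration.integrable_diff; measurable),
       (intro I integrable_divide Bochner_Integration.integrable_diff; measurable))
      (simp add: Bochner_Integration.integral_diff[OF I I] del: of_real_add of_real_diff)
  finally show "(LINT \<omega>|M. complex_of_real (indicator E \<omega> * (1 + sin (\<theta> \<omega>))) * iexp (X \<omega>)) = \<dots>" .
qed

text \<open>The half lines are added to the event \<open>E\<close> one coordinate at a time; the nonnegative weights
  $1_E(1 + \cos\theta)$ and $1_E(1 + \sin\theta)$ bring the joint characteristic function into the
  scope of the one-dimensional uniqueness theorem.\<close>

lemma orthant_prob_unique:
  fixes X :: "'i \<Rightarrow> 'a \<Rightarrow> real" and X' :: "'i \<Rightarrow> 'b \<Rightarrow> real"
  assumes "finite J" and M: "prob_space M" and M': "prob_space M'"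
    and "\<And>t. t \<in> J \<Longrightarrow> X t \<in> borel_measurable M" "\<And>t. t \<in> J \<Longrightarrow> X' t \<in> borel_measurable M'"
    and "E \<in> sets M" "E' \<in> sets M'"
    and "\<And>a. (LINT \<omega>|M. complex_of_real (indicator E \<omega>) * iexp (\<Sum>t\<in>J. a t * X t \<omega>))
             = (LINT \<omega>|M'. complex_of_real (indicator E' \<omega>) * iexp (\<Sum>t\<in>J. a t * X' t \<omega>))"
  shows "measure M (E \<inter> {\<omega>\<in>space M. \<forall>t\<in>J. X t \<omega> \<le> u t}) = measure M' (E' \<inter> {\<omega>\<in>space M'. \<forall>t\<in>J. X' t \<omega> \<le> u t})"
  using assms(1,4-)
proof (induction J arbitrary: E E' rule: finite_induct)
  case empty
  interpret M: prob_space M by fact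
  interpret M': prob_space M' by fact
  have "complex_of_real (measure M E) = complex_of_real (measure M' E')"
    using empty.prems(5)[of "\<lambda>_. 0"] empty.prems(3,4) by simp
  then show ?case using empty.prems(3,4) by (simp add: sets.Int_space_eq2)
next
  case (insert k J)
  interpret M: prob_space M by fact
  interpret M': prob_space M' by fact
  note [measurable] = insert.prems(3,4)
  have [measurable]: "X k \<in> borel_measurable M" "X' k \<in> borel_measurable M'"
    "\<And>t. t \<in> J \<Longrightarrow> X t \<in> borel_measurable M" "\<And>t. t \<in> J \<Longrightarrow> X' t \<in> borel_measurable M'"
    using insert.prems(1,2) by auto
  define F where "F = E \<inter> {\<omega>\<in>space M. X k \<omega> \<le> u k}"
  define F' where "F' = E' \<inter> {\<omega>\<in>space M'. X' k \<omega> \<le> u k}"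
  have [measurable]: "F \<in> sets M" "F' \<in> sets M'" by (auto simp: F_def F'_def)
  \<comment> \<open>Used with c = 0, 1, -1, which are the three phases occurring in
    \<open>iexp_cos_sin_weights\<close>.\<close>
  have EQ: "(LINT \<omega>|M. complex_of_real (indicator E \<omega>) * iexp (b * X k \<omega> + c * (\<Sum>t\<in>J. a t * X t \<omega>)))
     = (LINT \<omega>|M'. complex_of_real (indicator E' \<omega>) * iexp (b * X' k \<omega> + c * (\<Sum>t\<in>J. a t * X' t \<omega>)))" for a b c
  proof -
    have "(\<Sum>t\<in>insert k J. ((\<lambda>t. c * a t)(k := b)) t * Z t) = b * Z k + c * (\<Sum>t\<in>J. a t * Z t)" for Z :: "'i \<Rightarrow> real"
      using insert.hyps by (auto simp: sum_distrib_left mult.assoc intro!: sum.cong)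
    then show ?thesis using insert.prems(5)[of "(\<lambda>t. c * a t)(k := b)"] by (simp only:)
  qed
  have "measure M (F \<inter> {\<omega>\<in>space M. \<forall>t\<in>J. X t \<omega> \<le> u t}) = measure M' (F' \<inter> {\<omega>\<in>space M'. \<forall>t\<in>J. X' t \<omega> \<le> u t})"
  proof (rule insert.IH)
    fix a :: "'i \<Rightarrow> real"
    define \<theta> where "\<theta> = (\<lambda>\<omega>. \<Sum>t\<in>J. a t * X t \<omega>)"
    define \<theta>' where "\<theta>' = (\<lambda>\<omega>. \<Sum>t\<in>J. a t * X' t \<omega>)"
    have [measurable]: "\<theta> \<in> borel_measurable M" "\<theta>' \<in> borel_measurable M'" by (auto simp: \<theta>_def \<theta>'_def)
    have E0: "(LINT \<omega>|M. complex_of_real (indicator E \<omega>) * iexp (b * X k \<omega>))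
     = (LINT \<omega>|M'. complex_of_real (indicator E' \<omega>) * iexp (b * X' k \<omega>))" for b
      using EQ[of b 0] by simp
    have E1: "(LINT \<omega>|M. complex_of_real (indicator E \<omega>) * iexp (b * X k \<omega> + \<theta> \<omega>))
     = (LINT \<omega>|M'. complex_of_real (indicator E' \<omega>) * iexp (b * X' k \<omega> + \<theta>' \<omega>))" for b
      using EQ[of b 1 a] by (simp add: \<theta>_def \<theta>'_def)
    have E2: "(LINT \<omega>|M. complex_of_real (indicator E \<omega>) * iexp (b * X k \<omega> - \<theta> \<omega>))
     = (LINT \<omega>|M'. complex_of_real (indicator E' \<omega>) * iexp (b * X' k \<omega> - \<theta>' \<omega>))" for b
      using EQ[of b "-1" a] by (simp add: \<theta>_def \<theta>'_def)
    have F: "indicator F \<omega> = (indicator E \<omega> * indicator {..u k} (X k \<omega>) :: real)" if "\<omega> \<in> space M" for \<omega>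
      using that by (auto simp: F_def split: split_indicator)
    have F': "indicator F' \<omega> = (indicator E' \<omega> * indicator {..u k} (X' k \<omega>) :: real)" if "\<omega> \<in> space M'" for \<omega>
      using that by (auto simp: F'_def split: split_indicator)
    have b: "0 \<le> indicator A x * (1 + cos y)" "indicator A x * (1 + cos y) \<le> 2"
       "0 \<le> indicator A x * (1 + sin y)" "indicator A x * (1 + sin y) \<le> 2" for y :: real and A and x :: 'z
      using cos_ge_minus_one[of y] cos_le_one[of y] sin_ge_minus_one[of y] sin_le_one[of y]
      by (auto split: split_indicator simp: add_nonneg_nonneg le_diff_eq, linarith+)
    have 0: "(LINT \<omega>|M. indicator F \<omega>) = (LINT \<omega>|M'. (indicator F' \<omega> :: real))"
    proof -
      have "(LINT \<omega>|M. indicator E \<omega> * indicator {..u k} (X k \<omega>)) = (LINT \<omega>|M'. indicator E' \<omega> * (indicator {..u k} (X' k \<omega>) :: real))"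
        by (rule weighted_Levy_uniqueness[OF M M', where B=1]) (auto simp: E0 simp del: of_real_mult)
      then show ?thesis by (simp add: F F' cong: Bochner_Integration.integral_cong)
    qed
    have I: "integrable M (\<lambda>\<omega>. indicator F \<omega> * f (\<theta> \<omega>))" if "f \<in> borel_measurable borel" "\<And>x. \<bar>f x\<bar> \<le> 1" for f :: "real \<Rightarrow> real"
      using that by (intro M.integrable_const_bound[where B=1]) (auto split: split_indicator)
    have I': "integrable M' (\<lambda>\<omega>. indicator F' \<omega> * f (\<theta>' \<omega>))" if "f \<in> borel_measurable borel" "\<And>x. \<bar>f x\<bar> \<le> 1" for f :: "real \<Rightarrow> real"
      using that by (intro M'.integrable_const_bound[where B=1]) (auto split: split_indicator)
    have trig: "(LINT \<omega>|M. indicator F \<omega> * g (\<theta> \<omega>)) = (LINT \<omega>|M'. indicator F' \<omega> * g (\<theta>' \<omega>))"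
      if g: "g = cos \<or> g = sin" for g :: "real \<Rightarrow> real"
    proof -
      have gm[measurable]: "g \<in> borel_measurable borel" and gb: "\<And>x. \<bar>g x\<bar> \<le> 1" using g by auto
      have "(LINT \<omega>|M. (indicator E \<omega> * (1 + g (\<theta> \<omega>))) * indicator {..u k} (X k \<omega>))
        = (LINT \<omega>|M'. (indicator E' \<omega> * (1 + g (\<theta>' \<omega>))) * indicator {..u k} (X' k \<omega>))"
        by (rule weighted_Levy_uniqueness[OF M M', where B=2])
          (use g in \<open>auto simp: b M.iexp_cos_sin_weights M'.iexp_cos_sin_weights E0 E1 E2 simp del: of_real_add of_real_diff of_real_mult\<close>)
      then have "(LINT \<omega>|M. indicator F \<omega> * (1 + g (\<theta> \<omega>))) = (LINT \<omega>|M'. indicator F' \<omega> * (1 + g (\<theta>' \<omega>)))"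
        by (simp add: F F' mult_ac cong: Bochner_Integration.integral_cong)
      \<comment> \<open>The plain indicator case \<open>0\<close> is subtracted to remove the
        summand 1 of the weight.\<close>
      then show ?thesis using 0 I[OF gm gb] I'[OF gm gb] I[of "\<lambda>_. 1"] I'[of "\<lambda>_. 1"]
        by (simp add: distrib_left del: Bochner_Integration.integral_indicator integral_indicator)
    qed
    \<comment> \<open>The cosine and sine parts recombine to the characteristic function on
      \<open>F\<close>, the hypothesis of the induction for the smaller index set.\<close>
    have "(LINT \<omega>|M. complex_of_real (indicator F \<omega>) * iexp (\<theta> \<omega>)) =
       (LINT \<omega>|M. complex_of_real (indicator F \<omega> * cos (\<theta> \<omega>)) + \<i> * complex_of_real (indicator F \<omega> * sin (\<theta> \<omega>)))"
      by (intro Bochner_Integration.integral_cong refl) (auto simp: exp_Euler sin_of_real[symmetric] cos_of_real[symmetric] algebra_simps)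
    also have "\<dots> = (LINT \<omega>|M. complex_of_real (indicator F \<omega> * cos (\<theta> \<omega>))) + \<i> * (LINT \<omega>|M. complex_of_real (indicator F \<omega> * sin (\<theta> \<omega>)))"
      using I[of cos] I[of sin] by (subst Bochner_Integration.integral_add) (auto intro!: integrable_of_real simp del: of_real_mult)
    also have "\<dots> = (LINT \<omega>|M'. complex_of_real (indicator F' \<omega> * cos (\<theta>' \<omega>))) + \<i> * (LINT \<omega>|M'. complex_of_real (indicator F' \<omega> * sin (\<theta>' \<omega>)))"
      using trig[of cos] trig[of sin] by (simp only: integral_complex_of_real simp_thms)
    also have "\<dots> = (LINT \<omega>|M'. complex_of_real (indicator F' \<omega> * cos (\<theta>' \<omega>)) + \<i> * complex_of_real (indicator F' \<omega> * sin (\<theta>' \<omega>)))"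
      using I'[of cos] I'[of sin] by (subst Bochner_Integration.integral_add) (auto intro!: integrable_of_real simp del: of_real_mult)
    also have "\<dots> = (LINT \<omega>|M'. complex_of_real (indicator F' \<omega>) * iexp (\<theta>' \<omega>))"
      by (intro Bochner_Integration.integral_cong refl) (auto simp: exp_Euler sin_of_real[symmetric] cos_of_real[symmetric] algebra_simps)
    finally show "(LINT \<omega>|M. complex_of_real (indicator F \<omega>) * iexp (\<Sum>t\<in>J. a t * X t \<omega>))
             = (LINT \<omega>|M'. complex_of_real (indicator F' \<omega>) * iexp (\<Sum>t\<in>J. a t * X' t \<omega>))"
      by (simp add: \<theta>_def \<theta>'_def)
  qed auto
  moreover have "F \<inter> {\<omega>\<in>space M. \<forall>t\<in>J. X t \<omega> \<le> u t} = E \<inter> {\<omega>\<in>space M. \<forall>t\<in>insert k J. X t \<omega> \<le> u t}"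
    "F' \<inter> {\<omega>\<in>space M'. \<forall>t\<in>J. X' t \<omega> \<le> u t} = E' \<inter> {\<omega>\<in>space M'. \<forall>t\<in>insert k J. X' t \<omega> \<le> u t}"
    by (auto simp: F_def F'_def)
  ultimately show ?case by simp
qed

section \<open>Gaussian vectors and their covariances\<close>

definition quad_form :: "'i set \<Rightarrow> ('i \<Rightarrow> 'i \<Rightarrow> real) \<Rightarrow> ('i \<Rightarrow> real) \<Rightarrow> real" where
  "quad_form J C a = (\<Sum>t\<in>J. \<Sum>s\<in>J. a t * a s * C t s)"

definition psd_on :: "'i set \<Rightarrow> ('i \<Rightarrow> 'i \<Rightarrow> real) \<Rightarrow> bool" where
  "psd_on J C \<longleftrightarrow> (\<forall>t\<in>J. \<forall>s\<in>J. C t s = C s t) \<and> (\<forall>a. 0 \<le> quad_form J C a)"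

text \<open>The characteristic function, rather than a density, is prescribed: this covers singular
  covariances and makes sums of independent vectors a matter of multiplying exponentials.\<close>

definition gaussian_vector :: "'w measure \<Rightarrow> 'i set \<Rightarrow> ('i \<Rightarrow> 'w \<Rightarrow> real) \<Rightarrow> ('i \<Rightarrow> 'i \<Rightarrow> real) \<Rightarrow> bool" where
  "gaussian_vector M J X C \<longleftrightarrow> prob_space M \<and> finite J \<and> (\<forall>t\<in>J. X t \<in> borel_measurable M) \<and>
     (\<forall>t\<in>J. \<forall>s\<in>J. C t s = C s t) \<and>
     (\<forall>a. (LINT \<omega>|M. iexp (\<Sum>t\<in>J. a t * X t \<omega>)) = complex_of_real (exp (- quad_form J C a / 2)))"

lemma quad_form_cong:
  "(\<And>t s. t \<in> J \<Longrightarrow> s \<in> J \<Longrightarrow> C t s = D t s) \<Longrightarrow> (\<And>t. t \<in> J \<Longrightarrow> a t = b t) \<Longrightarrow> quad_form J C a = quad_form J D b"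
  unfolding quad_form_def by (intro sum.cong) auto

lemma quad_form_add: "quad_form J (\<lambda>t s. C t s + D t s) a = quad_form J C a + quad_form J D a"
  by (simp add: quad_form_def distrib_left sum.distrib)

lemma quad_form_scale: "quad_form J (\<lambda>t s. c * C t s) a = c * quad_form J C a"
  by (simp add: quad_form_def sum_distrib_left mult_ac)

lemma quad_form_rank_one: "quad_form J (\<lambda>t s. d t * d s) a = (\<Sum>t\<in>J. a t * d t)\<^sup>2"
  by (simp add: quad_form_def power2_eq_square sum_product mult_ac)

lemma quad_form_diag:
  "finite J \<Longrightarrow> quad_form J (\<lambda>t s. if t = s then v t else 0) a = (\<Sum>t\<in>J. v t * (a t)\<^sup>2)"
  by (simp add: quad_form_def power2_eq_square mult_ac if_distrib cong: if_cong)

lemma psd_on_cong: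
  assumes "psd_on J C" "\<And>t s. t \<in> J \<Longrightarrow> s \<in> J \<Longrightarrow> C t s = D t s"
  shows "psd_on J D"
proof -
  have "quad_form J C a = quad_form J D a" for a using assms(2) by (intro quad_form_cong) auto
  then show ?thesis using assms by (auto simp: psd_on_def)
qed

lemma psd_on_add: "psd_on J C \<Longrightarrow> psd_on J D \<Longrightarrow> psd_on J (\<lambda>t s. C t s + D t s)"
  by (simp add: psd_on_def quad_form_add)

lemma psd_on_scale: "psd_on J C \<Longrightarrow> 0 \<le> c \<Longrightarrow> psd_on J (\<lambda>t s. c * C t s)"
  by (simp add: psd_on_def quad_form_scale)

lemma psd_on_rank_one: "psd_on J (\<lambda>t s. d t * d s)"
  by (simp add: psd_on_def quad_form_rank_one mult.commute)

lemma psd_on_diag: "finite J \<Longrightarrow> (\<And>t. t \<in> J \<Longrightarrow> 0 \<le> v t) \<Longrightarrow> psd_on J (\<lambda>t s. if t = s then v t else 0)"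
  by (auto simp: psd_on_def quad_form_diag intro!: sum_nonneg)

lemma psd_on_zero: "psd_on J (\<lambda>t s. 0)"
  by (simp add: psd_on_def quad_form_def)

lemma quad_form_subset:
  assumes "finite J'" "J \<subseteq> J'"
  shows "quad_form J C a = quad_form J' C (\<lambda>t. if t \<in> J then a t else 0)"
proof -
  have *: "(\<Sum>s\<in>J'. (if t \<in> J then a t else 0) * (if s \<in> J then a s else 0) * C t s) =
     (if t \<in> J then \<Sum>s\<in>J. a t * a s * C t s else 0)" for t
  proof (cases "t \<in> J")
    case True
    then have "(\<Sum>s\<in>J'. (if t \<in> J then a t else 0) * (if s \<in> J then a s else 0) * C t s) =
       (\<Sum>s\<in>J'. if s \<in> J then a t * a s * C t s else 0)" by (intro sum.cong) auto
    also have "\<dots> = (\<Sum>s\<in>J' \<inter> J. a t * a s * C t s)" using assms by (simp add: sum.inter_restrict)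
    finally show ?thesis using True assms by (simp add: Int_absorb1)
  qed auto
  have "quad_form J' C (\<lambda>t. if t \<in> J then a t else 0) = (\<Sum>t\<in>J'. if t \<in> J then \<Sum>s\<in>J. a t * a s * C t s else 0)"
    unfolding quad_form_def * ..
  also have "\<dots> = (\<Sum>t\<in>J' \<inter> J. \<Sum>s\<in>J. a t * a s * C t s)" using assms by (simp add: sum.inter_restrict)
  finally show ?thesis using assms by (simp add: Int_absorb1 quad_form_def)
qed

lemma psd_on_subset: "psd_on J' C \<Longrightarrow> finite J' \<Longrightarrow> J \<subseteq> J' \<Longrightarrow> psd_on J C"
  unfolding psd_on_def using quad_form_subset[of J' J C] by (auto simp: subset_iff)

lemma gaussian_vectorD:
  assumes "gaussian_vector M J X C"
  shows "prob_space M" "finite J" "t \<in> J \<Longrightarrow> X t \<in> borel_measurable M"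
    "t \<in> J \<Longrightarrow> s \<in> J \<Longrightarrow> C t s = C s t"
    "(LINT \<omega>|M. iexp (\<Sum>t\<in>J. a t * X t \<omega>)) = complex_of_real (exp (- quad_form J C a / 2))"
  using assms unfolding gaussian_vector_def by simp_all

text \<open>A characteristic function has modulus at most 1, so exp(-q/2) <= 1 forces the quadratic
  form q to be nonnegative.\<close>

lemma gaussian_vector_psd:
  assumes "gaussian_vector M J X C" shows "psd_on J C"
proof -
  note g = gaussian_vectorD[OF assms]
  interpret prob_space M by (rule g)
  have "0 \<le> quad_form J C a" for a
  proof -
    have [measurable]: "(\<lambda>\<omega>. \<Sum>t\<in>J. a t * X t \<omega>) \<in> borel_measurable M" using g(3) by auto
    have "norm (LINT \<omega>|M. iexp (\<Sum>t\<in>J. a t * X t \<omega>)) \<le> (LINT \<omega>|M. norm (iexp (\<Sum>t\<in>J. a t * X t \<omega>)))"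
      by (rule integral_norm_bound)
    also have "\<dots> = 1" by (simp add: prob_space)
    finally show ?thesis unfolding g(5) by simp
  qed
  then show ?thesis using g(4) by (simp add: psd_on_def)
qed

lemma gaussian_vector_cong:
  assumes "gaussian_vector M J X C"
    and "\<And>t s. t \<in> J \<Longrightarrow> s \<in> J \<Longrightarrow> C t s = D t s" "\<And>t \<omega>. t \<in> J \<Longrightarrow> X t \<omega> = Y t \<omega>"
  shows "gaussian_vector M J Y D"
proof -
  have 1: "(\<Sum>t\<in>J. a t * X t \<omega>) = (\<Sum>t\<in>J. a t * Y t \<omega>)" for a \<omega> using assms(3) by (intro sum.cong) auto
  have 2: "X t = Y t" if "t \<in> J" for t using assms(3)[OF that] by blast
  have 3: "quad_form J C a = quad_form J D a" for a using assms(2) by (intro quad_form_cong) auto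
  show ?thesis using assms(1,2) 2 unfolding gaussian_vector_def 1 3 by simp
qed

lemma gaussian_vector_subset:
  assumes "gaussian_vector M J' X C" "J \<subseteq> J'" shows "gaussian_vector M J X C"
proof -
  note g = gaussian_vectorD[OF assms(1)]
  have "(LINT \<omega>|M. iexp (\<Sum>t\<in>J. a t * X t \<omega>)) = complex_of_real (exp (- quad_form J C a / 2))" for a
  proof -
    have "(\<Sum>t\<in>J'. (if t \<in> J then a t else 0) * X t \<omega>) = (\<Sum>t\<in>J. a t * X t \<omega>)" for \<omega>
      using g(2) assms(2) by (simp add: if_distrib[of "\<lambda>x. x * _"] sum.inter_restrict[symmetric] Int_absorb1 cong: if_cong)
    then show ?thesis using g(5)[of "\<lambda>t. if t \<in> J then a t else 0"] quad_form_subset[OF g(2) assms(2), of C a] by simp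
  qed
  then show ?thesis using g assms(2) unfolding gaussian_vector_def by (blast intro: finite_subset)
qed

lemma integral_pair_mult_bounded:
  fixes f :: "'a \<Rightarrow> 'c::{real_normed_field,banach,second_countable_topology}" and g :: "'b \<Rightarrow> 'c"
  assumes M: "prob_space M" and N: "prob_space N"
    and [measurable]: "f \<in> borel_measurable M" "g \<in> borel_measurable N"
    and b: "\<And>x. norm (f x) \<le> 1" "\<And>y. norm (g y) \<le> 1"
  shows "(LINT p|(M \<Otimes>\<^sub>M N). f (fst p) * g (snd p)) = (LINT x|M. f x) * (LINT y|N. g y)"
proof -
  interpret M: prob_space M by fact
  interpret N: prob_space N by fact
  interpret pair_prob_space M N ..
  have "norm (f (fst p) * g (snd p)) \<le> 1" for p
    using b(1)[of "fst p"] b(2)[of "snd p"] by (simp add: norm_mult mult_le_one)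
  then have "integrable (M \<Otimes>\<^sub>M N) (\<lambda>p. f (fst p) * g (snd p))"
    by (intro P.integrable_const_bound[where B=1]) auto
  from integral_fst'[OF this] show ?thesis by simp
qed

lemma gaussian_vector_add:
  assumes X: "gaussian_vector M J X C" and Z: "gaussian_vector N J Z D"
  shows "gaussian_vector (M \<Otimes>\<^sub>M N) J (\<lambda>t p. X t (fst p) + Z t (snd p)) (\<lambda>t s. C t s + D t s)"
proof -
  note x = gaussian_vectorD[OF X] and z = gaussian_vectorD[OF Z]
  interpret M: prob_space M by (rule x)
  interpret N: prob_space N by (rule z)
  interpret pair_prob_space M N ..
  have [measurable]: "\<And>t. t \<in> J \<Longrightarrow> X t \<in> borel_measurable M" "\<And>t. t \<in> J \<Longrightarrow> Z t \<in> borel_measurable N"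
    using x(3) z(3) by auto
  have "(LINT p|(M \<Otimes>\<^sub>M N). iexp (\<Sum>t\<in>J. a t * (X t (fst p) + Z t (snd p)))) =
    complex_of_real (exp (- quad_form J (\<lambda>t s. C t s + D t s) a / 2))" for a
  proof -
    have "(LINT p|(M \<Otimes>\<^sub>M N). iexp (\<Sum>t\<in>J. a t * (X t (fst p) + Z t (snd p)))) =
       (LINT p|(M \<Otimes>\<^sub>M N). iexp (\<Sum>t\<in>J. a t * X t (fst p)) * iexp (\<Sum>t\<in>J. a t * Z t (snd p)))"
      by (intro Bochner_Integration.integral_cong refl)
        (simp add: exp_add[symmetric] distrib_left sum.distrib del: of_real_sum of_real_mult)
    also have "\<dots> = (LINT \<omega>|M. iexp (\<Sum>t\<in>J. a t * X t \<omega>)) * (LINT \<omega>|N. iexp (\<Sum>t\<in>J. a t * Z t \<omega>))"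
      by (rule integral_pair_mult_bounded) (auto simp: x z simp del: of_real_sum of_real_mult)
    also have "\<dots> = complex_of_real (exp (- quad_form J C a / 2) * exp (- quad_form J D a / 2))"
      unfolding x(5) z(5) by simp
    also have "exp (- quad_form J C a / 2) * exp (- quad_form J D a / 2) = exp (- quad_form J (\<lambda>t s. C t s + D t s) a / 2)"
      by (simp add: quad_form_add exp_add[symmetric] field_simps)
    finally show ?thesis .
  qed
  then show ?thesis using x z P.prob_space_axioms by (auto simp: gaussian_vector_def simp del: of_real_sum)
qed

lemma prob_space_std_normal: "prob_space std_normal_distribution"
  by (rule prob_space_normal_density) simp

lemma integral_iexp_std_normal:
  "(LINT z|std_normal_distribution. iexp (b * z)) = complex_of_real (exp (- b\<^sup>2 / 2))"
  using fun_cong[OF char_std_normal_distribution, of b] by (simp add: char_def)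

lemma gaussian_vector_rank_one:
  assumes "finite J" shows "gaussian_vector std_normal_distribution J (\<lambda>t z. d t * z) (\<lambda>t s. d t * d s)"
proof -
  have "(LINT z|std_normal_distribution. iexp (\<Sum>t\<in>J. a t * (d t * z))) =
     complex_of_real (exp (- quad_form J (\<lambda>t s. d t * d s) a / 2))" for a
  proof -
    have "(\<Sum>t\<in>J. a t * (d t * z)) = (\<Sum>t\<in>J. a t * d t) * z" for z
      unfolding sum_distrib_right by (simp add: mult.assoc)
    then show ?thesis by (simp only: integral_iexp_std_normal quad_form_rank_one)
  qed
  then show ?thesis using assms prob_space_std_normal by (auto simp: gaussian_vector_def mult.commute)
qed

lemma gaussian_vector_linear:
  assumes J: "finite J"
  shows "gaussian_vector (PiM J (\<lambda>_. std_normal_distribution)) J (\<lambda>t \<omega>. \<Sum>j\<in>J. A t j * \<omega> j) (\<lambda>t s. \<Sum>j\<in>J. A t j * A s j)"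
proof -
  interpret S: prob_space std_normal_distribution by (rule prob_space_std_normal)
  interpret product_prob_space "\<lambda>_. std_normal_distribution" J ..
  have "(LINT \<omega>|PiM J (\<lambda>_. std_normal_distribution). iexp (\<Sum>t\<in>J. a t * (\<Sum>j\<in>J. A t j * \<omega> j))) =
     complex_of_real (exp (- quad_form J (\<lambda>t s. \<Sum>j\<in>J. A t j * A s j) a / 2))" for a
  proof -
    define b where "b j = (\<Sum>t\<in>J. a t * A t j)" for j
    have "(\<Sum>t\<in>J. a t * (\<Sum>j\<in>J. A t j * \<omega> j)) = (\<Sum>j\<in>J. b j * \<omega> j)" for \<omega>
      unfolding b_def sum_distrib_left sum_distrib_right by (subst sum.swap) (simp add: mult_ac)
    then have "(LINT \<omega>|PiM J (\<lambda>_. std_normal_distribution). iexp (\<Sum>t\<in>J. a t * (\<Sum>j\<in>J. A t j * \<omega> j))) =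
       (LINT \<omega>|PiM J (\<lambda>_. std_normal_distribution). (\<Prod>j\<in>J. iexp (b j * \<omega> j)))"
      by (simp add: exp_sum[OF J] sum_distrib_left del: of_real_mult)
    also have "\<dots> = (\<Prod>j\<in>J. LINT z|std_normal_distribution. iexp (b j * z))"
      by (intro product_integral_prod J S.integrable_iexp) auto
    also have "\<dots> = complex_of_real (exp (\<Sum>j\<in>J. - (b j)\<^sup>2 / 2))"
      by (simp only: integral_iexp_std_normal exp_sum[OF J] of_real_prod)
    also have "(\<Sum>j\<in>J. - (b j)\<^sup>2 / 2) = - (\<Sum>j\<in>J. (b j)\<^sup>2) / 2" by (simp add: sum_negf sum_divide_distrib)
    also have "(\<Sum>j\<in>J. (b j)\<^sup>2) = quad_form J (\<lambda>t s. \<Sum>j\<in>J. A t j * A s j) a"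
    proof -
      have "(\<Sum>j\<in>J. (b j)\<^sup>2) = (\<Sum>j\<in>J. \<Sum>t\<in>J. \<Sum>s\<in>J. a t * a s * (A t j * A s j))"
        by (simp add: b_def power2_eq_square sum_product mult_ac)
      also have "\<dots> = (\<Sum>t\<in>J. \<Sum>s\<in>J. \<Sum>j\<in>J. a t * a s * (A t j * A s j))"
        by (subst sum.swap, rule sum.cong[OF refl], rule sum.swap)
      finally show ?thesis by (simp add: quad_form_def sum_distrib_left)
    qed
    finally show ?thesis .
  qed
  then show ?thesis using J by (auto simp: gaussian_vector_def mult.commute P.prob_space_axioms)
qed

text \<open>Induction by Schur complements: the rank one part explained by the new variable
  \<open>k\<close> is split off, and the remainder \<open>C'\<close> is again semidefinite. A zero
  pivot is harmless, because then its whole row vanishes and division by zero returns 0.\<close>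

lemma cholesky:
  assumes "finite J" "psd_on J C"
  shows "\<exists>A. \<forall>t\<in>J. \<forall>s\<in>J. C t s = (\<Sum>j\<in>J. A t j * A s j)"
  using assms
proof (induction J arbitrary: C rule: finite_induct)
  case (insert k J)
  have sym: "C t s = C s t" if "t \<in> insert k J" "s \<in> insert k J" for t s
    using insert.prems that by (auto simp: psd_on_def)
  have qf: "quad_form (insert k J) C a = (a k)\<^sup>2 * C k k + 2 * a k * (\<Sum>t\<in>J. a t * C k t) + quad_form J C a" for a
  proof -
    have "(\<Sum>t\<in>J. a t * a k * C t k) = a k * (\<Sum>t\<in>J. a t * C k t)"
      unfolding sum_distrib_left using sym by (intro sum.cong) auto
    moreover have "(\<Sum>s\<in>J. a k * a s * C k s) = a k * (\<Sum>t\<in>J. a t * C k t)"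
      unfolding sum_distrib_left by (intro sum.cong) auto
    ultimately show ?thesis
      using insert.hyps by (simp add: quad_form_def sum.distrib power2_eq_square)
  qed
  have nonneg: "0 \<le> (a k)\<^sup>2 * C k k + 2 * a k * (\<Sum>t\<in>J. a t * C k t) + quad_form J C a" for a
    using insert.prems unfolding psd_on_def qf[symmetric] by blast
  have kk: "0 \<le> C k k"
  proof -
    define a where "a = (\<lambda>t. if t = k then 1 else 0 :: real)"
    have "\<And>t. t \<in> J \<Longrightarrow> a t = 0" using insert.hyps by (auto simp: a_def)
    then have "(\<Sum>t\<in>J. a t * C k t) = 0" "quad_form J C a = 0" by (simp_all add: quad_form_def)
    then show ?thesis using nonneg[of a] by (simp add: a_def)
  qed
  have zero: "C k t = 0" if "C k k = 0" "t \<in> J" for t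
  proof (rule ccontr)
    assume nz: "C k t \<noteq> 0"
    have tk: "t \<noteq> k" using that insert.hyps by auto
    \<comment> \<open>With zero pivot the form at x e_k + e_t is 2 x C(k,t) + C(t,t), linear in x;
      this x makes it -1.\<close>
    define x where "x = - (C t t + 1) / (2 * C k t)"
    define a where "a = (\<lambda>s. if s = k then x else if s = t then 1 else 0::real)"
    have s1: "(\<Sum>s\<in>J. a s * C k s) = C k t"
    proof -
      have "(\<Sum>s\<in>J. a s * C k s) = (\<Sum>s\<in>J. if s = t then C k s else 0)"
        using insert.hyps by (intro sum.cong) (auto simp: a_def)
      then show ?thesis using that insert.hyps by simp
    qed
    have s2: "quad_form J C a = C t t"
    proof -
      have "quad_form J C a = quad_form J C (\<lambda>s. if s \<in> {t} then 1 else 0)"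
        using insert.hyps by (intro quad_form_cong) (auto simp: a_def)
      also have "\<dots> = quad_form {t} C (\<lambda>_. 1)"
        using insert.hyps that by (intro quad_form_subset[symmetric]) auto
      finally show ?thesis by (simp add: quad_form_def)
    qed
    have "0 \<le> 2 * x * C k t + C t t"
      using nonneg[of a] that(1) by (simp add: s1 s2) (simp add: a_def)
    then show False using nz by (simp add: x_def field_simps)
  qed
  define C' where "C' = (\<lambda>t s. C t s - C k t * C k s / C k k)"
  have "psd_on J C'"
  proof -
    have "0 \<le> quad_form J C' a" for a
    proof -
      define r where "r = (\<Sum>t\<in>J. a t * C k t)"
      have q: "quad_form J C' a = quad_form J C a - r\<^sup>2 / C k k"
      proof -
        have "quad_form J C' a = quad_form J (\<lambda>t s. C t s + (- 1 / C k k) * (C k t * C k s)) a"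
          by (intro quad_form_cong) (auto simp: C'_def)
        also have "\<dots> = quad_form J C a + (- 1 / C k k) * r\<^sup>2"
          unfolding quad_form_add quad_form_scale quad_form_rank_one r_def by simp
        finally show ?thesis by simp
      qed
      \<comment> \<open>This coefficient at \<open>k\<close> minimises the form of \<open>C\<close>;
        the minimum is the form of \<open>C'\<close>.\<close>
      define b where "b = a(k := - r / C k k)"
      have "(\<Sum>t\<in>J. b t * C k t) = r" "quad_form J C b = quad_form J C a"
        unfolding r_def using insert.hyps by (auto intro!: sum.cong quad_form_cong simp: b_def)
      then have "0 \<le> (r / C k k)\<^sup>2 * C k k - 2 * (r / C k k) * r + quad_form J C a"
        using nonneg[of b] by (simp add: b_def)
      then show ?thesis unfolding q by (cases "C k k = 0") (auto simp: power2_eq_square field_simps)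
    qed
    then show ?thesis using sym by (auto simp: psd_on_def C'_def)
  qed
  from insert.IH[OF this] obtain A where A: "\<And>t s. t \<in> J \<Longrightarrow> s \<in> J \<Longrightarrow> C' t s = (\<Sum>j\<in>J. A t j * A s j)" by blast
  \<comment> \<open>Column \<open>k\<close> reproduces the rank one part; the other columns keep the
    factor of \<open>C'\<close> and vanish in row \<open>k\<close>.\<close>
  define A' where "A' = (\<lambda>t j. if j = k then C k t / sqrt (C k k) else if t = k then 0 else A t j)"
  have "C t s = (\<Sum>j\<in>insert k J. A' t j * A' s j)" if ts: "t \<in> insert k J" "s \<in> insert k J" for t s
  proof -
    have 1: "(\<Sum>j\<in>insert k J. A' t j * A' s j) = C k t * C k s / C k k + (\<Sum>j\<in>J. A' t j * A' s j)"
      using insert.hyps kk by (simp add: A'_def)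
    show ?thesis
    proof (cases "t = k \<or> s = k")
      case True
      then have "(\<Sum>j\<in>J. A' t j * A' s j) = 0" using insert.hyps by (intro sum.neutral) (auto simp: A'_def)
      moreover have "C t s = C k t * C k s / C k k"
      proof (cases "C k k = 0")
        case True
        with zero ts have "C k s = 0" "C k t = 0" by auto
        with \<open>t = k \<or> s = k\<close> sym[OF ts] True show ?thesis by auto
      next
        case False
        with \<open>t = k \<or> s = k\<close> sym[OF ts] show ?thesis by auto
      qed
      ultimately show ?thesis using 1 by simp
    next
      case False
      then have "(\<Sum>j\<in>J. A' t j * A' s j) = C' t s" using insert.hyps A ts by (auto simp: A'_def intro!: sum.cong)
      then show ?thesis using 1 by (simp add: C'_def)
    qed
  qed
  then show ?case by blast
qed simp

text \<open>The chosen factor of \<open>C\<close> gives one concrete Gaussian model; by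
  \<open>orthant_prob_eq\<close> every other vector with this covariance yields the same number. For
  a \<open>C\<close> without a factor the value is arbitrary.\<close>

definition orthant_prob :: "'i set \<Rightarrow> ('i \<Rightarrow> 'i \<Rightarrow> real) \<Rightarrow> ('i \<Rightarrow> real) \<Rightarrow> real" where
  "orthant_prob J C u = (let A = (SOME A. \<forall>t\<in>J. \<forall>s\<in>J. C t s = (\<Sum>j\<in>J. A t j * A s j));
      P = PiM J (\<lambda>_. std_normal_distribution)
     in measure P {\<omega> \<in> space P. \<forall>t\<in>J. (\<Sum>j\<in>J. A t j * \<omega> j) \<le> u t})"

lemma gaussian_vector_cholesky:
  assumes "finite J" "psd_on J C"
  obtains A where "gaussian_vector (PiM J (\<lambda>_. std_normal_distribution)) J (\<lambda>t \<omega>. \<Sum>j\<in>J. A t j * \<omega> j) C"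
    "A = (SOME A. \<forall>t\<in>J. \<forall>s\<in>J. C t s = (\<Sum>j\<in>J. A t j * A s j))"
proof -
  define A where "A = (SOME A. \<forall>t\<in>J. \<forall>s\<in>J. C t s = (\<Sum>j\<in>J. A t j * A s j))"
  have "\<forall>t\<in>J. \<forall>s\<in>J. C t s = (\<Sum>j\<in>J. A t j * A s j)"
    unfolding A_def using cholesky[OF assms] by (rule someI_ex)
  then have "gaussian_vector (PiM J (\<lambda>_. std_normal_distribution)) J (\<lambda>t \<omega>. \<Sum>j\<in>J. A t j * \<omega> j) C"
    by (intro gaussian_vector_cong[OF gaussian_vector_linear[OF assms(1), of A]]) auto
  then show ?thesis using that A_def by blast
qed

lemma gaussian_vector_exists:
  fixes J :: "'i set"
  assumes "finite J" "psd_on J C"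
  obtains M :: "('i \<Rightarrow> real) measure" and X where "gaussian_vector M J X C"
  using gaussian_vector_cholesky[OF assms] by blast

text \<open>The vector and the Cholesky model have the same characteristic function, so
  \<open>orthant_prob_unique\<close> applies with the whole spaces as events.\<close>

lemma orthant_prob_eq:
  assumes X: "gaussian_vector M J X C"
  shows "measure M {\<omega>\<in>space M. \<forall>t\<in>J. X t \<omega> \<le> u t} = orthant_prob J C u"
proof -
  note x = gaussian_vectorD[OF X]
  obtain A where A: "gaussian_vector (PiM J (\<lambda>_. std_normal_distribution)) J (\<lambda>t \<omega>. \<Sum>j\<in>J. A t j * \<omega> j) C"
    "A = (SOME A. \<forall>t\<in>J. \<forall>s\<in>J. C t s = (\<Sum>j\<in>J. A t j * A s j))"
    using gaussian_vector_cholesky[OF x(2) gaussian_vector_psd[OF X]] by blast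
  note a = gaussian_vectorD[OF A(1)]
  let ?P = "PiM J (\<lambda>_. std_normal_distribution) :: ('b \<Rightarrow> real) measure"
  have "measure M (space M \<inter> {\<omega>\<in>space M. \<forall>t\<in>J. X t \<omega> \<le> u t}) =
     measure ?P (space ?P \<inter> {\<omega>\<in>space ?P. \<forall>t\<in>J. (\<Sum>j\<in>J. A t j * \<omega> j) \<le> u t})"
  proof (rule orthant_prob_unique)
    fix b
    have "(LINT \<omega>|M. complex_of_real (indicator (space M) \<omega>) * iexp (\<Sum>t\<in>J. b t * X t \<omega>)) =
      (LINT \<omega>|M. iexp (\<Sum>t\<in>J. b t * X t \<omega>))" by (intro Bochner_Integration.integral_cong) auto
    moreover have "(LINT \<omega>|?P. complex_of_real (indicator (space ?P) \<omega>) * iexp (\<Sum>t\<in>J. b t * (\<Sum>j\<in>J. A t j * \<omega> j))) =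
      (LINT \<omega>|?P. iexp (\<Sum>t\<in>J. b t * (\<Sum>j\<in>J. A t j * \<omega> j)))" by (intro Bochner_Integration.integral_cong) auto
    ultimately show "(LINT \<omega>|M. complex_of_real (indicator (space M) \<omega>) * iexp (\<Sum>t\<in>J. b t * X t \<omega>)) =
      (LINT \<omega>|?P. complex_of_real (indicator (space ?P) \<omega>) * iexp (\<Sum>t\<in>J. b t * (\<Sum>j\<in>J. A t j * \<omega> j)))"
      using x(5) a(5) by presburger
  qed (use x a in auto)
  moreover have "space M \<inter> {\<omega>\<in>space M. \<forall>t\<in>J. X t \<omega> \<le> u t} = {\<omega>\<in>space M. \<forall>t\<in>J. X t \<omega> \<le> u t}"
    "space ?P \<inter> {\<omega>\<in>space ?P. \<forall>t\<in>J. (\<Sum>j\<in>J. A t j * \<omega> j) \<le> u t} = {\<omega>\<in>space ?P. \<forall>t\<in>J. (\<Sum>j\<in>J. A t j * \<omega> j) \<le> u t}"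
    by auto
  ultimately show ?thesis unfolding orthant_prob_def Let_def A(2)[symmetric] by metis
qed

text \<open>Covariances that agree on \<open>J\<close> have the same factors, so \<open>SOME\<close>
  picks the same one.\<close>

lemma orthant_prob_cong:
  assumes "\<And>t s. t \<in> J \<Longrightarrow> s \<in> J \<Longrightarrow> C t s = D t s" "\<And>t. t \<in> J \<Longrightarrow> u t = v t"
  shows "orthant_prob J C u = orthant_prob J D v"
proof -
  have "(\<lambda>A. \<forall>t\<in>J. \<forall>s\<in>J. C t s = (\<Sum>j\<in>J. A t j * A s j)) = (\<lambda>A. \<forall>t\<in>J. \<forall>s\<in>J. D t s = (\<Sum>j\<in>J. A t j * A s j))"
    using assms(1) by (intro ext) auto
  moreover have "(\<forall>t\<in>J. f t \<le> u t) = (\<forall>t\<in>J. f t \<le> v t)" for f :: "'a \<Rightarrow> real"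
    using assms(2) by auto
  ultimately show ?thesis by (simp add: orthant_prob_def Let_def)
qed

lemma orthant_prob_nonneg: "0 \<le> orthant_prob J C u"
  by (simp add: orthant_prob_def Let_def)

lemma orthant_prob_le_1: "orthant_prob J C u \<le> 1"
proof -
  interpret S: prob_space std_normal_distribution by (rule prob_space_std_normal)
  interpret product_prob_space "\<lambda>_. std_normal_distribution" J ..
  show ?thesis by (simp add: orthant_prob_def Let_def)
qed

lemma orthant_prob_mono:
  assumes "finite J'" "psd_on J' C" "J \<subseteq> J'" "\<And>t. t \<in> J \<Longrightarrow> u' t \<le> u t"
  shows "orthant_prob J' C u' \<le> orthant_prob J C u"
proof -
  obtain P :: "('a \<Rightarrow> real) measure" and X where G: "gaussian_vector P J' X C"
    using gaussian_vector_exists[OF assms(1,2)] .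
  note g = gaussian_vectorD[OF G]
  interpret prob_space P by (rule g)
  have "measure P {\<omega>\<in>space P. \<forall>t\<in>J'. X t \<omega> \<le> u' t} \<le> measure P {\<omega>\<in>space P. \<forall>t\<in>J. X t \<omega> \<le> u t}"
  proof (rule finite_measure_mono)
    have [measurable]: "\<And>t. t \<in> J \<Longrightarrow> X t \<in> borel_measurable P" using g(3) assms(3) by auto
    have "finite J" using assms finite_subset by blast
    then show "{\<omega>\<in>space P. \<forall>t\<in>J. X t \<omega> \<le> u t} \<in> sets P" by measurable
  qed (use assms in \<open>force\<close>)
  then show ?thesis using orthant_prob_eq[OF G] orthant_prob_eq[OF gaussian_vector_subset[OF G assms(3)]] by simp
qed

section \<open>Slepian's inequality\<close>

text \<open>For nested events the intersection is the smaller of the two, and a product of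
  probabilities is at most either factor. All positive dependence in Slepian's inequality is drawn
  from this.\<close>

lemma prob_pair_Times_le:
  assumes M: "prob_space M" and "A \<in> sets M" "B \<in> sets M" "A \<subseteq> B \<or> B \<subseteq> A"
  shows "emeasure (M \<Otimes>\<^sub>M M) (A \<times> B) \<le> emeasure M (A \<inter> B)"
proof -
  interpret M: prob_space M by fact
  have "emeasure (M \<Otimes>\<^sub>M M) (A \<times> B) = emeasure M A * emeasure M B"
    using assms by (simp add: M.emeasure_pair_measure_Times)
  also have "\<dots> \<le> emeasure M (A \<inter> B)"
  proof -
    have "emeasure M A * emeasure M B \<le> emeasure M A * 1" "emeasure M A * emeasure M B \<le> 1 * emeasure M B"
      by (intro mult_left_mono mult_right_mono M.emeasure_le_1; simp)+
    moreover have "A \<inter> B = A \<or> A \<inter> B = B" using assms(4) by blast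
    ultimately show ?thesis by auto
  qed
  finally show ?thesis .
qed

text \<open>On the left the coordinates \<open>i\<close> and \<open>j\<close> receive independent
  noises of variance \<open>e\<close>, on the right a common one. Given the rest of the vector, the
  constraints at \<open>i\<close> and \<open>j\<close> confine the noise to two nested sets.\<close>

lemma orthant_prob_pair:
  assumes J: "finite J" and C: "psd_on J C" and ij: "i \<in> J" "j \<in> J" "i \<noteq> j" and e: "0 \<le> e"
  shows "orthant_prob J (\<lambda>t s. C t s + e * (of_bool (t = i) * of_bool (s = i) + of_bool (t = j) * of_bool (s = j))) u
     \<le> orthant_prob J (\<lambda>t s. C t s + e * ((of_bool (t = i) + of_bool (t = j)) * (of_bool (s = i) + of_bool (s = j)))) u"
proof -
  let ?S = "std_normal_distribution"
  interpret S: prob_space ?S by (rule prob_space_std_normal)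
  obtain M :: "('a \<Rightarrow> real) measure" and V where G: "gaussian_vector M J V C"
    using gaussian_vector_exists[OF J C] .
  note g = gaussian_vectorD[OF G]
  interpret M: prob_space M by (rule g)
  define r where "r = sqrt e"
  have rr: "r * r = e" and r0: "0 \<le> r" using e by (auto simp: r_def)
  define a where "a t = r * of_bool (t = i)" for t
  define b where "b t = r * of_bool (t = j)" for t
  note R = gaussian_vector_rank_one[OF J]
  have G1: "gaussian_vector (M \<Otimes>\<^sub>M (?S \<Otimes>\<^sub>M ?S)) J (\<lambda>t p. V t (fst p) + (a t * fst (snd p) + b t * snd (snd p)))
     (\<lambda>t s. C t s + e * (of_bool (t = i) * of_bool (s = i) + of_bool (t = j) * of_bool (s = j)))"
    by (rule gaussian_vector_cong[OF gaussian_vector_add[OF G gaussian_vector_add[OF R[of a] R[of b]]]])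
      (auto simp: a_def b_def rr[symmetric] algebra_simps)
  have G2: "gaussian_vector (M \<Otimes>\<^sub>M ?S) J (\<lambda>t p. V t (fst p) + (a t + b t) * snd p)
     (\<lambda>t s. C t s + e * ((of_bool (t = i) + of_bool (t = j)) * (of_bool (s = i) + of_bool (s = j))))"
    by (rule gaussian_vector_cong[OF gaussian_vector_add[OF G R[of "\<lambda>t. a t + b t"]]])
      (simp_all add: a_def b_def rr[symmetric] algebra_simps)
  define E1 where "E1 = {p \<in> space (M \<Otimes>\<^sub>M (?S \<Otimes>\<^sub>M ?S)). \<forall>t\<in>J. V t (fst p) + (a t * fst (snd p) + b t * snd (snd p)) \<le> u t}"
  define E2 where "E2 = {p \<in> space (M \<Otimes>\<^sub>M ?S). \<forall>t\<in>J. V t (fst p) + (a t + b t) * snd p \<le> u t}"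
  note g1 = gaussian_vectorD[OF G1] and g2 = gaussian_vectorD[OF G2]
  interpret P1: prob_space "M \<Otimes>\<^sub>M (?S \<Otimes>\<^sub>M ?S)" by (rule g1)
  interpret P2: prob_space "M \<Otimes>\<^sub>M ?S" by (rule g2)
  interpret SS: pair_prob_space ?S ?S ..
  note [measurable] = g(3)
  have [measurable]: "E1 \<in> sets (M \<Otimes>\<^sub>M (?S \<Otimes>\<^sub>M ?S))" "E2 \<in> sets (M \<Otimes>\<^sub>M ?S)"
    unfolding E1_def E2_def using J by measurable
  have "emeasure (M \<Otimes>\<^sub>M (?S \<Otimes>\<^sub>M ?S)) E1 = (\<integral>\<^sup>+\<omega>. emeasure (?S \<Otimes>\<^sub>M ?S) (Pair \<omega> -` E1) \<partial>M)"
    by (rule SS.P.emeasure_pair_measure_alt) measurable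
  also have "\<dots> \<le> (\<integral>\<^sup>+\<omega>. emeasure ?S (Pair \<omega> -` E2) \<partial>M)"
  proof (rule nn_integral_mono)
    fix \<omega> assume \<omega>: "\<omega> \<in> space M"
    define Q where "Q \<longleftrightarrow> (\<forall>t\<in>J. t \<noteq> i \<longrightarrow> t \<noteq> j \<longrightarrow> V t \<omega> \<le> u t)"
    define Z where "Z k = {z. V k \<omega> + r * z \<le> u k}" for k
    have Zs: "Z k \<in> sets ?S" for k unfolding Z_def by measurable
    have ab: "a i = r" "b i = 0" "a j = 0" "b j = r" "\<And>t. t \<noteq> i \<Longrightarrow> a t = 0" "\<And>t. t \<noteq> j \<Longrightarrow> b t = 0"
      using ij by (auto simp: a_def b_def)
    have 1: "(\<forall>t\<in>J. V t \<omega> + (a t * x + b t * y) \<le> u t) \<longleftrightarrow> Q \<and> x \<in> Z i \<and> y \<in> Z j" for x y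
      unfolding Q_def Z_def mem_Collect_eq using ij ab by (metis add.left_neutral add.right_neutral mult_zero_left)
    have 2: "(\<forall>t\<in>J. V t \<omega> + (a t + b t) * x \<le> u t) \<longleftrightarrow> Q \<and> x \<in> Z i \<inter> Z j" for x
      unfolding Q_def Z_def mem_Collect_eq Int_iff using ij ab by (metis add.left_neutral add.right_neutral mult_zero_left)
    have e1: "Pair \<omega> -` E1 = (if Q then Z i \<times> Z j else {})"
      using \<omega> 1 by (auto simp: E1_def space_pair_measure)
    have e2: "Pair \<omega> -` E2 = (if Q then Z i \<inter> Z j else {})"
      using \<omega> 2 by (auto simp: E2_def space_pair_measure)
    \<comment> \<open>Both sets are defined by an upper bound on r z with the same r >= 0, hence are
      comparable.\<close>
    have "Z i \<subseteq> Z j \<or> Z j \<subseteq> Z i"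
    proof (rule ccontr)
      assume "\<not> ?thesis"
      then obtain x y where "V i \<omega> + r * x \<le> u i" "u j < V j \<omega> + r * x" "V j \<omega> + r * y \<le> u j" "u i < V i \<omega> + r * y"
        by (auto simp: Z_def not_le)
      then have "r * x < r * y" "r * y < r * x" by linarith+
      then show False by simp
    qed
    then show "emeasure (?S \<Otimes>\<^sub>M ?S) (Pair \<omega> -` E1) \<le> emeasure ?S (Pair \<omega> -` E2)"
      unfolding e1 e2 using prob_pair_Times_le[OF S.prob_space_axioms Zs Zs] by auto
  qed
  also have "\<dots> = emeasure (M \<Otimes>\<^sub>M ?S) E2"
    by (rule S.emeasure_pair_measure_alt[symmetric]) measurable
  finally have "measure (M \<Otimes>\<^sub>M (?S \<Otimes>\<^sub>M ?S)) E1 \<le> measure (M \<Otimes>\<^sub>M ?S) E2"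
    by (simp add: P1.emeasure_eq_measure P2.emeasure_eq_measure)
  then show ?thesis using orthant_prob_eq[OF G1, of u] orthant_prob_eq[OF G2, of u] by (simp add: E1_def E2_def)
qed

lemma psd_on_sum:
  "finite P \<Longrightarrow> (\<And>p. p \<in> P \<Longrightarrow> psd_on J (D p)) \<Longrightarrow> psd_on J (\<lambda>t s. \<Sum>p\<in>P. D p t s)"
  by (induction P rule: finite_induct) (auto intro: psd_on_zero psd_on_add)

text \<open>Pairs are switched from separate to common noise one at a time; the noise of all other
  pairs is absorbed into the base covariance, which stays semidefinite.\<close>

lemma orthant_prob_pairs:
  assumes J: "finite J" and "finite P" and "P \<subseteq> J \<times> J" "\<And>p. p \<in> P \<Longrightarrow> fst p \<noteq> snd p" "\<And>p. p \<in> P \<Longrightarrow> 0 \<le> e p" "psd_on J C"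
  shows "orthant_prob J (\<lambda>t s. C t s + (\<Sum>p\<in>P. e p * (of_bool (t = fst p) * of_bool (s = fst p) + of_bool (t = snd p) * of_bool (s = snd p)))) u
     \<le> orthant_prob J (\<lambda>t s. C t s + (\<Sum>p\<in>P. e p * ((of_bool (t = fst p) + of_bool (t = snd p)) * (of_bool (s = fst p) + of_bool (s = snd p))))) u"
  using assms(2-)
proof (induction P arbitrary: C rule: finite_induct)
  case (insert p P)
  define d where "d = (\<lambda>p t s. e p * (of_bool (t = fst p) * of_bool (s = fst p) + of_bool (t = snd p) * of_bool (s = snd p)))"
  define f where "f = (\<lambda>p t s. e p * ((of_bool (t = fst p) + of_bool (t = snd p)) * (of_bool (s = fst p) + of_bool (s = snd p))))"
  have pd: "psd_on J (d q)" if "q \<in> insert p P" for q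
    unfolding d_def by (intro psd_on_scale psd_on_add psd_on_rank_one insert.prems that)
  have pf: "psd_on J (f q)" if "q \<in> insert p P" for q
    unfolding f_def by (intro psd_on_scale psd_on_rank_one insert.prems that)
  have "orthant_prob J (\<lambda>t s. C t s + (\<Sum>q\<in>insert p P. d q t s)) u = orthant_prob J (\<lambda>t s. (C t s + d p t s) + (\<Sum>q\<in>P. d q t s)) u"
    using insert.hyps by (intro orthant_prob_cong) (auto simp: algebra_simps)
  also have "\<dots> \<le> orthant_prob J (\<lambda>t s. (C t s + d p t s) + (\<Sum>q\<in>P. f q t s)) u"
    unfolding d_def f_def
    by (rule insert.IH) (use insert.prems pd[of p] in \<open>auto intro!: psd_on_add simp: d_def\<close>)
  also have "\<dots> = orthant_prob J (\<lambda>t s. (C t s + (\<Sum>q\<in>P. f q t s)) + d p t s) u"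
    by (intro orthant_prob_cong) auto
  also have "\<dots> \<le> orthant_prob J (\<lambda>t s. (C t s + (\<Sum>q\<in>P. f q t s)) + f p t s) u"
    unfolding d_def f_def
    by (rule orthant_prob_pair[OF J])
      (use insert.prems insert.hyps pf in \<open>auto intro!: psd_on_add psd_on_sum simp: f_def\<close>)
  also have "\<dots> = orthant_prob J (\<lambda>t s. C t s + (\<Sum>q\<in>insert p P. f q t s)) u"
    using insert.hyps by (intro orthant_prob_cong) (auto simp: algebra_simps)
  finally show ?case by (simp add: d_def f_def)
qed simp

text \<open>Common noise for a pair raises not only the two off-diagonal entries but also the two
  variances. The surplus on the diagonal is the row sum of \<open>D\<close>; it is removed
  beforehand, and \<open>psd\<close> guarantees that a covariance is left.\<close>

lemma orthant_prob_step:
  assumes J: "finite J" and sym: "\<And>t s. t \<in> J \<Longrightarrow> s \<in> J \<Longrightarrow> D t s = D s t"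
    and D0: "\<And>t. t \<in> J \<Longrightarrow> D t t = 0" and Dn: "\<And>t s. t \<in> J \<Longrightarrow> s \<in> J \<Longrightarrow> 0 \<le> D t s"
    and psd: "psd_on J (\<lambda>t s. K t s - (if t = s then \<Sum>r\<in>J. D t r else 0))"
  shows "orthant_prob J K u \<le> orthant_prob J (\<lambda>t s. K t s + D t s) u"
proof -
  define C where "C = (\<lambda>t s. K t s - (if t = s then \<Sum>r\<in>J. D t r else 0))"
  \<comment> \<open>Halved because \<open>P\<close> contains each pair in both orders.\<close>
  define e where "e p = D (fst p) (snd p) / 2" for p
  define P where "P = {p \<in> J \<times> J. fst p \<noteq> snd p}"
  have zero: "e p = 0" if "p \<in> J \<times> J - P" for p using that D0 by (auto simp: e_def P_def)
  have sumP: "(\<Sum>p\<in>P. e p * g p) = (\<Sum>x\<in>J. \<Sum>y\<in>J. D x y / 2 * g (x, y))" for g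
  proof -
    have "(\<Sum>p\<in>P. e p * g p) = (\<Sum>p\<in>J \<times> J. e p * g p)"
      using J zero by (intro sum.mono_neutral_left) (auto simp: P_def)
    then show ?thesis by (simp add: sum.cartesian_product e_def case_prod_unfold)
  qed
  have del: "(\<Sum>x\<in>J. of_bool (t = x) * h x) = h t" "(\<Sum>x\<in>J. h x * of_bool (t = x)) = h t" if "t \<in> J" for t and h :: "'a \<Rightarrow> real"
    using J that by (simp_all add: of_bool_def if_distrib if_distribR cong: if_cong)
  have d: "(\<Sum>p\<in>P. e p * (of_bool (t = fst p) * of_bool (s = fst p) + of_bool (t = snd p) * of_bool (s = snd p)))
     = (if t = s then \<Sum>r\<in>J. D t r else 0)" if ts: "t \<in> J" "s \<in> J" for t s
  proof -
    have "(\<Sum>x\<in>J. \<Sum>y\<in>J. D x y / 2 * (of_bool (t = x) * of_bool (s = x) + of_bool (t = y) * of_bool (s = y)))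
      = (\<Sum>x\<in>J. of_bool (t = x) * (of_bool (s = x) * (\<Sum>y\<in>J. D x y / 2))) + (\<Sum>x\<in>J. \<Sum>y\<in>J. (D x y / 2 * of_bool (s = y)) * of_bool (t = y))"
      by (simp add: distrib_left sum.distrib sum_distrib_left mult_ac)
    also have "\<dots> = of_bool (s = t) * (\<Sum>y\<in>J. D t y / 2) + of_bool (s = t) * (\<Sum>x\<in>J. D x t / 2)"
      by (simp only: del ts) (simp add: sum_distrib_left sum_distrib_right mult.commute)
    also have "(\<Sum>x\<in>J. D x t / 2) = (\<Sum>x\<in>J. D t x / 2)" using sym ts by (intro sum.cong) auto
    finally show ?thesis unfolding sumP by (auto simp: sum_divide_distrib[symmetric])
  qed
  have f: "(\<Sum>p\<in>P. e p * ((of_bool (t = fst p) + of_bool (t = snd p)) * (of_bool (s = fst p) + of_bool (s = snd p))))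
     = (if t = s then \<Sum>r\<in>J. D t r else 0) + D t s" if ts: "t \<in> J" "s \<in> J" for t s
  proof -
    have "(\<Sum>p\<in>P. e p * ((of_bool (t = fst p) + of_bool (t = snd p)) * (of_bool (s = fst p) + of_bool (s = snd p))))
      = (\<Sum>p\<in>P. e p * (of_bool (t = fst p) * of_bool (s = fst p) + of_bool (t = snd p) * of_bool (s = snd p)))
       + (\<Sum>p\<in>P. e p * (of_bool (t = fst p) * of_bool (s = snd p) + of_bool (t = snd p) * of_bool (s = fst p)))"
      unfolding sum.distrib[symmetric] by (intro sum.cong) (auto simp: algebra_simps)
    also have "(\<Sum>p\<in>P. e p * (of_bool (t = fst p) * of_bool (s = snd p) + of_bool (t = snd p) * of_bool (s = fst p)))
      = (\<Sum>x\<in>J. of_bool (t = x) * (\<Sum>y\<in>J. D x y / 2 * of_bool (s = y))) + (\<Sum>x\<in>J. of_bool (s = x) * (\<Sum>y\<in>J. D x y / 2 * of_bool (t = y)))"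
      unfolding sumP by (simp add: distrib_left sum.distrib sum_distrib_left mult_ac)
    also have "\<dots> = D t s" unfolding del(1)[OF ts(1)] del(1)[OF ts(2)] del(2)[OF ts(1)] del(2)[OF ts(2)]
      using sym[OF ts] by simp
    finally show ?thesis unfolding d[OF ts] .
  qed
  have "orthant_prob J K u = orthant_prob J (\<lambda>t s. C t s + (\<Sum>p\<in>P. e p * (of_bool (t = fst p) * of_bool (s = fst p) + of_bool (t = snd p) * of_bool (s = snd p)))) u"
    by (rule orthant_prob_cong) (simp_all add: d C_def)
  also have "\<dots> \<le> orthant_prob J (\<lambda>t s. C t s + (\<Sum>p\<in>P. e p * ((of_bool (t = fst p) + of_bool (t = snd p)) * (of_bool (s = fst p) + of_bool (s = snd p))))) u"
    by (rule orthant_prob_pairs[OF J]) (use J Dn psd in \<open>auto simp: P_def C_def e_def\<close>)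
  also have "\<dots> = orthant_prob J (\<lambda>t s. K t s + D t s) u"
    by (rule orthant_prob_cong) (simp_all add: f C_def)
  finally show ?thesis .
qed

text \<open>\<open>C\<close> moves to \<open>C'\<close> along the segment in n equal steps. Once n
  exceeds R / \<open>\<delta>\<close>, the row sums of one step are at most \<open>\<delta>\<close>
  and can be taken out of the added white noise; what is left is a convex combination of
  \<open>C\<close> and \<open>C'\<close> plus a nonnegative diagonal.\<close>

lemma slepian_perturbed:
  assumes J: "finite J" and C: "psd_on J C" and C': "psd_on J C'"
    and diag: "\<And>t. t \<in> J \<Longrightarrow> C t t = C' t t" and le: "\<And>t s. t \<in> J \<Longrightarrow> s \<in> J \<Longrightarrow> C t s \<le> C' t s"
    and \<delta>: "0 < \<delta>"
  shows "orthant_prob J (\<lambda>t s. C t s + (if t = s then \<delta> else 0)) u \<le> orthant_prob J (\<lambda>t s. C' t s + (if t = s then \<delta> else 0)) u"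
proof -
  define D where "D t s = C' t s - C t s" for t s
  define R where "R = (\<Sum>t\<in>J. \<Sum>s\<in>J. D t s)"
  have D0: "0 \<le> D t s" if "t \<in> J" "s \<in> J" for t s using le that by (simp add: D_def)
  have row: "(\<Sum>s\<in>J. D t s) \<le> R" if "t \<in> J" for t
    unfolding R_def using J that D0 by (intro member_le_sum) (auto intro!: sum_nonneg)
  obtain n :: nat where n: "R / \<delta> < n" using reals_Archimedean2 by blast
  have "0 \<le> R" unfolding R_def by (intro sum_nonneg D0)
  then have n0: "0 < n" using n \<delta> by (metis divide_nonneg_pos of_nat_0_less_iff le_less_trans)
  have Rn: "R / n \<le> \<delta>" using n \<delta> n0 by (simp add: field_simps)
  define K where "K k t s = C t s + (real k / n) * D t s + (if t = s then \<delta> else 0)" for k t s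
  have "orthant_prob J (K 0) u \<le> orthant_prob J (K k) u" if "k \<le> n" for k
    using that
  proof (induction k)
    case (Suc k)
    have "orthant_prob J (K k) u \<le> orthant_prob J (\<lambda>t s. K k t s + D t s / n) u"
    proof (rule orthant_prob_step[OF J])
      have "psd_on J (\<lambda>t s. ((1 - real k / n) * C t s + (real k / n) * C' t s) + (if t = s then \<delta> - (\<Sum>r\<in>J. D t r / n) else 0))"
      proof (intro psd_on_add psd_on_scale C C' psd_on_diag J)
        fix t assume "t \<in> J"
        then have "(\<Sum>r\<in>J. D t r) / n \<le> R / n" using row by (intro divide_right_mono) auto
        then show "0 \<le> \<delta> - (\<Sum>r\<in>J. D t r / n)" using Rn by (simp add: sum_divide_distrib)
      qed (use Suc in \<open>auto simp: field_simps\<close>)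
      then show "psd_on J (\<lambda>t s. K k t s - (if t = s then \<Sum>r\<in>J. D t r / n else 0))"
        by (rule psd_on_cong) (auto simp: K_def D_def algebra_simps diff_divide_distrib)
    qed (use C C' D0 diag in \<open>auto simp: D_def psd_on_def\<close>)
    also have "\<dots> = orthant_prob J (K (Suc k)) u"
      by (rule orthant_prob_cong) (auto simp: K_def add_divide_distrib algebra_simps)
    finally show ?case using Suc by simp
  qed simp
  from this[of n] have "orthant_prob J (K 0) u \<le> orthant_prob J (K n) u" by simp
  moreover have "K 0 = (\<lambda>t s. C t s + (if t = s then \<delta> else 0))" "K n = (\<lambda>t s. C' t s + (if t = s then \<delta> else 0))"
    using n0 by (auto simp: K_def D_def fun_eq_iff)
  ultimately show ?thesis by simp
qed

lemma gaussian_vector_white: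
  assumes J: "finite J"
  shows "gaussian_vector (PiM J (\<lambda>_. std_normal_distribution)) J (\<lambda>t \<omega>. c * \<omega> t) (\<lambda>t s. if t = s then c\<^sup>2 else 0)"
proof (rule gaussian_vector_cong[OF gaussian_vector_linear[OF J, of "\<lambda>t j. of_bool (j = t) * c"]])
  have del: "(\<Sum>j\<in>J. of_bool (j = t) * h j) = h t" if "t \<in> J" for t and h :: "_ \<Rightarrow> real"
    using J that by (simp add: of_bool_def if_distrib if_distribR cong: if_cong)
  fix t assume t: "t \<in> J"
  show "(\<Sum>j\<in>J. of_bool (j = t) * c * \<omega> j) = c * \<omega> t" for \<omega> by (simp only: del[OF t] mult.assoc)
  show "(\<Sum>j\<in>J. of_bool (j = t) * c * (of_bool (j = s) * c)) = (if t = s then c\<^sup>2 else 0)" for s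
    by (simp only: del[OF t] mult.assoc) (simp add: power2_eq_square)
qed

text \<open>The noise has standard deviation \<open>e n ^ 2\<close>, while the level is raised by
  the larger amount \<open>e n\<close>. Thus a point satisfying the constraints, even with equality,
  eventually satisfies the perturbed ones, and a violation eventually persists. The indicators
  converge everywhere, also when a degenerate law charges the boundary of the orthant.\<close>

lemma orthant_prob_perturb_tendsto:
  assumes J: "finite J" and C: "psd_on J C" and e: "e \<longlonglongrightarrow> 0" "\<And>n. 0 < e n"
  shows "(\<lambda>n. orthant_prob J (\<lambda>t s. C t s + (if t = s then (e n ^ 2)\<^sup>2 else 0)) (\<lambda>t. u t + e n)) \<longlonglongrightarrow> orthant_prob J C u"
proof -
  obtain M :: "('a \<Rightarrow> real) measure" and V where G: "gaussian_vector M J V C"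
    using gaussian_vector_exists[OF J C] .
  define N where "N = (PiM J (\<lambda>_. std_normal_distribution) :: ('a \<Rightarrow> real) measure)"
  have G1: "gaussian_vector (M \<Otimes>\<^sub>M N) J (\<lambda>t p. V t (fst p) + c * snd p t) (\<lambda>t s. C t s + (if t = s then c\<^sup>2 else 0))" for c
    using gaussian_vector_add[OF G gaussian_vector_white[OF J, of c]] by (simp add: N_def)
  have G0: "gaussian_vector (M \<Otimes>\<^sub>M N) J (\<lambda>t p. V t (fst p)) C"
    by (rule gaussian_vector_cong[OF G1[of 0]]) auto
  note g1 = gaussian_vectorD[OF G1] and g0 = gaussian_vectorD[OF G0]
  interpret P: prob_space "M \<Otimes>\<^sub>M N" by (rule g0)
  define E where "E n = {p \<in> space (M \<Otimes>\<^sub>M N). \<forall>t\<in>J. V t (fst p) + (e n)^2 * snd p t \<le> u t + e n}" for n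
  define F where "F = {p \<in> space (M \<Otimes>\<^sub>M N). \<forall>t\<in>J. V t (fst p) \<le> u t}"
  note [measurable] = g1(3) g0(3)
  have [measurable]: "E n \<in> sets (M \<Otimes>\<^sub>M N)" "F \<in> sets (M \<Otimes>\<^sub>M N)" for n
    unfolding E_def F_def using J by measurable
  have "(\<lambda>n. LINT p|(M \<Otimes>\<^sub>M N). indicator (E n) p :: real) \<longlonglongrightarrow> (LINT p|(M \<Otimes>\<^sub>M N). indicator F p)"
  proof (rule integral_dominated_convergence[where w="\<lambda>_. 1"])
    show "AE p in M \<Otimes>\<^sub>M N. (\<lambda>n. indicator (E n) p :: real) \<longlonglongrightarrow> indicator F p"
    proof (rule AE_I2)
      fix p assume p: "p \<in> space (M \<Otimes>\<^sub>M N)"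
      have "\<forall>\<^sub>F n in sequentially. indicator (E n) p = (indicator F p :: real)"
      proof (cases "p \<in> F")
        case True
        have "\<forall>\<^sub>F n in sequentially. e n * snd p t < 1" for t
        proof -
          have "(\<lambda>n. e n * snd p t) \<longlonglongrightarrow> 0 * snd p t" by (intro tendsto_intros e)
          then show ?thesis by (rule order_tendstoD) simp
        qed
        then have "\<forall>\<^sub>F n in sequentially. \<forall>t\<in>J. e n * snd p t < 1" using J by (simp add: eventually_ball_finite)
        then show ?thesis
        proof eventually_elim
          case (elim n)
          have "V t (fst p) + (e n)^2 * snd p t \<le> u t + e n" if "t \<in> J" for t
          proof -
            have "e n * (e n * snd p t) \<le> e n * 1" using elim that e(2)[of n] by (intro mult_left_mono) (auto intro: less_imp_le)
            moreover have "V t (fst p) \<le> u t" using True that by (auto simp: F_def)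
            ultimately show ?thesis by (simp add: power2_eq_square mult.assoc)
          qed
          then have "p \<in> E n" using p by (auto simp: E_def)
          then show ?case using True by simp
        qed
      next
        case False
        then obtain t where t: "t \<in> J" "u t < V t (fst p)" using p by (auto simp: F_def not_le)
        have "(\<lambda>n. V t (fst p) + (e n)^2 * snd p t - e n) \<longlonglongrightarrow> V t (fst p) + 0^2 * snd p t - 0"
          by (intro tendsto_intros e)
        then have "\<forall>\<^sub>F n in sequentially. u t < V t (fst p) + (e n)^2 * snd p t - e n"
          by (rule order_tendstoD) (use t in simp)
        then show ?thesis
        proof eventually_elim
          case (elim n)
          then have "p \<notin> E n" using t by (auto simp: E_def not_le intro!: bexI[of _ t])
          then show ?case using False by simp
        qed
      qed
      then show "(\<lambda>n. indicator (E n) p :: real) \<longlonglongrightarrow> indicator F p" by (rule tendsto_eventually)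
    qed
  qed (auto split: split_indicator)
  then have "(\<lambda>n. measure (M \<Otimes>\<^sub>M N) (E n)) \<longlonglongrightarrow> measure (M \<Otimes>\<^sub>M N) F" by simp
  then show ?thesis unfolding E_def F_def orthant_prob_eq[OF G0] orthant_prob_eq[OF G1] .
qed

text \<open>The perturbed inequality holds for every noise level and every threshold; both sides
  converge along e = 1/(n+1).\<close>

theorem slepian:
  assumes J: "finite J" and C: "psd_on J C" and C': "psd_on J C'"
    and diag: "\<And>t. t \<in> J \<Longrightarrow> C t t = C' t t" and le: "\<And>t s. t \<in> J \<Longrightarrow> s \<in> J \<Longrightarrow> C t s \<le> C' t s"
  shows "orthant_prob J C u \<le> orthant_prob J C' u"
proof (rule LIMSEQ_le)
  have e: "(\<lambda>n. 1 / real (Suc n)) \<longlonglongrightarrow> 0" by (rule LIMSEQ_Suc[OF lim_1_over_n])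
  show "(\<lambda>n. orthant_prob J (\<lambda>t s. C t s + (if t = s then ((1 / real (Suc n)) ^ 2)\<^sup>2 else 0)) (\<lambda>t. u t + 1 / real (Suc n))) \<longlonglongrightarrow> orthant_prob J C u"
    by (rule orthant_prob_perturb_tendsto[OF J C e]) simp
  show "(\<lambda>n. orthant_prob J (\<lambda>t s. C' t s + (if t = s then ((1 / real (Suc n)) ^ 2)\<^sup>2 else 0)) (\<lambda>t. u t + 1 / real (Suc n))) \<longlonglongrightarrow> orthant_prob J C' u"
    by (rule orthant_prob_perturb_tendsto[OF J C' e]) simp
qed (intro exI[of _ 0] allI impI slepian_perturbed assms, simp_all)

lemma gaussian_vector_zero_extend:
  assumes "gaussian_vector M A X C" "A \<subseteq> J" "finite J"
  shows "gaussian_vector M J (\<lambda>t \<omega>. if t \<in> A then X t \<omega> else 0) (\<lambda>t s. if t \<in> A \<and> s \<in> A then C t s else 0)"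
proof -
  note g = gaussian_vectorD[OF assms(1)]
  have s: "(\<Sum>t\<in>J. if t \<in> A then f t else 0) = sum f A" for f :: "_ \<Rightarrow> real"
    using assms by (simp add: sum.inter_restrict[symmetric] Int_absorb1)
  have 1: "(\<Sum>t\<in>J. a t * (if t \<in> A then X t \<omega> else 0)) = (\<Sum>t\<in>A. a t * X t \<omega>)" for a \<omega>
    using s[of "\<lambda>t. a t * X t \<omega>"] by (simp add: if_distrib cong: if_cong)
  have 2: "quad_form J (\<lambda>t s. if t \<in> A \<and> s \<in> A then C t s else 0) a = quad_form A C a" for a
  proof -
    have "(\<Sum>s\<in>J. a t * a s * (if t \<in> A \<and> s \<in> A then C t s else 0)) = (if t \<in> A then \<Sum>s\<in>A. a t * a s * C t s else 0)" for t
      using s[of "\<lambda>s. a t * a s * C t s"] by (simp add: if_distrib cong: if_cong)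
    then show ?thesis using s[of "\<lambda>t. \<Sum>s\<in>A. a t * a s * C t s"] by (simp add: quad_form_def)
  qed
  have "(\<lambda>\<omega>. if t \<in> A then X t \<omega> else 0) \<in> borel_measurable M" for t using g(3) by (cases "t \<in> A") auto
  then show ?thesis using g assms(3) unfolding gaussian_vector_def 1 2 by auto
qed

text \<open>The blocks are realised on the two factors of a product space, each extended by zero to
  the other block.\<close>

lemma orthant_prob_block:
  assumes J: "finite A" "finite B" "A \<inter> B = {}" and C: "psd_on A C" "psd_on B C"
  defines "C0 \<equiv> (\<lambda>t s. if (t \<in> A \<and> s \<in> A) \<or> (t \<in> B \<and> s \<in> B) then C t s else 0)"
  shows "psd_on (A \<union> B) C0" "orthant_prob (A \<union> B) C0 u = orthant_prob A C u * orthant_prob B C u"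
proof -
  obtain M :: "('a \<Rightarrow> real) measure" and V where GA: "gaussian_vector M A V C"
    using gaussian_vector_exists[OF J(1) C(1)] .
  obtain N :: "('a \<Rightarrow> real) measure" and W where GB: "gaussian_vector N B W C"
    using gaussian_vector_exists[OF J(2) C(2)] .
  interpret M: prob_space M by (rule gaussian_vectorD[OF GA])
  interpret N: prob_space N by (rule gaussian_vectorD[OF GB])
  interpret pair_prob_space M N ..
  have G: "gaussian_vector (M \<Otimes>\<^sub>M N) (A \<union> B) (\<lambda>t p. if t \<in> A then V t (fst p) else W t (snd p)) C0"
    by (rule gaussian_vector_cong[OF gaussian_vector_add[OF gaussian_vector_zero_extend[OF GA, of "A \<union> B"] gaussian_vector_zero_extend[OF GB, of "A \<union> B"]]])
      (use J in \<open>auto simp: C0_def\<close>)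
  show "psd_on (A \<union> B) C0" by (rule gaussian_vector_psd[OF G])
  define E F where "E = {\<omega>\<in>space M. \<forall>t\<in>A. V t \<omega> \<le> u t}" and "F = {\<omega>\<in>space N. \<forall>t\<in>B. W t \<omega> \<le> u t}"
  note [measurable] = gaussian_vectorD(3)[OF GA] gaussian_vectorD(3)[OF GB]
  have [measurable]: "E \<in> sets M" "F \<in> sets N" unfolding E_def F_def using J by measurable
  have "{p \<in> space (M \<Otimes>\<^sub>M N). \<forall>t\<in>A \<union> B. (if t \<in> A then V t (fst p) else W t (snd p)) \<le> u t} = E \<times> F"
    using J(3) by (auto simp: E_def F_def space_pair_measure)
  then have "orthant_prob (A \<union> B) C0 u = measure (M \<Otimes>\<^sub>M N) (E \<times> F)" using orthant_prob_eq[OF G, of u] by simp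
  also have "\<dots> = measure M E * measure N F"
    by (simp add: measure_def N.emeasure_pair_measure_Times enn2real_mult)
  finally show "orthant_prob (A \<union> B) C0 u = orthant_prob A C u * orthant_prob B C u"
    using orthant_prob_eq[OF GA, of u] orthant_prob_eq[OF GB, of u] by (simp add: E_def F_def)
qed

text \<open>Deleting the nonnegative covariances between \<open>A\<close> and \<open>B - A\<close>
  makes the two blocks independent and, by Slepian, lowers the probability. Passing from
  \<open>B\<close> to \<open>B - A\<close> only raises its factor.\<close>

lemma orthant_prob_Un:
  assumes J: "finite A" "finite B" and C: "psd_on (A \<union> B) C" and nn: "\<And>t s. t \<in> A \<union> B \<Longrightarrow> s \<in> A \<union> B \<Longrightarrow> 0 \<le> C t s"
  shows "orthant_prob A C u * orthant_prob B C u \<le> orthant_prob (A \<union> B) C u"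
proof -
  define D where "D = B - A"
  have D: "finite D" "A \<inter> D = {}" "A \<union> D = A \<union> B" "D \<subseteq> B" using J by (auto simp: D_def)
  have pA: "psd_on A C" and pD: "psd_on D C" and pB: "psd_on B C"
    using C J D by (auto intro!: psd_on_subset[OF C])
  note bl = orthant_prob_block[OF J(1) D(1,2) pA pD]
  have "orthant_prob A C u * orthant_prob B C u \<le> orthant_prob A C u * orthant_prob D C u"
    using D J pB by (intro mult_left_mono orthant_prob_mono orthant_prob_nonneg) auto
  also have "\<dots> \<le> orthant_prob (A \<union> D) C u"
    unfolding bl(2)[symmetric] using J D C nn bl(1) by (intro slepian) auto
  finally show ?thesis by (simp add: D)
qed

lemma orthant_prob_reindex:
  assumes J: "finite J" and C: "psd_on (f ` J) C" and inj: "inj_on f J"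
  shows "orthant_prob (f ` J) C u = orthant_prob J (\<lambda>t s. C (f t) (f s)) (\<lambda>t. u (f t))"
proof -
  obtain M :: "('b \<Rightarrow> real) measure" and V where G: "gaussian_vector M (f ` J) V C"
    using gaussian_vector_exists[OF finite_imageI[OF J] C] .
  note g = gaussian_vectorD[OF G]
  define inv where "inv = the_inv_into J f"
  have inv: "inv (f t) = t" if "t \<in> J" for t using that inj by (simp add: inv_def the_inv_into_f_f)
  have "(LINT \<omega>|M. iexp (\<Sum>t\<in>J. a t * V (f t) \<omega>)) = complex_of_real (exp (- quad_form J (\<lambda>t s. C (f t) (f s)) a / 2))" for a
  proof -
    have "(\<Sum>t\<in>f ` J. a (inv t) * V t \<omega>) = (\<Sum>t\<in>J. a t * V (f t) \<omega>)" for \<omega>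
      using inj inv by (simp add: sum.reindex)
    moreover have "quad_form (f ` J) C (\<lambda>t. a (inv t)) = quad_form J (\<lambda>t s. C (f t) (f s)) a"
      using inj inv by (simp add: quad_form_def sum.reindex)
    ultimately show ?thesis using g(5)[of "\<lambda>t. a (inv t)"] by simp
  qed
  then have G': "gaussian_vector M J (\<lambda>t. V (f t)) (\<lambda>t s. C (f t) (f s))"
    using g J by (auto simp: gaussian_vector_def)
  show ?thesis using orthant_prob_eq[OF G, of u] orthant_prob_eq[OF G', of "\<lambda>t. u (f t)"] by simp
qed

section \<open>Persistence probabilities and change of level\<close>

text \<open>The point mass at 0 and the normal densities obey one formula when the variance is
  written as a second moment.\<close>

lemma centered_gaussian_iexp:
  assumes M: "prob_space M" and Z: "centered_gaussian M Z"
  shows "integrable M (\<lambda>\<omega>. (Z \<omega>)\<^sup>2)"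
    and "(LINT \<omega>|M. iexp (Z \<omega>)) = complex_of_real (exp (- (LINT \<omega>|M. (Z \<omega>)\<^sup>2) / 2))"
proof -
  interpret prob_space M by fact
  have [measurable]: "Z \<in> borel_measurable M" using Z by (simp add: centered_gaussian_def)
  have "integrable M (\<lambda>\<omega>. (Z \<omega>)\<^sup>2) \<and> (LINT \<omega>|M. iexp (Z \<omega>)) = complex_of_real (exp (- (LINT \<omega>|M. (Z \<omega>)\<^sup>2) / 2))"
  proof (cases "AE \<omega> in M. Z \<omega> = 0")
    case True
    then have "(LINT \<omega>|M. (Z \<omega>)\<^sup>2) = 0" by (intro integral_eq_zero_AE) auto
    moreover have "(LINT \<omega>|M. iexp (Z \<omega>)) = (LINT \<omega>|M. 1)"
      using True by (intro integral_cong_AE) auto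
    moreover have "integrable M (\<lambda>\<omega>. (Z \<omega>)\<^sup>2) \<longleftrightarrow> integrable M (\<lambda>\<omega>. 0::real)"
      using True by (intro integrable_cong_AE) auto
    ultimately show ?thesis by (simp add: prob_space)
  next
    case False
    then obtain \<sigma> where \<sigma>: "0 < \<sigma>" "distributed M lborel Z (normal_density 0 \<sigma>)"
      using Z by (auto simp: centered_gaussian_def)
    define g where "g \<omega> = Z \<omega> / \<sigma>" for \<omega>
    have [measurable]: "g \<in> borel_measurable M" unfolding g_def by measurable
    have "distributed M lborel g std_normal_density"
      using \<sigma> normal_standard_normal_convert[OF \<sigma>(1), of Z 0] by (simp add: g_def[abs_def])
    then have "distr M lborel g = std_normal_distribution" by (simp add: distributed_def)
    moreover have "distr M lborel g = distr M borel g" by (intro distr_cong) auto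
    ultimately have d: "distr M borel g = std_normal_distribution" by simp
    have Zg: "Z \<omega> = \<sigma> * g \<omega>" for \<omega> using \<sigma> by (simp add: g_def)
    have "(LINT \<omega>|M. iexp (Z \<omega>)) = (LINT z|distr M borel g. iexp (\<sigma> * z))"
      by (subst integral_distr) (auto simp: Zg)
    then have 1: "(LINT \<omega>|M. iexp (Z \<omega>)) = complex_of_real (exp (- \<sigma>\<^sup>2 / 2))"
      unfolding d integral_iexp_std_normal .
    have m2: "(LINT z|std_normal_distribution. z\<^sup>2) = 1" "integrable std_normal_distribution (\<lambda>z::real. z\<^sup>2)"
      using std_normal_distribution_even_moments[of 1] by simp_all
    have "integrable (distr M borel g) (\<lambda>z. z\<^sup>2)" using m2 d by simp
    then have i: "integrable M (\<lambda>\<omega>. (g \<omega>)\<^sup>2)" by (subst (asm) integrable_distr_eq) auto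
    have "(LINT z|distr M borel g. z\<^sup>2) = (LINT \<omega>|M. (g \<omega>)\<^sup>2)" by (rule integral_distr) auto
    then have "(LINT \<omega>|M. (g \<omega>)\<^sup>2) = 1" using m2 d by simp
    then have "(LINT \<omega>|M. (Z \<omega>)\<^sup>2) = \<sigma>\<^sup>2" by (simp add: Zg power_mult_distrib)
    moreover have "integrable M (\<lambda>\<omega>. (Z \<omega>)\<^sup>2)" using i by (simp add: Zg power_mult_distrib)
    ultimately show ?thesis using 1 by simp
  qed
  then show "integrable M (\<lambda>\<omega>. (Z \<omega>)\<^sup>2)"
    and "(LINT \<omega>|M. iexp (Z \<omega>)) = complex_of_real (exp (- (LINT \<omega>|M. (Z \<omega>)\<^sup>2) / 2))" by auto
qed

lemma centered_gaussian_process_measurable: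
  assumes "centered_gaussian_process M I X" "t \<in> I"
  shows "X t \<in> borel_measurable M" "integrable M (\<lambda>\<omega>. (X t \<omega>)\<^sup>2)"
proof -
  have "\<forall>J a. finite J \<longrightarrow> J \<subseteq> I \<longrightarrow> centered_gaussian M (\<lambda>\<omega>. \<Sum>s\<in>J. a s * X s \<omega>)"
    using assms unfolding centered_gaussian_process_def by blast
  from this[rule_format, of "{t}" "\<lambda>_. 1"] assms(2) have "centered_gaussian M (\<lambda>\<omega>. \<Sum>s\<in>{t}. 1 * X s \<omega>)" by simp
  then have "centered_gaussian M (X t)" by simp
  then show "X t \<in> borel_measurable M" "integrable M (\<lambda>\<omega>. (X t \<omega>)\<^sup>2)"
    using assms centered_gaussian_iexp(1) by (auto simp: centered_gaussian_def centered_gaussian_process_def)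
qed

lemma integrable_mult_of_squares:
  fixes f g :: "'a \<Rightarrow> real"
  assumes "f \<in> borel_measurable M" "g \<in> borel_measurable M"
    "integrable M (\<lambda>\<omega>. (f \<omega>)\<^sup>2)" "integrable M (\<lambda>\<omega>. (g \<omega>)\<^sup>2)"
  shows "integrable M (\<lambda>\<omega>. f \<omega> * g \<omega>)"
proof (rule Bochner_Integration.integrable_bound)
  show "integrable M (\<lambda>\<omega>. (f \<omega>)\<^sup>2 + (g \<omega>)\<^sup>2)" using assms by auto
  have "\<bar>x * y\<bar> \<le> x\<^sup>2 + y\<^sup>2" for x y :: real
  proof -
    have "0 \<le> (\<bar>x\<bar> - \<bar>y\<bar>)\<^sup>2" by simp
    then have "2 * \<bar>x * y\<bar> \<le> x\<^sup>2 + y\<^sup>2" by (simp add: power2_diff abs_mult)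
    then show ?thesis by linarith
  qed
  then show "AE \<omega> in M. norm (f \<omega> * g \<omega>) \<le> norm ((f \<omega>)\<^sup>2 + (g \<omega>)\<^sup>2)" by (intro AE_I2) auto
qed (use assms in measurable)

text \<open>The law of a linear combination is fixed by its second moment, which expands bilinearly
  into the quadratic form of the covariance.\<close>

lemma gaussian_vector_of_process:
  assumes X: "centered_gaussian_process M I X" and J: "finite J" "J \<subseteq> I"
  shows "gaussian_vector M J X (covariance M X)"
proof -
  have M: "prob_space M" using X by (simp add: centered_gaussian_process_def)
  note m = centered_gaussian_process_measurable[OF X]
  have "(LINT \<omega>|M. iexp (\<Sum>t\<in>J. a t * X t \<omega>)) = complex_of_real (exp (- quad_form J (covariance M X) a / 2))" for a
  proof -
    have cg: "centered_gaussian M (\<lambda>\<omega>. \<Sum>t\<in>J. a t * X t \<omega>)" using X J by (simp add: centered_gaussian_process_def)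
    have i: "integrable M (\<lambda>\<omega>. X t \<omega> * X s \<omega>)" if "t \<in> J" "s \<in> J" for t s
      using J that m by (intro integrable_mult_of_squares) auto
    have "(LINT \<omega>|M. (\<Sum>t\<in>J. a t * X t \<omega>)\<^sup>2) = (LINT \<omega>|M. (\<Sum>t\<in>J. \<Sum>s\<in>J. a t * a s * (X t \<omega> * X s \<omega>)))"
      by (simp add: power2_eq_square sum_product mult_ac)
    also have "\<dots> = (\<Sum>t\<in>J. LINT \<omega>|M. (\<Sum>s\<in>J. a t * a s * (X t \<omega> * X s \<omega>)))"
      by (intro Bochner_Integration.integral_sum Bochner_Integration.integrable_sum integrable_mult_right i)
    also have "\<dots> = (\<Sum>t\<in>J. \<Sum>s\<in>J. LINT \<omega>|M. a t * a s * (X t \<omega> * X s \<omega>))"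
      by (intro sum.cong refl Bochner_Integration.integral_sum integrable_mult_right i)
    also have "\<dots> = quad_form J (covariance M X) a" by (simp add: quad_form_def covariance_def)
    finally show ?thesis using centered_gaussian_iexp(2)[OF M cg] by simp
  qed
  then show ?thesis using M J m unfolding gaussian_vector_def
    by (auto simp: covariance_def mult.commute simp del: of_real_sum of_real_mult)
qed

section \<open>Persistence over arbitrary index sets\<close>

text \<open>An infimum over finite subsets is a function of the covariance alone and inherits the
  finite inequalities without any question of measurability. \<open>persistence_prob_eq\<close>
  links it to actual events.\<close>

definition persistence_prob :: "'i set \<Rightarrow> ('i \<Rightarrow> 'i \<Rightarrow> real) \<Rightarrow> ('i \<Rightarrow> real) \<Rightarrow> real" where
  "persistence_prob S C u = (INF J\<in>{J. finite J \<and> J \<subseteq> S}. orthant_prob J C u)"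

lemma persistence_prob_le: "finite J \<Longrightarrow> J \<subseteq> S \<Longrightarrow> persistence_prob S C u \<le> orthant_prob J C u"
  unfolding persistence_prob_def
  by (intro cINF_lower bdd_belowI[of _ 0]) (auto simp: orthant_prob_nonneg)

lemma persistence_prob_ge: "(\<And>J. finite J \<Longrightarrow> J \<subseteq> S \<Longrightarrow> c \<le> orthant_prob J C u) \<Longrightarrow> c \<le> persistence_prob S C u"
  unfolding persistence_prob_def by (rule cINF_greatest) auto

lemma persistence_prob_nonneg: "0 \<le> persistence_prob S C u"
  by (intro persistence_prob_ge orthant_prob_nonneg)

lemma persistence_prob_le_1: "persistence_prob S C u \<le> 1"
  using persistence_prob_le[of "{}" S C u] orthant_prob_le_1[of "{}" C u] by simp

lemma persistence_prob_mono:
  assumes C: "\<And>J. finite J \<Longrightarrow> psd_on J C" and "S' \<subseteq> S" "\<And>t. t \<in> S' \<Longrightarrow> u t \<le> u' t"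
  shows "persistence_prob S C u \<le> persistence_prob S' C u'"
proof (rule persistence_prob_ge)
  fix J assume J: "finite J" "J \<subseteq> S'"
  then have "persistence_prob S C u \<le> orthant_prob J C u" using assms by (intro persistence_prob_le) auto
  also have "\<dots> \<le> orthant_prob J C u'" using J assms by (intro orthant_prob_mono) auto
  finally show "persistence_prob S C u \<le> orthant_prob J C u'" .
qed

lemma persistence_prob_Un:
  assumes C: "\<And>J. finite J \<Longrightarrow> psd_on J C" and nn: "\<And>t s. 0 \<le> C t s"
  shows "persistence_prob A C u * persistence_prob B C u \<le> persistence_prob (A \<union> B) C u"
proof (rule persistence_prob_ge)
  fix J assume J: "finite J" "J \<subseteq> A \<union> B"
  have "persistence_prob A C u * persistence_prob B C u \<le> orthant_prob (J \<inter> A) C u * orthant_prob (J \<inter> B) C u"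
    using J by (intro mult_mono persistence_prob_le persistence_prob_nonneg orthant_prob_nonneg) auto
  also have "\<dots> \<le> orthant_prob (J \<inter> A \<union> J \<inter> B) C u"
    using J C nn by (intro orthant_prob_Un) auto
  also have "J \<inter> A \<union> J \<inter> B = J" using J by auto
  finally show "persistence_prob A C u * persistence_prob B C u \<le> orthant_prob J C u" .
qed

lemma persistence_prob_UN:
  assumes C: "\<And>J. finite J \<Longrightarrow> psd_on J C" and nn: "\<And>t s. 0 \<le> C t s"
    and "finite F" and p: "0 \<le> p" and ge: "\<And>i. i \<in> F \<Longrightarrow> p \<le> persistence_prob (A i) C u"
  shows "p ^ card F \<le> persistence_prob (\<Union>i\<in>F. A i) C u"
  using \<open>finite F\<close> ge
proof (induction F rule: finite_induct)
  case empty
  interpret S: prob_space std_normal_distribution by (rule prob_space_std_normal)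
  interpret product_prob_space "\<lambda>_. std_normal_distribution" "{} :: 'a set" ..
  have "orthant_prob {} C u = 1" by (simp add: orthant_prob_def Let_def P.prob_space)
  then show ?case by (intro persistence_prob_ge) auto
next
  case (insert i F)
  have "p * p ^ card F \<le> persistence_prob (A i) C u * persistence_prob (\<Union>i\<in>F. A i) C u"
    using insert p by (intro mult_mono persistence_prob_nonneg) auto
  also have "\<dots> \<le> persistence_prob (A i \<union> (\<Union>i\<in>F. A i)) C u" by (rule persistence_prob_Un[OF C nn])
  finally show ?case using insert by simp
qed

lemma persistence_prob_image:
  assumes C: "\<And>J. finite J \<Longrightarrow> psd_on J C" and f: "inj f"
  shows "persistence_prob (f ` S) C u = persistence_prob S (\<lambda>t s. C (f t) (f s)) (\<lambda>t. u (f t))"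
proof (rule antisym)
  have fi: "inj_on f J" for J using f by (rule inj_on_subset) simp
  show "persistence_prob (f ` S) C u \<le> persistence_prob S (\<lambda>t s. C (f t) (f s)) (\<lambda>t. u (f t))"
  proof (rule persistence_prob_ge)
    fix J assume "finite J" "J \<subseteq> S"
    then show "persistence_prob (f ` S) C u \<le> orthant_prob J (\<lambda>t s. C (f t) (f s)) (\<lambda>t. u (f t))"
      using orthant_prob_reindex[of J f C u] C fi persistence_prob_le[of "f ` J" "f ` S" C u] by force
  qed
  show "persistence_prob S (\<lambda>t s. C (f t) (f s)) (\<lambda>t. u (f t)) \<le> persistence_prob (f ` S) C u"
  proof (rule persistence_prob_ge)
    fix J assume "finite J" "J \<subseteq> f ` S"
    then obtain K where K: "finite K" "K \<subseteq> S" "J = f ` K" by (meson finite_subset_image)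
    then show "persistence_prob S (\<lambda>t s. C (f t) (f s)) (\<lambda>t. u (f t)) \<le> orthant_prob J C u"
      using orthant_prob_reindex[of K f C u] C fi persistence_prob_le[of K S] by simp
  qed
qed

text \<open>By continuity the constraint on a countable dense subset \<open>D\<close> forces it on
  \<open>S\<close>. Along an enumeration of \<open>D\<close> the finite events decrease to the full
  one, so the infimum is not larger than its probability.\<close>

lemma persistence_prob_eq:
  fixes X :: "'t::euclidean_space \<Rightarrow> 'w \<Rightarrow> real"
  assumes N: "prob_space N" and g: "\<And>J. finite J \<Longrightarrow> J \<subseteq> S \<Longrightarrow> gaussian_vector N J X C"
    and X: "\<And>\<omega>. \<omega> \<in> space N \<Longrightarrow> continuous_on S (\<lambda>t. X t \<omega>)" and u: "continuous_on S u"
  shows "{\<omega>\<in>space N. \<forall>t\<in>S. X t \<omega> \<le> u t} \<in> sets N"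
    and "measure N {\<omega>\<in>space N. \<forall>t\<in>S. X t \<omega> \<le> u t} = persistence_prob S C u"
proof -
  interpret prob_space N by fact
  obtain D where D: "countable D" "D \<subseteq> S" "S \<subseteq> closure D" using separable[of S] by blast
  have mS: "X t \<in> borel_measurable N" if "t \<in> S" for t using gaussian_vectorD(3)[OF g[of "{t}"]] that by auto
  have ev: "{\<omega>\<in>space N. \<forall>t\<in>S. X t \<omega> \<le> u t} = {\<omega>\<in>space N. \<forall>t\<in>D. X t \<omega> \<le> u t}"
  proof (intro Collect_cong conj_cong refl iffI ballI)
    fix \<omega> t assume \<omega>: "\<omega> \<in> space N" and H: "\<forall>t\<in>D. X t \<omega> \<le> u t" and t: "t \<in> S"
    obtain x where x: "\<And>n. x n \<in> D" "x \<longlonglongrightarrow> t" using subsetD[OF D(3) t] closure_sequential[of t D] by auto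
    have xS: "\<forall>n. x n \<in> S" using x D by auto
    have 1: "(\<lambda>n. X (x n) \<omega>) \<longlonglongrightarrow> X t \<omega>" "(\<lambda>n. u (x n)) \<longlonglongrightarrow> u t"
      using continuous_on_tendsto_compose[OF X[OF \<omega>] x(2) t] continuous_on_tendsto_compose[OF u x(2) t] xS by auto
    show "X t \<omega> \<le> u t" using x H by (intro LIMSEQ_le[OF 1]) auto
  qed (use D in auto)
  have mD: "{\<omega>\<in>space N. \<forall>t\<in>D. X t \<omega> \<le> u t} \<in> sets N"
  proof -
    have "{\<omega>\<in>space N. X t \<omega> \<le> u t} \<in> sets N" if "t \<in> D" for t
      using mS[of t] that D(2) by auto
    then show ?thesis using D(1) by (rule sets.sets_Collect_countable_All')
  qed
  then show "{\<omega>\<in>space N. \<forall>t\<in>S. X t \<omega> \<le> u t} \<in> sets N" by (simp add: ev)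
  show "measure N {\<omega>\<in>space N. \<forall>t\<in>S. X t \<omega> \<le> u t} = persistence_prob S C u"
  proof (rule antisym)
    show "measure N {\<omega>\<in>space N. \<forall>t\<in>S. X t \<omega> \<le> u t} \<le> persistence_prob S C u"
    proof (rule persistence_prob_ge)
      fix J assume J: "finite J" "J \<subseteq> S"
      have "measure N {\<omega>\<in>space N. \<forall>t\<in>S. X t \<omega> \<le> u t} \<le> measure N {\<omega>\<in>space N. \<forall>t\<in>J. X t \<omega> \<le> u t}"
        using J mS by (intro finite_measure_mono sets.sets_Collect_countable_All' countable_finite) auto
      then show "measure N {\<omega>\<in>space N. \<forall>t\<in>S. X t \<omega> \<le> u t} \<le> orthant_prob J C u"
        using orthant_prob_eq[OF g[OF J]] by simp
    qed
    show "persistence_prob S C u \<le> measure N {\<omega>\<in>space N. \<forall>t\<in>S. X t \<omega> \<le> u t}"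
    proof (cases "D = {}")
      case True
      then show ?thesis unfolding ev using persistence_prob_le_1 by (simp add: prob_space)
    next
      case False
      define F where "F n = from_nat_into D ` {..<n}" for n :: nat
      define E where "E n = {\<omega>\<in>space N. \<forall>t\<in>F n. X t \<omega> \<le> u t}" for n
      have FD: "finite (F n)" "F n \<subseteq> D" for n using from_nat_into[OF False] by (auto simp: F_def)
      have E: "E n \<in> sets N" for n unfolding E_def
        using FD[of n] D mS by (intro sets.sets_Collect_countable_All' countable_finite) auto
      have "(\<Union>n. F n) = D" using range_from_nat_into[OF False D(1)] by (auto simp: F_def)
      then have I: "(\<Inter>n. E n) = {\<omega>\<in>space N. \<forall>t\<in>D. X t \<omega> \<le> u t}" by (auto simp: E_def)
      have "decseq E" unfolding decseq_def E_def F_def by auto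
      then have "(\<lambda>n. measure N (E n)) \<longlonglongrightarrow> measure N (\<Inter>n. E n)"
        using E by (intro finite_Lim_measure_decseq) auto
      moreover have "persistence_prob S C u \<le> measure N (E n)" for n
        using orthant_prob_eq[OF g, of "F n" u] persistence_prob_le[of "F n" S C u] FD[of n] D(2) by (auto simp: E_def)
      ultimately show ?thesis unfolding ev I[symmetric] by (intro LIMSEQ_le_const) auto
    qed
  qed
qed

section \<open>Gaussian shifts and change of level\<close>

text \<open>For z <= -M, completing the square bounds the density at z by exp(-M^2/2) times the
  density at z + M, whose total mass is 1.\<close>

lemma std_normal_tail:
  assumes "0 \<le> M" shows "measure std_normal_distribution {..- M} \<le> exp (- M\<^sup>2 / 2)"
proof -
  interpret S: prob_space std_normal_distribution by (rule prob_space_std_normal)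
  have "emeasure std_normal_distribution {..- M} = (\<integral>\<^sup>+z. ennreal (std_normal_density z) * indicator {..- M} z \<partial>lborel)"
    by (simp add: emeasure_density)
  also have "\<dots> \<le> (\<integral>\<^sup>+z. ennreal (exp (- M\<^sup>2 / 2)) * ennreal (std_normal_density (M + 1 * z)) \<partial>lborel)"
  proof (rule nn_integral_mono)
    fix z :: real
    have "std_normal_density z \<le> exp (- M\<^sup>2 / 2) * std_normal_density (M + z)" if "z \<le> - M"
    proof -
      have "M * (z + M) \<le> 0" using that assms by (intro mult_nonneg_nonpos) auto
      then have "exp (- z\<^sup>2 / 2) \<le> exp (- M\<^sup>2 / 2 + - (M + z)\<^sup>2 / 2)"
        by (simp add: power2_eq_square algebra_simps)
      then show ?thesis by (simp add: std_normal_density_def exp_add[symmetric] divide_right_mono)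
    qed
    then show "ennreal (std_normal_density z) * indicator {..- M} z \<le> ennreal (exp (- M\<^sup>2 / 2)) * ennreal (std_normal_density (M + 1 * z))"
      by (auto split: split_indicator simp: ennreal_mult[symmetric] intro!: ennreal_leI)
  qed
  also have "\<dots> = ennreal (exp (- M\<^sup>2 / 2)) * (\<integral>\<^sup>+z. ennreal (std_normal_density z) \<partial>lborel)"
    using nn_integral_real_affine[of "\<lambda>z. ennreal (std_normal_density z)" 1 M] by (simp add: nn_integral_cmult)
  also have "(\<integral>\<^sup>+z. ennreal (std_normal_density z) \<partial>lborel) = 1"
    using S.emeasure_space_1 by (simp add: emeasure_density)
  finally show ?thesis by (simp add: S.emeasure_eq_measure)
qed

text \<open>The ratio of the normal densities at z and z - m is exp(-m z + m^2/2). It is at most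
  exp(M m + m^2/2) for z > -M; the remaining half line is discarded at the price of its
  mass.\<close>

lemma nn_integral_std_normal_shift:
  fixes G :: "real \<Rightarrow> ennreal"
  assumes [measurable]: "G \<in> borel_measurable borel" and G: "\<And>z. G z \<le> 1" and M: "0 \<le> M" and m: "0 \<le> m"
  shows "(\<integral>\<^sup>+z. G (z - m) \<partial>std_normal_distribution) \<le> ennreal (exp (- M\<^sup>2 / 2)) + ennreal (exp (M * m + m\<^sup>2 / 2)) * (\<integral>\<^sup>+z. G z \<partial>std_normal_distribution)"
proof -
  let ?n = "\<lambda>z. ennreal (std_normal_density z)"
  let ?K = "exp (M * m + m\<^sup>2 / 2)"
  interpret S: prob_space std_normal_distribution by (rule prob_space_std_normal)
  have "(\<integral>\<^sup>+z. G (z - m) \<partial>std_normal_distribution) = (\<integral>\<^sup>+z. ?n z * G (z - m) \<partial>lborel)"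
    by (simp add: nn_integral_density)
  also have "\<dots> \<le> (\<integral>\<^sup>+z. ?n z * indicator {..- M} z + ennreal ?K * (?n (- m + 1 * z) * G (- m + 1 * z)) \<partial>lborel)"
  proof (rule nn_integral_mono)
    fix z :: real
    show "?n z * G (z - m) \<le> ?n z * indicator {..- M} z + ennreal ?K * (?n (- m + 1 * z) * G (- m + 1 * z))"
    proof (cases "z \<le> - M")
      case True
      then have "?n z * G (z - m) \<le> ?n z * indicator {..- M} z" using G by (intro mult_left_mono) auto
      then show ?thesis by (simp add: add_increasing2)
    next
      case False
      then have "- (m * z) \<le> m * M" using m mult_left_mono[of "- z" M m] by simp
      then have "exp (- z\<^sup>2 / 2) \<le> exp (M * m + m\<^sup>2 / 2 + - (z - m)\<^sup>2 / 2)"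
        by (simp add: power2_eq_square algebra_simps add_divide_distrib diff_divide_distrib)
      then have "std_normal_density z \<le> ?K * std_normal_density (z - m)"
        by (simp add: std_normal_density_def exp_add[symmetric] divide_right_mono)
      then have "?n z \<le> ennreal ?K * ?n (z - m)" by (simp add: ennreal_mult[symmetric] ennreal_leI)
      then have "?n z * G (z - m) \<le> (ennreal ?K * ?n (z - m)) * G (z - m)" by (rule mult_right_mono) simp
      then show ?thesis by (simp add: add_increasing mult.assoc)
    qed
  qed
  also have "\<dots> = (\<integral>\<^sup>+z. ?n z * indicator {..- M} z \<partial>lborel) + ennreal ?K * (\<integral>\<^sup>+z. ?n (- m + 1 * z) * G (- m + 1 * z) \<partial>lborel)"
    by (simp add: nn_integral_add nn_integral_cmult)
  also have "(\<integral>\<^sup>+z. ?n z * indicator {..- M} z \<partial>lborel) = ennreal (measure std_normal_distribution {..- M})"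
    by (simp add: emeasure_density[symmetric] S.emeasure_eq_measure)
  also have "(\<integral>\<^sup>+z. ?n (- m + 1 * z) * G (- m + 1 * z) \<partial>lborel) = (\<integral>\<^sup>+z. ?n z * G z \<partial>lborel)"
    using nn_integral_real_affine[of "\<lambda>z. ?n z * G z" 1 "- m"] by simp
  also have "\<dots> = (\<integral>\<^sup>+z. G z \<partial>std_normal_distribution)" by (simp add: nn_integral_density)
  finally show ?thesis using std_normal_tail[OF M] by (meson add_right_mono ennreal_leI order_trans)
qed

text \<open>With Z the sum of the X_b over b in \<open>F\<close>, \<open>\<phi> t\<close> is the
  covariance of X_t with Z and \<open>v\<close> the variance of Z, so the kernel is that of the
  residual after regression on Z. The test vector adds the optimal multiple x = -r/v of Z.\<close>

lemma psd_on_schur: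
  assumes C: "psd_on (J \<union> F) C" and fin: "finite J" "finite F"
  defines "\<phi> \<equiv> (\<lambda>t. \<Sum>b\<in>F. C b t)" and "v \<equiv> (\<Sum>a\<in>F. \<Sum>b\<in>F. C a b)"
  assumes v: "0 < v"
  shows "psd_on J (\<lambda>t s. C t s - \<phi> t * \<phi> s / v)"
proof -
  define K where "K = J \<union> F"
  have K: "finite K" "J \<subseteq> K" "F \<subseteq> K" using fin by (auto simp: K_def)
  have sym: "C t s = C s t" if "t \<in> K" "s \<in> K" for t s using C that by (auto simp: psd_on_def K_def)
  have del: "(\<Sum>k\<in>K. of_bool (k \<in> A) * h k) = sum h A" if "A \<subseteq> K" for A and h :: "'a \<Rightarrow> real"
    using K that by (simp add: of_bool_def if_distrib if_distribR sum.inter_restrict[symmetric] Int_absorb1 cong: if_cong)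
  have "0 \<le> quad_form J (\<lambda>t s. C t s - \<phi> t * \<phi> s / v) a" for a
  proof -
    define r where "r = (\<Sum>t\<in>J. a t * \<phi> t)"
    define x where "x = - r / v"
    define \<alpha> where "\<alpha> k = of_bool (k \<in> J) * a k + of_bool (k \<in> F) * x" for k
    have "0 \<le> quad_form K C \<alpha>" using C by (auto simp: psd_on_def K_def)
    also have "quad_form K C \<alpha> = (\<Sum>t\<in>K. of_bool (t \<in> J) * (\<Sum>s\<in>K. of_bool (s \<in> J) * (a t * a s * C t s)))
      + (\<Sum>t\<in>K. of_bool (t \<in> F) * (\<Sum>s\<in>K. of_bool (s \<in> J) * (x * a s * C t s)))
      + (\<Sum>t\<in>K. of_bool (t \<in> J) * (\<Sum>s\<in>K. of_bool (s \<in> F) * (a t * x * C t s)))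
      + (\<Sum>t\<in>K. of_bool (t \<in> F) * (\<Sum>s\<in>K. of_bool (s \<in> F) * (x * x * C t s)))"
      unfolding quad_form_def \<alpha>_def sum.distrib[symmetric] sum_distrib_left distrib_left[symmetric]
      by (intro sum.cong refl) (simp add: algebra_simps)
    also have "\<dots> = quad_form J C a + (\<Sum>t\<in>F. \<Sum>s\<in>J. x * a s * C t s) + (\<Sum>t\<in>J. \<Sum>s\<in>F. a t * x * C t s) + (\<Sum>t\<in>F. \<Sum>s\<in>F. x * x * C t s)"
      unfolding del[OF K(2)] del[OF K(3)] quad_form_def ..
    also have "(\<Sum>t\<in>F. \<Sum>s\<in>J. x * a s * C t s) = x * r"
      unfolding r_def \<phi>_def sum_distrib_left by (subst sum.swap) (simp add: mult_ac)
    also have "(\<Sum>t\<in>J. \<Sum>s\<in>F. a t * x * C t s) = x * r"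
      unfolding r_def \<phi>_def sum_distrib_left using sym K by (intro sum.cong refl) (auto simp: mult_ac subset_iff)
    also have "(\<Sum>t\<in>F. \<Sum>s\<in>F. x * x * C t s) = x * x * v" unfolding v_def sum_distrib_left ..
    also have "quad_form J C a + x * r + x * r + x * x * v = quad_form J C a - r\<^sup>2 / v"
      using v by (simp add: x_def power2_eq_square field_simps)
    also have "\<dots> = quad_form J (\<lambda>t s. C t s + (- 1 / v) * (\<phi> t * \<phi> s)) a"
      unfolding quad_form_add quad_form_scale quad_form_rank_one r_def by simp
    finally show ?thesis by simp
  qed
  then show ?thesis using sym K by (auto simp: psd_on_def subset_iff)
qed

text \<open>A Cameron--Martin shift in the direction of the single variable
  $\sum_{b\in F} X_b$, whose covariance with $X_t$ is $\varphi(t)$.\<close>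

lemma orthant_prob_level_change:
  assumes C: "psd_on (J \<union> F) C" and fin: "finite J" "finite F"
  defines "\<phi> \<equiv> (\<lambda>t. \<Sum>b\<in>F. C b t)" and "v \<equiv> (\<Sum>a\<in>F. \<Sum>b\<in>F. C a b)"
  assumes v: "0 < v" and c: "0 < c" and u: "\<And>t. t \<in> J \<Longrightarrow> u t \<le> \<phi> t / c" and M: "0 \<le> M"
  defines "m \<equiv> sqrt v / c"
  shows "orthant_prob J C u \<le> exp (- M\<^sup>2 / 2) + exp (M * m + m\<^sup>2 / 2) * orthant_prob J C (\<lambda>_. 0)"
proof -
  let ?S = "std_normal_distribution"
  have CJ: "psd_on J C" using C fin by (auto intro: psd_on_subset)
  have D: "psd_on J (\<lambda>t s. C t s - \<phi> t * \<phi> s / v)" using psd_on_schur[OF C fin] v unfolding \<phi>_def v_def by blast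
  obtain Q :: "('a \<Rightarrow> real) measure" and V where G: "gaussian_vector Q J V (\<lambda>t s. C t s - \<phi> t * \<phi> s / v)"
    using gaussian_vector_exists[OF fin(1) D] .
  note g = gaussian_vectorD[OF G]
  interpret Q: prob_space Q by (rule g)
  interpret S: prob_space ?S by (rule prob_space_std_normal)
  interpret pair_prob_space Q ?S ..
  \<comment> \<open>The vector is rebuilt as the residual \<open>V\<close> plus \<open>d t\<close>
    times an independent standard normal z, which stands for the normalised sum over
    \<open>F\<close>.\<close>
  define d where "d t = \<phi> t / sqrt v" for t
  have G1: "gaussian_vector (Q \<Otimes>\<^sub>M ?S) J (\<lambda>t p. V t (fst p) + d t * snd p) C"
    by (rule gaussian_vector_cong[OF gaussian_vector_add[OF G gaussian_vector_rank_one[OF fin(1), of d]]])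
      (use v in \<open>auto simp: d_def\<close>)
  note [measurable] = g(3)
  define E where "E w = {p \<in> space (Q \<Otimes>\<^sub>M ?S). \<forall>t\<in>J. V t (fst p) + d t * snd p \<le> w t}" for w
  have Em[measurable]: "E w \<in> sets (Q \<Otimes>\<^sub>M ?S)" for w unfolding E_def using fin by measurable
  have Ew: "orthant_prob J C w = measure (Q \<Otimes>\<^sub>M ?S) (E w)" for w
    using orthant_prob_eq[OF G1, of w] by (simp add: E_def)
  define H where "H z = emeasure Q ((\<lambda>x. (x, z)) -` E (\<lambda>_. 0))" for z
  have H[measurable]: "H \<in> borel_measurable borel"
  proof -
    have "H \<in> borel_measurable ?S" unfolding H_def[abs_def] by (rule measurable_emeasure_Pair2) measurable
    then show ?thesis by simp
  qed
  \<comment> \<open>Since \<open>d t * m = \<phi> t / c\<close>, raising the level from 0 to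
    \<open>\<phi> t / c\<close> amounts to replacing z by z - m.\<close>
  have sec: "(\<lambda>x. (x, z)) -` E (\<lambda>t. \<phi> t / c) = (\<lambda>x. (x, z - m)) -` E (\<lambda>_. 0)" for z
  proof -
    have "V t x + d t * (z - m) \<le> 0 \<longleftrightarrow> V t x + d t * z \<le> \<phi> t / c" for t x
    proof -
      have "d t * m = \<phi> t / c" using v by (simp add: d_def m_def)
      then show ?thesis by (simp add: right_diff_distrib) linarith
    qed
    then show ?thesis by (auto simp: E_def space_pair_measure)
  qed
  have "ennreal (orthant_prob J C (\<lambda>t. \<phi> t / c)) = emeasure (Q \<Otimes>\<^sub>M ?S) (E (\<lambda>t. \<phi> t / c))"
    unfolding Ew by (simp add: emeasure_eq_measure)
  also have "\<dots> = (\<integral>\<^sup>+z. H (z - m) \<partial>?S)" by (simp add: emeasure_pair_measure_alt2[OF Em] sec H_def)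
  also have "\<dots> \<le> ennreal (exp (- M\<^sup>2 / 2)) + ennreal (exp (M * m + m\<^sup>2 / 2)) * (\<integral>\<^sup>+z. H z \<partial>?S)"
    using M v c by (intro nn_integral_std_normal_shift H) (auto simp: m_def H_def intro!: Q.emeasure_le_1)
  also have "(\<integral>\<^sup>+z. H z \<partial>?S) = ennreal (orthant_prob J C (\<lambda>_. 0))"
    unfolding Ew H_def by (simp add: emeasure_pair_measure_alt2[OF Em, symmetric] emeasure_eq_measure)
  finally have "orthant_prob J C (\<lambda>t. \<phi> t / c) \<le> exp (- M\<^sup>2 / 2) + exp (M * m + m\<^sup>2 / 2) * orthant_prob J C (\<lambda>_. 0)"
    by (simp add: ennreal_mult[symmetric] ennreal_plus[symmetric] orthant_prob_nonneg ennreal_le_iff del: ennreal_plus)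
  moreover have "orthant_prob J C u \<le> orthant_prob J C (\<lambda>t. \<phi> t / c)"
    using u by (intro orthant_prob_mono fin CJ) auto
  ultimately show ?thesis by linarith
qed

section \<open>Weakly correlated vectors\<close>

lemma orthant_prob_white:
  assumes A: "finite A" and c: "0 < c"
  shows "orthant_prob A (\<lambda>t s. if t = s then c\<^sup>2 else 0) (\<lambda>_. a) = measure std_normal_distribution {..a / c} ^ card A"
proof -
  interpret S: prob_space std_normal_distribution by (rule prob_space_std_normal)
  interpret product_prob_space "\<lambda>_. std_normal_distribution" A ..
  let ?P = "PiM A (\<lambda>_. std_normal_distribution)"
  have "c * x \<le> a \<longleftrightarrow> x \<in> {..a / c}" for x using c by (simp add: field_simps)
  then have "orthant_prob A (\<lambda>t s. if t = s then c\<^sup>2 else 0) (\<lambda>_. a)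
     = measure ?P {\<omega> \<in> space ?P. \<forall>t\<in>A. \<omega> t \<in> {..a / c}}"
    using orthant_prob_eq[OF gaussian_vector_white[OF A, of c], of "\<lambda>_. a"] by simp
  also have "\<dots> = (\<Prod>t\<in>A. measure std_normal_distribution {..a / c})"
  proof -
    have "emeasure ?P {\<omega> \<in> space ?P. \<forall>t\<in>A. \<omega> t \<in> {..a / c}} = (\<Prod>t\<in>A. emeasure std_normal_distribution {..a / c})"
      by (rule emeasure_PiM_Collect) (use A in auto)
    then show ?thesis
      by (simp add: emeasure_eq_measure S.emeasure_eq_measure ennreal_power)
  qed
  finally show ?thesis by simp
qed

lemma std_normal_half_line_less_1: "measure std_normal_distribution {..x} < 1"
proof (rule ccontr)
  interpret S: prob_space std_normal_distribution by (rule prob_space_std_normal)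
  assume "\<not> ?thesis"
  then have "S.prob {..x} = 1" using S.prob_le_1[of "{..x}"] by simp
  then have "AE z in std_normal_distribution. z \<in> {..x}" by (intro S.AE_prob_1) simp
  then have "AE z in lborel. z \<in> {..x}"
    by (simp add: AE_density normal_density_pos)
  then have "emeasure lborel {x<..} = 0"
    by (subst (asm) AE_iff_measurable[OF _ refl]) (auto simp: greaterThan_def not_le)
  moreover have "emeasure lborel {x<..x+1} \<le> emeasure lborel {x<..}" by (intro emeasure_mono) auto
  ultimately show False by simp
qed

text \<open>\<open>W\<close> is given through its covariance on an abstract space, so independence
  is read off from orthant probabilities: the product is expanded over subsets, every term is an
  orthant probability of white noise, and the sum is folded back.\<close>

lemma integral_prod_step_weights:
  fixes r :: real
  assumes W: "gaussian_vector M J W (\<lambda>t s. if t = s then c\<^sup>2 else 0)" and c: "0 < c"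
  shows "(LINT \<omega>|M. (\<Prod>t\<in>J. r + (1 - r) * indicator {..1} (W t \<omega>))) = (r + (1 - r) * measure std_normal_distribution {..1 / c}) ^ card J"
proof -
  note w = gaussian_vectorD[OF W]
  interpret prob_space M by (rule w)
  note [measurable] = w(3)
  let ?p = "measure std_normal_distribution {..1 / c}"
  define E where "E A = {\<omega>\<in>space M. \<forall>t\<in>A. W t \<omega> \<le> 1}" for A
  have E: "E A \<in> sets M" "measure M (E A) = ?p ^ card A" if "A \<subseteq> J" for A
  proof -
    have fA: "finite A" using that w(2) finite_subset by blast
    show "E A \<in> sets M" unfolding E_def using w(3) that fA
      by (intro sets.sets_Collect_countable_All' countable_finite) auto
    show "measure M (E A) = ?p ^ card A"
      using orthant_prob_eq[OF gaussian_vector_subset[OF W that], of "\<lambda>_. 1"] orthant_prob_white[OF fA c, of 1]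
      by (simp add: E_def)
  qed
  have "(LINT \<omega>|M. (\<Prod>t\<in>J. r + (1 - r) * indicator {..1} (W t \<omega>)))
     = (LINT \<omega>|M. (\<Sum>X\<in>Pow J. (\<Prod>t\<in>X. r) * ((1 - r) ^ card (J - X) * indicator (E (J - X)) \<omega>)))"
  proof (intro Bochner_Integration.integral_cong refl)
    fix \<omega> assume \<omega>: "\<omega> \<in> space M"
    have "(\<Prod>t\<in>A. (1 - r) * indicator {..1} (W t \<omega>)) = (1 - r) ^ card A * indicator (E A) \<omega>" if "finite A" for A
      using that \<omega> by (induction A rule: finite_induct) (auto simp: E_def split: split_indicator)
    then show "(\<Prod>t\<in>J. r + (1 - r) * indicator {..1} (W t \<omega>)) = (\<Sum>X\<in>Pow J. (\<Prod>t\<in>X. r) * ((1 - r) ^ card (J - X) * indicator (E (J - X)) \<omega>))"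
      using w(2) by (simp add: prod_add del: prod_constant)
  qed
  also have "\<dots> = (\<Sum>X\<in>Pow J. (\<Prod>t\<in>X. r) * ((1 - r) ^ card (J - X) * ?p ^ card (J - X)))"
    by (subst Bochner_Integration.integral_sum)
      (auto intro!: sum.cong integrable_mult_right integrable_real_indicator simp: E emeasure_eq_measure)
  also have "\<dots> = (\<Sum>X\<in>Pow J. (\<Prod>t\<in>X. r) * (\<Prod>t\<in>J - X. (1 - r) * ?p))"
    by (simp add: power_mult_distrib)
  also have "\<dots> = (\<Prod>t\<in>J. r + (1 - r) * ?p)" using w(2) by (rule prod_add[symmetric])
  finally show ?thesis by simp
qed

text \<open>Since a_t a_s <= (a_t^2 + a_s^2)/2 and \<open>C\<close> is nonnegative and symmetric,
  the form of \<open>C\<close> is at most the sum of a_t^2 times the row sum at t.\<close>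

lemma psd_on_diagonally_dominant:
  assumes J: "finite J" and C: "psd_on J C" and nn: "\<And>t s. t \<in> J \<Longrightarrow> s \<in> J \<Longrightarrow> 0 \<le> C t s"
    and row: "\<And>t. t \<in> J \<Longrightarrow> (\<Sum>s\<in>J. C t s) \<le> b"
  shows "psd_on J (\<lambda>t s. (if t = s then b else 0) - C t s)"
proof -
  have sym: "C t s = C s t" if "t \<in> J" "s \<in> J" for t s using C that by (auto simp: psd_on_def)
  have "0 \<le> quad_form J (\<lambda>t s. (if t = s then b else 0) - C t s) a" for a
  proof -
    have "quad_form J C a \<le> (\<Sum>t\<in>J. \<Sum>s\<in>J. ((a t)\<^sup>2 * C t s + (a s)\<^sup>2 * C t s) / 2)"
      unfolding quad_form_def
    proof (intro sum_mono)
      fix t s assume ts: "t \<in> J" "s \<in> J"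
      have "0 \<le> (a t - a s)\<^sup>2" by simp
      then have "a t * a s \<le> ((a t)\<^sup>2 + (a s)\<^sup>2) / 2" by (simp add: power2_diff)
      then have "a t * a s * C t s \<le> ((a t)\<^sup>2 + (a s)\<^sup>2) / 2 * C t s" using nn ts by (intro mult_right_mono) auto
      then show "a t * a s * C t s \<le> ((a t)\<^sup>2 * C t s + (a s)\<^sup>2 * C t s) / 2" by (simp add: algebra_simps)
    qed
    also have "\<dots> = (\<Sum>t\<in>J. \<Sum>s\<in>J. (a t)\<^sup>2 * C t s / 2) + (\<Sum>t\<in>J. \<Sum>s\<in>J. (a s)\<^sup>2 * C t s / 2)"
      by (simp add: sum.distrib add_divide_distrib)
    also have "(\<Sum>t\<in>J. \<Sum>s\<in>J. (a s)\<^sup>2 * C t s / 2) = (\<Sum>t\<in>J. \<Sum>s\<in>J. (a t)\<^sup>2 * C t s / 2)"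
      by (subst sum.swap) (intro sum.cong refl, use sym in auto)
    also have "(\<Sum>t\<in>J. \<Sum>s\<in>J. (a t)\<^sup>2 * C t s / 2) + (\<Sum>t\<in>J. \<Sum>s\<in>J. (a t)\<^sup>2 * C t s / 2) = (\<Sum>t\<in>J. (a t)\<^sup>2 * (\<Sum>s\<in>J. C t s))"
      unfolding sum.distrib[symmetric] sum_distrib_left by (simp add: mult.commute)
    also have "\<dots> \<le> (\<Sum>t\<in>J. (a t)\<^sup>2 * b)" using row by (intro sum_mono mult_left_mono) auto
    also have "\<dots> = quad_form J (\<lambda>t s. if t = s then b else 0) a" using J by (simp add: quad_form_diag mult.commute)
    finally have "quad_form J C a \<le> quad_form J (\<lambda>t s. if t = s then b else 0) a" .
    moreover have "quad_form J (\<lambda>t s. (if t = s then b else 0) - C t s) a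
       = quad_form J (\<lambda>t s. (if t = s then b else 0) + (- 1) * C t s) a" by (intro quad_form_cong) auto
    ultimately show ?thesis unfolding quad_form_add quad_form_scale by simp
  qed
  then show ?thesis using sym by (auto simp: psd_on_def)
qed

text \<open>Adding an independent field with covariance $(1+\varepsilon)I - C$ turns $C$ into white noise;
  this field is small because its variance is $\varepsilon$. The event is transferred by the
  decreasing weight that equals 1 on $(-\infty,1]$ and $e^{-1}$ beyond.\<close>

lemma orthant_prob_weak_correlation:
  "\<exists>\<epsilon>>0. \<exists>q. 0 < q \<and> q < 1 \<and> (\<forall>J C. finite (J :: 'i set) \<longrightarrow> psd_on J C \<longrightarrow> (\<forall>t\<in>J. C t t = 1) \<longrightarrow>
     (\<forall>t\<in>J. \<forall>s\<in>J. 0 \<le> C t s) \<longrightarrow> (\<forall>t\<in>J. (\<Sum>s\<in>J. C t s) \<le> 1 + \<epsilon>) \<longrightarrow> orthant_prob J C (\<lambda>_. 0) \<le> q ^ card J)"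
proof -
  let ?S = "std_normal_distribution"
  interpret S: real_distribution ?S by (rule real_dist_normal_dist)
  define r where "r = exp (-1 :: real)"
  have r: "0 < r" "r < 1" by (auto simp: r_def)
  define q0 where "q0 = r + (1 - r) * measure ?S {..1}"
  have "(1 - r) * measure ?S {..1} < (1 - r) * 1" using r std_normal_half_line_less_1 by (intro mult_strict_left_mono) auto
  then have "r + (1 - r) * measure ?S {..1} < r + (1 - r) * 1" by (rule add_strict_left_mono)
  then have "q0 < 1" by (simp add: q0_def)
  moreover have "0 < q0" using r by (auto simp: q0_def intro!: add_pos_nonneg)
  ultimately have q0: "0 < q0" "q0 < 1" by auto
  \<comment> \<open>\<open>q0\<close> bounds the mean weight of one coordinate of the white noise.
    Removing the auxiliary field will cost a factor exp(\<open>\<tau>\<close>) per coordinate, with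
    \<open>\<tau>\<close> the normal tail beyond y; y is taken so large that the product stays below
    1.\<close>
  have "((\<lambda>y. q0 * exp (1 - cdf ?S y)) \<longlongrightarrow> q0 * exp (1 - 1)) at_top"
    by (intro tendsto_intros S.cdf_lim_at_top_prob)
  then have "\<forall>\<^sub>F y in at_top. q0 * exp (1 - cdf ?S y) < 1" using q0 by (intro order_tendstoD) auto
  then have "\<forall>\<^sub>F y in at_top. q0 * exp (1 - cdf ?S y) < 1 \<and> 0 < y" using eventually_gt_at_top[of 0] by eventually_elim auto
  then obtain y where y: "q0 * exp (1 - cdf ?S y) < 1" "0 < y"
    using eventually_happens'[OF trivial_limit_at_top_linorder] by blast
  define \<tau> where "\<tau> = 1 - measure ?S {..y}"
  \<comment> \<open>With standard deviation 1/y a coordinate of the auxiliary field exceeds 1 with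
    probability exactly \<open>\<tau>\<close>.\<close>
  define \<epsilon> where "\<epsilon> = (1 / y)\<^sup>2"
  have \<epsilon>: "0 < \<epsilon>" using y by (simp add: \<epsilon>_def)
  define c where "c = sqrt (1 + \<epsilon>)"
  have c: "1 \<le> c" "c\<^sup>2 = 1 + \<epsilon>" using \<epsilon> by (auto simp: c_def)
  define k where "k w = r + (1 - r) * indicator {..1} w" for w :: real
  have k: "0 \<le> k w" "k w \<le> 1" for w using r by (auto simp: k_def split: split_indicator)
  have kmono: "k b \<le> k a" if "a \<le> b" for a b using that r by (auto simp: k_def split: split_indicator)
  have [measurable]: "k \<in> borel_measurable borel" unfolding k_def[abs_def] by measurable
  have main: "orthant_prob J C (\<lambda>_. 0) \<le> (q0 * exp \<tau>) ^ card J"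
    if J: "finite J" and C: "psd_on J C" and C1: "\<forall>t\<in>J. C t t = 1" and nn: "\<forall>t\<in>J. \<forall>s\<in>J. 0 \<le> C t s"
      and row: "\<forall>t\<in>J. (\<Sum>s\<in>J. C t s) \<le> 1 + \<epsilon>" for J :: "'i set" and C
  proof -
    define D where "D = (\<lambda>t s. (if t = s then 1 + \<epsilon> else 0) - C t s)"
    have D: "psd_on J D" unfolding D_def using J C nn row by (intro psd_on_diagonally_dominant) auto
    obtain M :: "('i \<Rightarrow> real) measure" and Y where Y: "gaussian_vector M J Y C" using gaussian_vector_exists[OF J C] .
    obtain N :: "('i \<Rightarrow> real) measure" and Z where Z: "gaussian_vector N J Z D" using gaussian_vector_exists[OF J D] .
    interpret M: prob_space M by (rule gaussian_vectorD[OF Y])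
    interpret N: prob_space N by (rule gaussian_vectorD[OF Z])
    interpret pair_prob_space M N ..
    have W: "gaussian_vector (M \<Otimes>\<^sub>M N) J (\<lambda>t p. Y t (fst p) + Z t (snd p)) (\<lambda>t s. if t = s then c\<^sup>2 else 0)"
      by (rule gaussian_vector_cong[OF gaussian_vector_add[OF Y Z]]) (auto simp: D_def c)
    note mY[measurable] = gaussian_vectorD(3)[OF Y] and mZ[measurable] = gaussian_vectorD(3)[OF Z]
    define E where "E = {\<omega>\<in>space M. \<forall>t\<in>J. Y t \<omega> \<le> 0}"
    have [measurable]: "E \<in> sets M" unfolding E_def using J by measurable
    define f where "f \<omega> = (indicator E \<omega> :: real)" for \<omega>
    define g where "g \<omega> = (\<Prod>t\<in>J. k (Z t \<omega>))" for \<omega>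
    have [measurable]: "f \<in> borel_measurable M" "g \<in> borel_measurable N" unfolding f_def[abs_def] g_def[abs_def] by measurable
    have fb: "0 \<le> f \<omega>" "f \<omega> \<le> 1" for \<omega> by (auto simp: f_def split: split_indicator)
    have gb: "0 \<le> g \<omega>" "g \<omega> \<le> 1" for \<omega> unfolding g_def using k by (auto intro!: prod_nonneg prod_le_1)
    have "(LINT \<omega>|M. f \<omega>) * (LINT \<omega>|N. g \<omega>) = (LINT p|(M \<Otimes>\<^sub>M N). f (fst p) * g (snd p))"
      by (rule integral_pair_mult_bounded[symmetric]) (use fb gb M.prob_space_axioms N.prob_space_axioms in auto)
    \<comment> \<open>On \<open>E\<close> every \<open>Y t\<close> is at most 0, and
      \<open>k\<close> is decreasing, so adding \<open>Y t\<close> to \<open>Z t\<close> only raises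
      the weight.\<close>
    also have "\<dots> \<le> (LINT p|(M \<Otimes>\<^sub>M N). (\<Prod>t\<in>J. k (Y t (fst p) + Z t (snd p))))"
    proof (rule integral_mono)
      show "integrable (M \<Otimes>\<^sub>M N) (\<lambda>p. f (fst p) * g (snd p))"
        using fb gb by (intro P.integrable_const_bound[where B=1]) (auto simp: mult_le_one)
      show "integrable (M \<Otimes>\<^sub>M N) (\<lambda>p. \<Prod>t\<in>J. k (Y t (fst p) + Z t (snd p)))"
        using k by (intro P.integrable_const_bound[where B=1]) (auto simp: prod_nonneg prod_le_1)
      fix p
      show "f (fst p) * g (snd p) \<le> (\<Prod>t\<in>J. k (Y t (fst p) + Z t (snd p)))"
      proof (cases "fst p \<in> E")
        case True
        then have "g (snd p) \<le> (\<Prod>t\<in>J. k (Y t (fst p) + Z t (snd p)))"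
          unfolding g_def E_def using k by (intro prod_mono conjI kmono) auto
        then show ?thesis using True by (simp add: f_def)
      qed (use k in \<open>auto simp: f_def intro!: prod_nonneg\<close>)
    qed
    also have "\<dots> = (r + (1 - r) * measure ?S {..1 / c}) ^ card J"
      unfolding k_def using c by (intro integral_prod_step_weights W) auto
    also have "\<dots> \<le> q0 ^ card J"
      unfolding q0_def using r c by (intro power_mono add_left_mono mult_left_mono S.finite_measure_mono) auto
    finally have 1: "(LINT \<omega>|M. f \<omega>) * (LINT \<omega>|N. g \<omega>) \<le> q0 ^ card J" .
    have 2: "(LINT \<omega>|M. f \<omega>) = orthant_prob J C (\<lambda>_. 0)"
    proof -
      have "E \<inter> space M = E" by (auto simp: E_def)
      then have "(LINT \<omega>|M. f \<omega>) = measure M E" by (simp add: f_def[abs_def])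
      then show ?thesis using orthant_prob_eq[OF Y, of "\<lambda>_. 0"] by (simp add: E_def)
    qed
    have 3: "exp (- real (card J) * \<tau>) \<le> (LINT \<omega>|N. g \<omega>)"
    proof -
      define m where "m = real (card J) * \<tau>"
      define n where "n \<omega> = (\<Sum>t\<in>J. 1 - (indicator {\<omega>\<in>space N. Z t \<omega> \<le> 1} \<omega> :: real))" for \<omega>
      \<comment> \<open>Jensen's inequality via a tangent: g = exp(-n), where n counts the
        coordinates of \<open>Z\<close> above 1 and has mean m, and exp(m - n) >= 1 + (m -
        n).\<close>
      have ge: "exp (- m) * (1 + (m - n \<omega>)) \<le> g \<omega>" if "\<omega> \<in> space N" for \<omega>
      proof -
        have "g \<omega> = (\<Prod>t\<in>J. exp (- (1 - (indicator {\<omega>\<in>space N. Z t \<omega> \<le> 1} \<omega> :: real))))"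
          unfolding g_def using that by (intro prod.cong refl) (auto simp: k_def r_def split: split_indicator)
        also have "\<dots> = exp (- n \<omega>)" using J by (simp add: exp_sum[symmetric] n_def sum_negf[symmetric] del: sum_negf)
        also have "\<dots> = exp (- m) * exp (m - n \<omega>)" by (simp add: exp_add[symmetric])
        finally show ?thesis by (simp add: exp_ge_add_one_self)
      qed
      have P1: "measure N {\<omega>\<in>space N. Z t \<omega> \<le> 1} = 1 - \<tau>" if "t \<in> J" for t
      proof -
        have "measure N {\<omega>\<in>space N. Z t \<omega> \<le> 1} = orthant_prob {t} D (\<lambda>_. 1)"
          using orthant_prob_eq[OF gaussian_vector_subset[OF Z, of "{t}"], of "\<lambda>_. 1"] that by simp
        also have "\<dots> = orthant_prob {t} (\<lambda>t s. if t = s then (1 / y)\<^sup>2 else 0) (\<lambda>_. 1)"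
          using that C1 by (intro orthant_prob_cong) (auto simp: D_def \<epsilon>_def)
        also have "\<dots> = measure ?S {..y}" using orthant_prob_white[of "{t}" "1 / y" 1] y by simp
        finally show ?thesis by (simp add: \<tau>_def)
      qed
      have ms: "{\<omega>\<in>space N. Z t \<omega> \<le> 1} \<in> sets N" if "t \<in> J" for t using that by measurable
      have ni: "integrable N n" unfolding n_def
        using ms by (intro Bochner_Integration.integrable_sum Bochner_Integration.integrable_diff integrable_real_indicator) (auto simp: N.emeasure_eq_measure)
      have "(LINT \<omega>|N. n \<omega>) = (\<Sum>t\<in>J. LINT \<omega>|N. 1 - (indicator {\<omega>\<in>space N. Z t \<omega> \<le> 1} \<omega> :: real))"
        unfolding n_def using ms
        by (intro Bochner_Integration.integral_sum Bochner_Integration.integrable_diff integrable_real_indicator) (auto simp: N.emeasure_eq_measure)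
      also have "\<dots> = (\<Sum>t\<in>J. \<tau>)"
      proof (intro sum.cong refl)
        fix t assume t: "t \<in> J"
        have "(LINT \<omega>|N. 1 - (indicator {\<omega>\<in>space N. Z t \<omega> \<le> 1} \<omega> :: real)) = (LINT \<omega>|N. 1) - measure N {\<omega>\<in>space N. Z t \<omega> \<le> 1}"
          using ms[OF t] by (subst Bochner_Integration.integral_diff) (auto simp: N.emeasure_eq_measure)
        then show "(LINT \<omega>|N. 1 - (indicator {\<omega>\<in>space N. Z t \<omega> \<le> 1} \<omega> :: real)) = \<tau>"
          using P1[OF t] by (simp add: N.prob_space)
      qed
      finally have En: "(LINT \<omega>|N. n \<omega>) = m" by (simp add: m_def)
      have "exp (- m) = (LINT \<omega>|N. exp (- m) * (1 + (m - n \<omega>)))"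
        using ni En by (simp add: N.prob_space)
      also have "\<dots> \<le> (LINT \<omega>|N. g \<omega>)"
        using ni gb by (intro integral_mono_AE AE_I2 ge N.integrable_const_bound[where B=1, of g]) auto
      finally show ?thesis by (simp add: m_def)
    qed
    have "orthant_prob J C (\<lambda>_. 0) * exp (- real (card J) * \<tau>) \<le> q0 ^ card J"
      using mult_left_mono[OF 3 orthant_prob_nonneg[of J C "\<lambda>_. 0"]] 1 2 by simp
    then have "orthant_prob J C (\<lambda>_. 0) \<le> q0 ^ card J * exp (real (card J) * \<tau>)"
      by (simp add: exp_minus field_simps)
    also have "\<dots> = (q0 * exp \<tau>) ^ card J" by (simp add: power_mult_distrib exp_of_nat_mult)
    finally show ?thesis .
  qed
  have "q0 * exp \<tau> < 1" using y by (simp add: \<tau>_def cdf_def)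
  then show ?thesis using \<epsilon> q0 main by (intro exI[of _ \<epsilon>] conjI exI[of _ "q0 * exp \<tau>"]) auto
qed

section \<open>Persistence exponents of a stationary kernel\<close>

definition cube :: "real \<Rightarrow> (real^'n) set" where
  "cube x = {t. \<forall>i. 0 \<le> t $ i \<and> t $ i \<le> x}"

text \<open>This is x times the set S_h of the theorem, as h . 1 is the sum H of the
  indices.\<close>

definition corner_simplex :: "real^'n \<Rightarrow> real \<Rightarrow> (real^'n) set" where
  "corner_simplex h x = {t. (\<forall>i. 0 \<le> t $ i) \<and> h \<bullet> t \<le> x * (h \<bullet> 1)}"

definition lattice :: "real \<Rightarrow> nat \<Rightarrow> (real^'n) set" where
  "lattice L n = {t. \<forall>i. t $ i \<in> (\<lambda>k. L * real k) ` {..<n}}"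

lemma vec_coords_eq_image: "{t::'a^'n. \<forall>i. t $ i \<in> A} = vec_lambda ` (UNIV \<rightarrow>\<^sub>E A)"
proof (intro equalityI subsetI)
  fix t :: "'a^'n" assume "t \<in> {t. \<forall>i. t $ i \<in> A}"
  then show "t \<in> vec_lambda ` (UNIV \<rightarrow>\<^sub>E A)" by (intro image_eqI[of _ _ "vec_nth t"]) auto
qed auto

lemma inj_on_vec_lambda: "inj_on vec_lambda A"
  by (auto simp: inj_on_def vec_lambda_inject)

lemma finite_vec_coords: "finite A \<Longrightarrow> finite {t::'a^'n. \<forall>i. t $ i \<in> A}"
  unfolding vec_coords_eq_image by (intro finite_imageI finite_PiE) auto

lemma card_vec_coords: "finite A \<Longrightarrow> card {t::'a^'n. \<forall>i. t $ i \<in> A} = card A ^ CARD('n)"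
  unfolding vec_coords_eq_image by (subst card_image[OF inj_on_vec_lambda]) (simp add: card_PiE)

lemma inner_mono_nonneg:
  fixes h t s :: "real^'n"
  assumes "\<And>i. 0 \<le> h $ i" "\<And>i. t $ i \<le> s $ i" shows "h \<bullet> t \<le> h \<bullet> s"
  using assms by (auto simp: inner_vec_def intro!: sum_mono mult_left_mono)

lemma component_le_inner:
  fixes h t :: "real^'n"
  assumes "\<And>i. 0 \<le> h $ i" "\<And>i. 0 \<le> t $ i" shows "h $ i * t $ i \<le> h \<bullet> t"
  using member_le_sum[of i UNIV "\<lambda>i. h $ i * t $ i"] assms by (simp add: inner_vec_def)

lemma cube_eq_cbox: "cube x = cbox 0 (x *\<^sub>R (1::real^'n))"
  by (auto simp: cube_def mem_box_cart)

lemma borel_cube [measurable]: "cube x \<in> sets borel"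
  by (simp add: cube_eq_cbox)

lemma one_inner_Basis: "b \<in> Basis \<Longrightarrow> (1::real^'n) \<bullet> b = 1"
  by (auto simp: Basis_vec_def inner_axis)

lemma measure_cube:
  assumes "0 \<le> x" shows "measure lborel (cube x :: (real^'n) set) = x ^ CARD('n)"
  unfolding cube_eq_cbox using assms by (subst measure_lborel_cbox) (simp_all add: one_inner_Basis)

lemma measure_translated_box:
  assumes "0 \<le> y" shows "measure lborel (box k (k + y *\<^sub>R (1::real^'n))) = y ^ CARD('n)"
  using assms by (subst measure_lborel_box) (simp_all add: inner_add_left one_inner_Basis)

lemma closed_corner_simplex: "closed (corner_simplex h x)"
proof -
  have "corner_simplex h x = (\<Inter>i. {t. 0 \<le> t $ i}) \<inter> {t. h \<bullet> t \<le> x * (h \<bullet> 1)}"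
    by (auto simp: corner_simplex_def)
  moreover have "closed \<dots>"
    by (intro closed_INT closed_Int ballI closed_Collect_le continuous_intros)
  ultimately show ?thesis by simp
qed

lemma borel_corner_simplex [measurable]: "corner_simplex h x \<in> sets borel"
  by (intro borel_closed closed_corner_simplex)

lemma corner_simplex_scale:
  assumes "0 < x" shows "corner_simplex h x = (\<lambda>t. x *\<^sub>R t) ` corner_simplex h 1"
proof (intro equalityI subsetI)
  fix t assume t: "t \<in> corner_simplex h x"
  have "t = x *\<^sub>R ((1 / x) *\<^sub>R t)" using assms by simp
  moreover have "(1 / x) *\<^sub>R t \<in> corner_simplex h 1" using t assms by (auto simp: corner_simplex_def field_simps)
  ultimately show "t \<in> (\<lambda>t. x *\<^sub>R t) ` corner_simplex h 1" by blast
qed (use assms in \<open>auto simp: corner_simplex_def\<close>)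

text \<open>Boxes of the grid of mesh \<open>y\<close> are indexed by their lower corners.\<close>

lemma grid_cover:
  fixes A A' :: "(real^'n) set"
  assumes y: "0 < y" and A': "A' \<in> sets borel" "emeasure lborel A' < \<infinity>"
    and cells: "\<And>a x. a \<in> A \<Longrightarrow> (\<And>i. \<lfloor>x $ i / y\<rfloor> = \<lfloor>a $ i / y\<rfloor>) \<Longrightarrow> x \<in> A'"
  obtains K where "finite K" "real (card K) * y ^ CARD('n) \<le> measure lborel A'"
    "A \<subseteq> (\<Union>k\<in>K. (\<lambda>t. t + k) ` cube y)"
proof -
  define c where "c a = (\<chi> i. y * of_int \<lfloor>a $ i / y\<rfloor>)" for a :: "real^'n"
  define K where "K = c ` A"
  \<comment> \<open>Open cells are disjoint, which is needed for counting by volume; the covering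
    uses their closures.\<close>
  define B where "B k = box k (k + y *\<^sub>R (1::real^'n))" for k
  have fl: "\<lfloor>x $ i / y\<rfloor> = \<lfloor>a $ i / y\<rfloor>" if "x \<in> B (c a)" for x a i
  proof -
    have "y * of_int \<lfloor>a $ i / y\<rfloor> < x $ i" "x $ i < y * of_int \<lfloor>a $ i / y\<rfloor> + y"
      using that by (simp_all add: B_def mem_box_cart c_def)
    then have "of_int \<lfloor>a $ i / y\<rfloor> < x $ i / y" "x $ i / y < of_int \<lfloor>a $ i / y\<rfloor> + 1" using y by (simp_all add: field_simps)
    then show ?thesis by (intro floor_unique) auto
  qed
  have sub: "B k \<subseteq> A'" if "k \<in> K" for k
    using that cells fl by (auto simp: K_def)
  have disj: "disjoint_family_on B K"
  proof (unfold disjoint_family_on_def, intro ballI impI)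
    fix k l assume kl: "k \<in> K" "l \<in> K" "k \<noteq> l"
    then obtain a b where ab: "k = c a" "l = c b" by (auto simp: K_def)
    show "B k \<inter> B l = {}"
    proof (rule ccontr)
      assume "B k \<inter> B l \<noteq> {}"
      then obtain x where "x \<in> B (c a)" "x \<in> B (c b)" using ab by auto
      then have "\<lfloor>a $ i / y\<rfloor> = \<lfloor>b $ i / y\<rfloor>" for i using fl by metis
      then show False using kl ab by (simp add: c_def)
    qed
  qed
  have bound: "real (card F) * y ^ CARD('n) \<le> measure lborel A'" if F: "F \<subseteq> K" "finite F" for F
  proof -
    have "real (card F) * y ^ CARD('n) = (\<Sum>k\<in>F. measure lborel (B k))"
      using y by (simp add: B_def measure_translated_box)
    also have "\<dots> = measure lborel (\<Union>k\<in>F. B k)"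
    proof (rule measure_finite_Union[symmetric])
      show "disjoint_family_on B F" using F(1) disj by (rule disjoint_family_on_mono)
      show "emeasure lborel (B i) \<noteq> \<infinity>" for i by (simp add: B_def emeasure_lborel_box_eq)
    qed (use F in \<open>auto simp: B_def\<close>)
    also have "\<dots> \<le> measure lborel A'"
      using sub F A' by (intro measure_mono_fmeasurable) (auto simp: fmeasurable_def B_def)
    finally show ?thesis .
  qed
  \<comment> \<open>By the volume bound no finite subset of \<open>K\<close> has more than m
    elements, so \<open>K\<close> itself is finite.\<close>
  obtain m :: nat where m: "measure lborel A' / y ^ CARD('n) < m" using reals_Archimedean2 by blast
  have "card F \<le> m" if "F \<subseteq> K" "finite F" for F
  proof -
    have "real (card F) \<le> measure lborel A' / y ^ CARD('n)" using bound[OF that] y by (simp add: field_simps)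
    then show ?thesis using m by linarith
  qed
  then have fin: "finite K" by (rule finite_if_finite_subsets_card_bdd[THEN conjunct1, rule_format]) auto
  have "A \<subseteq> (\<Union>k\<in>K. (\<lambda>t. t + k) ` cube y)"
  proof
    fix a assume a: "a \<in> A"
    have "a - c a \<in> cube y"
    proof -
      have "of_int \<lfloor>a $ i / y\<rfloor> \<le> a $ i / y" "a $ i / y \<le> of_int \<lfloor>a $ i / y\<rfloor> + 1" for i by linarith+
      then have "y * of_int \<lfloor>a $ i / y\<rfloor> \<le> y * (a $ i / y)" "y * (a $ i / y) \<le> y * (of_int \<lfloor>a $ i / y\<rfloor> + 1)" for i
        using y by (intro mult_left_mono; simp)+
      then have "y * of_int \<lfloor>a $ i / y\<rfloor> \<le> a $ i" "a $ i \<le> y * of_int \<lfloor>a $ i / y\<rfloor> + y" for i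
        using y by (simp_all add: distrib_left)
      then show ?thesis by (simp add: cube_def c_def algebra_simps)
    qed
    then show "a \<in> (\<Union>k\<in>K. (\<lambda>t. t + k) ` cube y)"
      using a unfolding K_def by (auto intro!: bexI[of _ a] image_eqI[of _ _ "a - c a"])
  qed
  then show ?thesis using that fin bound[OF subset_refl fin] by blast
qed

lemma cell_bounds:
  fixes x y a :: real
  assumes "0 < y" "\<lfloor>x / y\<rfloor> = \<lfloor>a / y\<rfloor>" shows "x \<le> a + y" "a \<le> x + y" "0 \<le> a \<Longrightarrow> 0 \<le> x"
proof -
  have "x / y \<le> a / y + 1" "a / y \<le> x / y + 1" using assms(2) by linarith+
  then show "x \<le> a + y" "a \<le> x + y" using assms(1) by (simp_all add: field_simps)
  assume "0 \<le> a"
  then have "0 \<le> \<lfloor>x / y\<rfloor>" using assms by simp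
  then show "0 \<le> x" using assms(1) by (simp add: zero_le_divide_iff)
qed

lemma cube_cells:
  assumes y: "0 < y" and a: "a \<in> cube x" and z: "\<And>i. \<lfloor>z $ i / y\<rfloor> = \<lfloor>a $ i / y\<rfloor>"
  shows "z \<in> cube (x + y)"
proof -
  have "0 \<le> z $ i \<and> z $ i \<le> x + y" for i
  proof -
    have "0 \<le> a $ i" "a $ i \<le> x" using a by (auto simp: cube_def)
    then show ?thesis using cell_bounds(1,3)[OF y z[of i]] by linarith
  qed
  then show ?thesis by (simp add: cube_def)
qed

section \<open>Costs of cubes\<close>

text \<open>In logarithmic coordinates \<open>posX\<close> says that X is at most exp(m) on the unit
  cube with positive probability. \<open>lower\<close> and \<open>decay\<close> are the forms that
  hypotheses (e) and (d) take after the Lamperti transform.\<close>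

locale stationary_kernel =
  fixes C :: "real^'n \<Rightarrow> real^'n \<Rightarrow> real" and h :: "real^'n"
  assumes psd: "finite J \<Longrightarrow> psd_on J C"
    and nonneg: "0 \<le> C t s"
    and diag: "C t t = 1"
    and transl: "C (t + v) (s + v) = C t s"
    and h_pos: "0 < h $ i"
    and pos0: "\<exists>\<delta>>0. 0 < persistence_prob (cube \<delta>) C (\<lambda>_. 0)"
    and posX: "\<exists>m. 0 < persistence_prob {t. \<forall>i. t $ i \<le> 0} C (\<lambda>t. exp (m - h \<bullet> t))"
    and lower: "\<exists>c>0. \<forall>t s. (\<forall>i. s $ i \<le> t $ i) \<longrightarrow> c * exp (- (h \<bullet> (t - s))) \<le> C s t"
    and decay: "0 < \<epsilon> \<Longrightarrow> \<exists>L>0. \<forall>n. \<forall>t\<in>lattice L n. (\<Sum>s\<in>lattice L n. C t s) \<le> 1 + \<epsilon>"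
begin

abbreviation p :: "(real^'n) set \<Rightarrow> real" where
  "p S \<equiv> persistence_prob S C (\<lambda>_. 0)"

abbreviation cost :: "(real^'n) set \<Rightarrow> real" where
  "cost S \<equiv> - ln (p S)"

lemma sym: "C t s = C s t"
  using psd[of "{t, s}"] unfolding psd_on_def by blast

lemma persistence_translate:
  "persistence_prob ((\<lambda>t. t + v) ` S) C u = persistence_prob S C (\<lambda>t. u (t + v))"
  by (subst persistence_prob_image[OF psd]) (auto simp: transl)

text \<open>Translation by t + s - v carries the pair (v - t, v - s) to (s, t), and \<open>C\<close>
  is symmetric.\<close>

lemma reflect: "C (v - t) (v - s) = C t s"
  using transl[of "v - t" "t + s - v" "v - s"] sym[of s t] by (simp add: algebra_simps)

lemma p_reflect: "p ((\<lambda>t. v - t) ` S) = p S"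
  by (subst persistence_prob_image[OF psd]) (auto simp: reflect inj_def)

lemma p_mono: "S' \<subseteq> S \<Longrightarrow> p S \<le> p S'"
  by (rule persistence_prob_mono[OF psd]) auto

text \<open>Costs are subadditive, and at most vol(\<open>A'\<close>) / y^d translates of
  \<open>cube y\<close> cover \<open>A\<close>. Positivity of \<open>p (cube y)\<close> is a premise
  because this lemma is also what spreads positivity from one small cube to all cubes.\<close>

lemma p_grid_cover:
  assumes y: "0 < y" "0 < p (cube y)" and A': "A' \<in> sets borel" "emeasure lborel A' < \<infinity>"
    and cells: "\<And>a x. a \<in> A \<Longrightarrow> (\<And>i. \<lfloor>x $ i / y\<rfloor> = \<lfloor>a $ i / y\<rfloor>) \<Longrightarrow> x \<in> A'"
  shows "0 < p A" "cost A \<le> measure lborel A' * (cost (cube y) / y ^ CARD('n))"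
proof -
  obtain K where K: "finite K" "real (card K) * y ^ CARD('n) \<le> measure lborel A'"
    "A \<subseteq> (\<Union>k\<in>K. (\<lambda>t. t + k) ` cube y)"
    using grid_cover[OF y(1) A', of A] cells by blast
  have "p (cube y) ^ card K \<le> p (\<Union>k\<in>K. (\<lambda>t. t + k) ` cube y)"
    using y K by (intro persistence_prob_UN psd nonneg) (auto simp: persistence_translate)
  also have "\<dots> \<le> p A" by (rule p_mono) (use K in auto)
  finally have le: "p (cube y) ^ card K \<le> p A" .
  moreover have "0 < p (cube y) ^ card K" using y by simp
  ultimately show pA: "0 < p A" by linarith
  have "ln (p (cube y) ^ card K) \<le> ln (p A)" using le y pA by (subst ln_le_cancel_iff) auto
  then have "cost A \<le> real (card K) * cost (cube y)" using y by (simp add: ln_realpow)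
  also have "\<dots> = (real (card K) * y ^ CARD('n)) * (cost (cube y) / y ^ CARD('n))" using y by simp
  also have "\<dots> \<le> measure lborel A' * (cost (cube y) / y ^ CARD('n))"
    using K y persistence_prob_le_1[of "cube y" C "\<lambda>_. 0"]
    by (intro mult_right_mono divide_nonneg_pos) auto
  finally show "cost A \<le> measure lborel A' * (cost (cube y) / y ^ CARD('n))" .
qed

lemma emeasure_cube_finite: "emeasure lborel (cube x :: (real^'n) set) < \<infinity>"
  by (simp add: cube_eq_cbox emeasure_lborel_cbox_eq)

lemma p_cube_pos: "0 < p (cube x)"
proof -
  obtain \<delta> where \<delta>: "0 < \<delta>" "0 < p (cube \<delta>)" using pos0 by blast
  show ?thesis
    by (rule p_grid_cover(1)[OF \<delta> borel_cube emeasure_cube_finite]) (rule cube_cells[OF \<delta>(1)])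
qed

lemma cost_cube_nonneg: "0 \<le> cost (cube x)"
  using persistence_prob_le_1[of "cube x" C "\<lambda>_. 0"] p_cube_pos[of x] by simp

lemma cost_grid_cover:
  assumes "0 < y" "A' \<in> sets borel" "emeasure lborel A' < \<infinity>"
    and "\<And>a x. a \<in> A \<Longrightarrow> (\<And>i. \<lfloor>x $ i / y\<rfloor> = \<lfloor>a $ i / y\<rfloor>) \<Longrightarrow> x \<in> A'"
  shows "0 < p A" "cost A \<le> measure lborel A' * (cost (cube y) / y ^ CARD('n))"
  using p_grid_cover[OF assms(1) p_cube_pos assms(2,3)] assms(4) by blast+

text \<open>Taking the infimum rather than a limit makes \<open>\<psi>\<close> a lower bound for
  every single cube; that it is the limit follows in \<open>cost_cube_limit\<close>.\<close>

definition \<psi> :: real where "\<psi> = (INF y\<in>{0<..}. cost (cube y) / y ^ CARD('n))"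

lemma \<psi>_le: "0 < y \<Longrightarrow> \<psi> \<le> cost (cube y) / y ^ CARD('n)"
proof -
  assume "0 < y"
  moreover have "0 \<le> cost (cube x) / x ^ CARD('n)" if "0 < x" for x
    using cost_cube_nonneg[of x] that by (intro divide_nonneg_pos) auto
  ultimately show ?thesis unfolding \<psi>_def by (intro cINF_lower bdd_belowI2[of _ 0]) auto
qed

lemma \<psi>_approx:
  assumes "\<psi> < z" obtains y where "0 < y" "cost (cube y) / y ^ CARD('n) < z"
  using assms cInf_lessD[of "(\<lambda>y. cost (cube y) / y ^ CARD('n)) ` {0<..}" z] unfolding \<psi>_def by auto

lemma cost_cube_upper:
  assumes "0 < y" "0 \<le> x"
  shows "cost (cube x) \<le> (x + y) ^ CARD('n) * (cost (cube y) / y ^ CARD('n))"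
proof -
  have "cost (cube x) \<le> measure lborel (cube (x + y) :: (real^'n) set) * (cost (cube y) / y ^ CARD('n))"
    by (rule cost_grid_cover(2)[OF assms(1) borel_cube emeasure_cube_finite]) (rule cube_cells[OF assms(1)])
  then show ?thesis using assms by (simp add: measure_cube)
qed

lemma tendsto_shift_power:
  "((\<lambda>T::real. ((T * a + b) / T) ^ n) \<longlongrightarrow> a ^ n) at_top"
proof -
  have "((\<lambda>T::real. (a + b / T) ^ n) \<longlongrightarrow> (a + 0) ^ n) at_top"
    by (intro tendsto_intros tendsto_divide_0[OF tendsto_const] filterlim_at_top_imp_at_infinity filterlim_ident)
  moreover have "\<forall>\<^sub>F T::real in at_top. (a + b / T) ^ n = ((T * a + b) / T) ^ n"
    using eventually_gt_at_top[of 0] by eventually_elim (simp add: field_simps)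
  ultimately show ?thesis by (simp add: filterlim_cong)
qed

text \<open>Fekete's argument: the lower bound is the infimum itself. For the upper bound the cube
  is covered by cubes of a nearly optimal side y, and the waste at the boundary, a factor ((x +
  y)/x)^d, tends to 1.\<close>

lemma cost_cube_limit: "((\<lambda>x. cost (cube x) / x ^ CARD('n)) \<longlongrightarrow> \<psi>) at_top"
proof (rule order_tendstoI)
  fix a assume a: "a < \<psi>"
  show "\<forall>\<^sub>F x in at_top. a < cost (cube x) / x ^ CARD('n)"
    using eventually_gt_at_top[of 0]
  proof eventually_elim
    case (elim x)
    then show ?case using \<psi>_le[of x] a by linarith
  qed
next
  fix a assume "\<psi> < a"
  then obtain y where y: "0 < y" "cost (cube y) / y ^ CARD('n) < a" using \<psi>_approx by blast
  have "((\<lambda>x. ((x * 1 + y) / x) ^ CARD('n) * (cost (cube y) / y ^ CARD('n))) \<longlongrightarrow> 1 ^ CARD('n) * (cost (cube y) / y ^ CARD('n))) at_top"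
    by (intro tendsto_mult tendsto_shift_power tendsto_const)
  then have "\<forall>\<^sub>F x in at_top. ((x * 1 + y) / x) ^ CARD('n) * (cost (cube y) / y ^ CARD('n)) < a"
    using y by (intro order_tendstoD(2)) auto
  then show "\<forall>\<^sub>F x in at_top. cost (cube x) / x ^ CARD('n) < a"
    using eventually_gt_at_top[of 0]
  proof eventually_elim
    case (elim x)
    have "cost (cube x) / x ^ CARD('n) \<le> ((x + y) ^ CARD('n) * (cost (cube y) / y ^ CARD('n))) / x ^ CARD('n)"
      using cost_cube_upper[OF y(1), of x] elim by (intro divide_right_mono) auto
    also have "\<dots> = ((x * 1 + y) / x) ^ CARD('n) * (cost (cube y) / y ^ CARD('n))" by (simp add: power_divide)
    finally show ?case using elim by simp
  qed
qed

lemma finite_lattice: "finite (lattice L n)"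
  unfolding lattice_def by (rule finite_vec_coords) auto

lemma card_lattice: "0 < L \<Longrightarrow> card (lattice L n :: (real^'n) set) = n ^ CARD('n)"
  unfolding lattice_def by (subst card_vec_coords) (auto simp: card_image inj_on_def)

text \<open>The cube of side L n contains n^d lattice points whose correlations are weak enough to
  give probability at most q^(n^d); hence the cost per volume is at least -ln q / L^d.\<close>

lemma \<psi>_pos: "0 < \<psi>"
proof -
  obtain \<epsilon> q where \<epsilon>: "0 < \<epsilon>" and q: "0 < q" "q < 1" and
    H: "\<And>J C. finite (J :: (real^'n) set) \<Longrightarrow> psd_on J C \<Longrightarrow> (\<forall>t\<in>J. C t t = 1) \<Longrightarrow>
     (\<forall>t\<in>J. \<forall>s\<in>J. 0 \<le> C t s) \<Longrightarrow> (\<forall>t\<in>J. (\<Sum>s\<in>J. C t s) \<le> 1 + \<epsilon>) \<Longrightarrow> orthant_prob J C (\<lambda>_. 0) \<le> q ^ card J"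
    using orthant_prob_weak_correlation[where 'i="real^'n"] by blast
  obtain L where L: "0 < L" "\<And>n t. t \<in> lattice L n \<Longrightarrow> (\<Sum>s\<in>lattice L n. C t s) \<le> 1 + \<epsilon>"
    using decay[OF \<epsilon>] by blast
  have lb: "- ln q / L ^ CARD('n) \<le> cost (cube (L * real n)) / (L * real n) ^ CARD('n)" if n: "0 < n" for n :: nat
  proof -
    have sub: "(lattice L n :: (real^'n) set) \<subseteq> cube (L * real n)"
    proof
      fix t :: "real^'n" assume t: "t \<in> lattice L n"
      have "0 \<le> t $ i \<and> t $ i \<le> L * real n" for i
      proof -
        obtain k where "k < n" "t $ i = L * real k" using t unfolding lattice_def by blast
        then show ?thesis using L(1) by simp
      qed
      then show "t \<in> cube (L * real n)" by (simp add: cube_def)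
    qed
    have "p (cube (L * real n)) \<le> orthant_prob (lattice L n) C (\<lambda>_. 0)"
      by (intro persistence_prob_le finite_lattice sub)
    also have "\<dots> \<le> q ^ card (lattice L n :: (real^'n) set)"
      using L nonneg diag by (intro H finite_lattice psd) auto
    finally have "p (cube (L * real n)) \<le> q ^ (n ^ CARD('n))" by (simp add: card_lattice L)
    then have "ln (p (cube (L * real n))) \<le> ln (q ^ (n ^ CARD('n)))"
      using p_cube_pos q by (subst ln_le_cancel_iff) auto
    then have "real n ^ CARD('n) * (- ln q) \<le> cost (cube (L * real n))" using q by (simp add: ln_realpow)
    then show ?thesis using L n by (simp add: field_simps power_mult_distrib)
  qed
  have "((\<lambda>n. cost (cube (L * real n)) / (L * real n) ^ CARD('n)) \<longlongrightarrow> \<psi>) sequentially"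
    using L by (intro filterlim_compose[OF cost_cube_limit] filterlim_tendsto_pos_mult_at_top[OF tendsto_const] filterlim_real_sequentially)
  then have "- ln q / L ^ CARD('n) \<le> \<psi>"
    using lb by (intro LIMSEQ_le_const) (auto intro!: exI[of _ 1])
  moreover have "0 < - ln q / L ^ CARD('n)" using q L by (intro divide_pos_pos) auto
  ultimately show ?thesis by linarith
qed

section \<open>Costs of simplices\<close>

definition vol :: real where "vol = measure lborel (corner_simplex h 1)"

lemma inner_h_le: "(\<And>i. t $ i \<le> s $ i) \<Longrightarrow> h \<bullet> t \<le> h \<bullet> s"
  using h_pos by (intro inner_mono_nonneg) (auto intro: less_imp_le)

lemma h1_pos: "0 < h \<bullet> 1"
  using h_pos by (auto simp: inner_vec_def intro!: sum_pos)

text \<open>The sum of the intercepts H / h_i of S_h on the axes serves as a common bound for all of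
  them, so a cube of side \<open>x * width\<close> contains the simplex.\<close>

definition width :: real where "width = (\<Sum>i\<in>UNIV. (h \<bullet> 1) / h $ i)"

lemma width_pos: "0 < width"
  unfolding width_def using h_pos h1_pos by (auto intro!: sum_pos)

lemma corner_simplex_subset_cube: "0 \<le> x \<Longrightarrow> corner_simplex h x \<subseteq> cube (x * width)"
proof
  fix t assume x: "0 \<le> x" and t: "t \<in> corner_simplex h x"
  have "t $ i \<le> x * width" for i
  proof -
    have "h $ i * t $ i \<le> x * (h \<bullet> 1)"
      using component_le_inner[of h t i] t h_pos by (force simp: corner_simplex_def less_imp_le)
    then have "t $ i \<le> x * ((h \<bullet> 1) / h $ i)" using h_pos[of i] by (simp add: field_simps)
    also have "(h \<bullet> 1) / h $ i \<le> width"
      unfolding width_def using h_pos h1_pos by (intro member_le_sum) (auto simp: less_imp_le)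
    finally show ?thesis using x by (simp add: mult_left_mono)
  qed
  then show "t \<in> cube (x * width)" using t by (simp add: cube_def corner_simplex_def)
qed

lemma fmeasurable_corner_simplex: "0 \<le> x \<Longrightarrow> corner_simplex h x \<in> fmeasurable lborel"
proof -
  assume "0 \<le> x"
  then have "emeasure lborel (corner_simplex h x) \<le> emeasure lborel (cube (x * width) :: (real^'n) set)"
    by (intro emeasure_mono corner_simplex_subset_cube) auto
  also have "\<dots> < \<infinity>" by (rule emeasure_cube_finite)
  finally show ?thesis by (simp add: fmeasurable_def)
qed

lemma measure_corner_simplex:
  assumes "0 < x" shows "measure lborel (corner_simplex h x) = x ^ CARD('n) * vol"
proof -
  have "corner_simplex h 1 \<in> lmeasurable"
    using fmeasurable_corner_simplex[of 1] by (simp add: fmeasurable_def)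
  then have "measure lebesgue ((\<lambda>t. \<chi> k. x * t $ k) ` corner_simplex h 1) = \<bar>\<Prod>k\<in>(UNIV::'n set). x\<bar> * measure lebesgue (corner_simplex h 1)"
    by (rule measure_stretch)
  moreover have "(\<lambda>t. \<chi> k. x * t $ k) ` corner_simplex h 1 = corner_simplex h x"
  proof -
    have "(\<lambda>t::real^'n. \<chi> k. x * t $ k) = (\<lambda>t. x *\<^sub>R t)" by (simp add: fun_eq_iff vec_eq_iff)
    then show ?thesis by (simp only: corner_simplex_scale[OF assms])
  qed
  ultimately have "measure lebesgue (corner_simplex h x) = x ^ CARD('n) * measure lebesgue (corner_simplex h 1)"
    using assms by simp
  then show ?thesis by (simp add: vol_def)
qed

lemma vol_ge_1: "1 \<le> vol"
proof -
  have "cube 1 \<subseteq> corner_simplex h 1"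
    using inner_h_le[of _ 1] by (auto simp: cube_def corner_simplex_def)
  then have "measure lborel (cube 1 :: (real^'n) set) \<le> vol"
    unfolding vol_def using fmeasurable_corner_simplex[of 1] by (intro measure_mono_fmeasurable) auto
  then show ?thesis by (simp add: measure_cube)
qed

lemma vol_le: "vol \<le> width ^ CARD('n)"
proof -
  have "vol \<le> measure lborel (cube (1 * width) :: (real^'n) set)"
    unfolding vol_def using emeasure_cube_finite corner_simplex_subset_cube[of 1]
    by (intro measure_mono_fmeasurable) (auto simp: fmeasurable_def)
  then show ?thesis using width_pos by (simp add: measure_cube)
qed

lemma p_corner_simplex_pos: "0 \<le> x \<Longrightarrow> 0 < p (corner_simplex h x)"
  using p_cube_pos[of "x * width"] p_mono[OF corner_simplex_subset_cube, of x] by linarith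

lemma cell_inner_bounds:
  assumes "0 < y" "\<And>i. \<lfloor>x $ i / y\<rfloor> = \<lfloor>a $ i / y\<rfloor>"
  shows "h \<bullet> x \<le> h \<bullet> a + y * (h \<bullet> 1)" "h \<bullet> a \<le> h \<bullet> x + y * (h \<bullet> 1)"
proof -
  have "h \<bullet> x \<le> h \<bullet> (a + y *\<^sub>R 1)" "h \<bullet> a \<le> h \<bullet> (x + y *\<^sub>R 1)"
    using cell_bounds(1,2)[OF assms(1) assms(2)] by (intro inner_h_le; simp)+
  then show "h \<bullet> x \<le> h \<bullet> a + y * (h \<bullet> 1)" "h \<bullet> a \<le> h \<bullet> x + y * (h \<bullet> 1)" by (simp_all add: inner_add_right)
qed

lemma cost_simplex_upper:
  assumes y: "0 < y" and x: "0 \<le> x"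
  shows "cost (corner_simplex h x) \<le> (x + y) ^ CARD('n) * vol * (cost (cube y) / y ^ CARD('n))"
proof -
  have "cost (corner_simplex h x) \<le> measure lborel (corner_simplex h (x + y)) * (cost (cube y) / y ^ CARD('n))"
  proof (rule cost_grid_cover(2)[OF y])
    show "emeasure lborel (corner_simplex h (x + y)) < \<infinity>"
      using fmeasurable_corner_simplex[of "x + y"] x y by (simp add: fmeasurable_def)
    fix a z assume a: "a \<in> corner_simplex h x" and z: "\<And>i. \<lfloor>z $ i / y\<rfloor> = \<lfloor>a $ i / y\<rfloor>"
    have "h \<bullet> z \<le> (x + y) * (h \<bullet> 1)" using cell_inner_bounds(1)[OF y z] a by (auto simp: corner_simplex_def distrib_right)
    then show "z \<in> corner_simplex h (x + y)" using cell_bounds(3)[OF y z] a by (auto simp: corner_simplex_def)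
  qed auto
  then show ?thesis using assms by (simp add: measure_corner_simplex)
qed

text \<open>The large cube pays at least \<open>\<psi>\<close> times its volume. Its part
  \<open>A\<close> outside the simplex pays at most the rate of \<open>cube y\<close> times the
  volume of \<open>A'\<close>, which also contains all grid cells meeting \<open>A\<close>. The
  simplex must pay the difference.\<close>

lemma cost_simplex_lower:
  assumes y: "0 < y" and x: "y < x"
  shows "\<psi> * (x * width) ^ CARD('n) - ((x * width + y) ^ CARD('n) - (x - y) ^ CARD('n) * vol) * (cost (cube y) / y ^ CARD('n))
    \<le> cost (corner_simplex h x)"
proof -
  define A where "A = cube (x * width) - corner_simplex h x"
  define A' where "A' = cube (x * width + y) - corner_simplex h (x - y)"
  have x0: "0 < x" using x y by simp
  have sub: "corner_simplex h (x - y) \<subseteq> cube (x * width + y)"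
  proof -
    have "corner_simplex h (x - y) \<subseteq> cube ((x - y) * width)" using x by (intro corner_simplex_subset_cube) auto
    also have "\<dots> \<subseteq> cube (x * width + y)"
    proof -
      have "0 \<le> y * width" using width_pos y by simp
      then have "(x - y) * width \<le> x * width + y" using y by (simp add: algebra_simps)
      then show ?thesis by (auto simp: cube_def intro: order_trans)
    qed
    finally show ?thesis .
  qed
  have A: "0 < p A" "cost A \<le> measure lborel A' * (cost (cube y) / y ^ CARD('n))"
  proof -
    have m: "A' \<in> sets borel" by (auto simp: A'_def)
    have "emeasure lborel A' \<le> emeasure lborel (cube (x * width + y) :: (real^'n) set)"
      by (intro emeasure_mono) (auto simp: A'_def)
    also have "\<dots> < \<infinity>" by (rule emeasure_cube_finite)
    finally have f: "emeasure lborel A' < \<infinity>" .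
    have c: "z \<in> A'" if a: "a \<in> A" and z: "\<And>i. \<lfloor>z $ i / y\<rfloor> = \<lfloor>a $ i / y\<rfloor>" for a z
    proof -
      have "a \<in> cube (x * width)" using a by (simp add: A_def)
      then have 1: "z \<in> cube (x * width + y)" using z by (rule cube_cells[OF y])
      have "x * (h \<bullet> 1) < h \<bullet> a" using a by (auto simp: A_def corner_simplex_def cube_def)
      then have "(x - y) * (h \<bullet> 1) < h \<bullet> z" using cell_inner_bounds(2)[OF y z] by (simp add: algebra_simps)
      then show ?thesis using 1 by (auto simp: A'_def corner_simplex_def)
    qed
    show "0 < p A" by (rule cost_grid_cover(1)[OF y m f]) (rule c)
    show "cost A \<le> measure lborel A' * (cost (cube y) / y ^ CARD('n))"
      by (rule cost_grid_cover(2)[OF y m f]) (rule c)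
  qed
  have mA: "measure lborel A' = (x * width + y) ^ CARD('n) - (x - y) ^ CARD('n) * vol"
  proof -
    have "measure lborel A' = measure lborel (cube (x * width + y) :: (real^'n) set) - measure lborel (corner_simplex h (x - y))"
      unfolding A'_def using sub emeasure_cube_finite by (intro measure_Diff) (auto simp: less_top)
    then show ?thesis using x y width_pos x0 by (simp add: measure_cube measure_corner_simplex)
  qed
  have "p (corner_simplex h x) * p A \<le> p (corner_simplex h x \<union> A)" by (rule persistence_prob_Un[OF psd nonneg])
  also have "corner_simplex h x \<union> A = cube (x * width)" using corner_simplex_subset_cube[of x] x0 by (auto simp: A_def)
  finally have "ln (p (corner_simplex h x) * p A) \<le> ln (p (cube (x * width)))"
    using p_cube_pos A p_corner_simplex_pos[of x] x0 by (subst ln_le_cancel_iff) auto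
  then have "cost (cube (x * width)) \<le> cost (corner_simplex h x) + cost A"
    using A p_corner_simplex_pos[of x] x0 by (simp add: ln_mult)
  moreover have "\<psi> * (x * width) ^ CARD('n) \<le> cost (cube (x * width))"
  proof -
    have "0 < x * width" using x0 width_pos by simp
    then show ?thesis using \<psi>_le[of "x * width"] pos_le_divide_eq[of "(x * width) ^ CARD('n)"] zero_less_power by blast
  qed
  ultimately show ?thesis using A(2) unfolding mA by linarith
qed

lemma cost_simplex_limit: "((\<lambda>x. cost (corner_simplex h x) / x ^ CARD('n)) \<longlongrightarrow> \<psi> * vol) at_top"
proof (rule order_tendstoI)
  fix a assume a: "\<psi> * vol < a"
  then have "\<psi> < a / vol" using vol_ge_1 by (simp add: field_simps)
  then obtain y where y: "0 < y" "cost (cube y) / y ^ CARD('n) < a / vol" using \<psi>_approx by blast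
  define \<gamma> where "\<gamma> = cost (cube y) / y ^ CARD('n)"
  have "((\<lambda>x. ((x * 1 + y) / x) ^ CARD('n) * (vol * \<gamma>)) \<longlongrightarrow> 1 ^ CARD('n) * (vol * \<gamma>)) at_top"
    by (intro tendsto_mult tendsto_shift_power tendsto_const)
  then have "\<forall>\<^sub>F x in at_top. ((x * 1 + y) / x) ^ CARD('n) * (vol * \<gamma>) < a"
    using y vol_ge_1 by (intro order_tendstoD(2)) (auto simp: \<gamma>_def field_simps)
  then show "\<forall>\<^sub>F x in at_top. cost (corner_simplex h x) / x ^ CARD('n) < a"
    using eventually_gt_at_top[of 0]
  proof eventually_elim
    case (elim x)
    have "cost (corner_simplex h x) / x ^ CARD('n) \<le> ((x + y) ^ CARD('n) * vol * \<gamma>) / x ^ CARD('n)"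
      unfolding \<gamma>_def using cost_simplex_upper[OF y(1), of x] elim by (intro divide_right_mono) auto
    also have "\<dots> = ((x * 1 + y) / x) ^ CARD('n) * (vol * \<gamma>)" by (simp add: power_divide)
    finally show ?case using elim by simp
  qed
next
  fix a assume a: "a < \<psi> * vol"
  define w where "w = width ^ CARD('n)"
  have w: "0 \<le> w - vol" using vol_le by (simp add: w_def)
  \<comment> \<open>Chosen so that the excess rate \<open>\<eta>\<close> on the complementary volume
    w - vol costs less than \<open>\<psi> * vol - a\<close>. The added 1 covers w = vol, as in
    dimension one.\<close>
  define \<eta> where "\<eta> = (\<psi> * vol - a) / (w - vol + 1)"
  have "0 < \<eta>" using a w by (simp add: \<eta>_def)
  then obtain y where y: "0 < y" "cost (cube y) / y ^ CARD('n) < \<psi> + \<eta>" using \<psi>_approx[of "\<psi> + \<eta>"] by auto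
  define \<gamma> where "\<gamma> = cost (cube y) / y ^ CARD('n)"
  have \<gamma>: "a < \<psi> * w - (w - vol) * \<gamma>"
  proof -
    have "(w - vol) * (\<gamma> - \<psi>) \<le> (w - vol) * \<eta>" using y w by (intro mult_left_mono) (auto simp: \<gamma>_def)
    also have "\<dots> < (w - vol + 1) * \<eta>" using \<open>0 < \<eta>\<close> by (simp add: algebra_simps)
    also have "\<dots> = \<psi> * vol - a" using w by (simp add: \<eta>_def)
    finally show ?thesis by (simp add: algebra_simps)
  qed
  have "((\<lambda>x. \<psi> * w - (((x * width + y) / x) ^ CARD('n) - ((x * 1 + - y) / x) ^ CARD('n) * vol) * \<gamma>) \<longlongrightarrow>
     \<psi> * w - (width ^ CARD('n) - 1 ^ CARD('n) * vol) * \<gamma>) at_top"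
    by (intro tendsto_mult tendsto_diff tendsto_shift_power tendsto_const)
  then have "\<forall>\<^sub>F x in at_top. a < \<psi> * w - (((x * width + y) / x) ^ CARD('n) - ((x * 1 + - y) / x) ^ CARD('n) * vol) * \<gamma>"
    using \<gamma> by (intro order_tendstoD(1)) (auto simp: w_def)
  then show "\<forall>\<^sub>F x in at_top. a < cost (corner_simplex h x) / x ^ CARD('n)"
    using eventually_gt_at_top[of y]
  proof eventually_elim
    case (elim x)
    have x: "0 < x" using elim y by simp
    have "\<psi> * w - (((x * width + y) / x) ^ CARD('n) - ((x * 1 + - y) / x) ^ CARD('n) * vol) * \<gamma>
       = (\<psi> * (x * width) ^ CARD('n) - ((x * width + y) ^ CARD('n) - (x - y) ^ CARD('n) * vol) * \<gamma>) / x ^ CARD('n)"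
      using x by (simp add: power_divide power_mult_distrib w_def field_simps)
    also have "\<dots> \<le> cost (corner_simplex h x) / x ^ CARD('n)"
      unfolding \<gamma>_def using cost_simplex_lower[OF y(1), of x] elim x by (intro divide_right_mono) auto
    finally show ?case using elim by simp
  qed
qed

end

section \<open>The level one problem\<close>

context stationary_kernel
begin

text \<open>This is the probability that X is at most 1 on the cube of side
  exp(\<open>\<tau>\<close>), as \<open>stays_below_X\<close> shows.\<close>

definition level_prob :: "real \<Rightarrow> real" where
  "level_prob \<tau> = persistence_prob {t. \<forall>i. t $ i \<le> \<tau>} C (\<lambda>t. exp (- (h \<bullet> t)))"

definition wedge :: "real \<Rightarrow> (real^'n) set" where
  "wedge x = {t. (\<forall>i. t $ i \<le> x) \<and> 0 \<le> h \<bullet> t}"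

text \<open>The reflection of t to x 1 - t turns t_i <= x into nonnegativity and 0 <= h . t into h .
  t <= x H.\<close>

lemma p_wedge: "p (wedge x) = p (corner_simplex h x)"
proof -
  have "corner_simplex h x = (\<lambda>t. x *\<^sub>R 1 - t) ` wedge x"
  proof (intro equalityI subsetI)
    fix t assume "t \<in> corner_simplex h x"
    then have "x *\<^sub>R 1 - t \<in> wedge x" by (simp add: wedge_def corner_simplex_def inner_diff_right)
    then show "t \<in> (\<lambda>t. x *\<^sub>R 1 - t) ` wedge x" by (intro image_eqI[of _ _ "x *\<^sub>R 1 - t"]) auto
  qed (auto simp: wedge_def corner_simplex_def inner_diff_right)
  then show ?thesis by (simp only: p_reflect)
qed

text \<open>A diagonal shift fits the wedge to the corner \<open>\<tau>\<close> with a displaced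
  lower face; it is used with y = \<open>\<delta> * \<tau>\<close> and with y =
  -\<open>\<delta> * \<tau>\<close>.\<close>

lemma p_wedge_translate: "p {t. (\<forall>i. t $ i \<le> x - y) \<and> - y * (h \<bullet> 1) \<le> h \<bullet> t} = p (corner_simplex h x)"
proof -
  have "{t. (\<forall>i. t $ i \<le> x - y) \<and> - y * (h \<bullet> 1) \<le> h \<bullet> t} = (\<lambda>t. t + (- y) *\<^sub>R 1) ` wedge x"
  proof (intro equalityI subsetI)
    fix t assume "t \<in> {t. (\<forall>i. t $ i \<le> x - y) \<and> - y * (h \<bullet> 1) \<le> h \<bullet> t}"
    then have "t + y *\<^sub>R 1 \<in> wedge x" by (simp add: wedge_def inner_add_right le_diff_eq)
    then show "t \<in> (\<lambda>t. t + (- y) *\<^sub>R 1) ` wedge x" by (intro image_eqI[of _ _ "t + y *\<^sub>R 1"]) auto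
  qed (auto simp: wedge_def inner_diff_right)
  then show ?thesis by (simp only: persistence_translate p_wedge)
qed

lemma h1_le_width: "(h \<bullet> 1) \<le> width * h $ i"
proof -
  have "(h \<bullet> 1) / h $ i \<le> width"
    unfolding width_def using h_pos h1_pos by (intro member_le_sum) (auto simp: less_imp_le)
  then show ?thesis using h_pos[of i] by (simp add: field_simps)
qed

text \<open>Scaled by \<open>\<tau>\<close> / N this gives corners from -\<open>\<tau>\<close> P / N
  up to \<open>\<tau>\<close> in each coordinate; their number does not grow with
  \<open>\<tau>\<close>.\<close>

definition grid :: "nat \<Rightarrow> nat \<Rightarrow> (real^'n) set" where
  "grid P N = {z. \<forall>i. z $ i \<in> real_of_int ` {- int P..int N}}"

lemma finite_grid: "finite (grid P N)"
  unfolding grid_def by (rule finite_vec_coords) auto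

text \<open>Moving the corner of the orthant from \<open>b\<close> to 0 multiplies the level by
  exp(-h . b), which is at least exp(m). For X this is self-similarity: X <= 1 on a small box is no
  rarer than X <= exp(m) on the unit cube.\<close>

lemma persistence_box:
  assumes "h \<bullet> b \<le> - m"
  shows "persistence_prob {t. \<forall>i. t $ i \<le> 0} C (\<lambda>t. exp (m - h \<bullet> t)) \<le> persistence_prob {t. \<forall>i. t $ i \<le> b $ i} C (\<lambda>t. exp (- (h \<bullet> t)))"
proof -
  have "{t. \<forall>i. t $ i \<le> b $ i} = (\<lambda>t. t + b) ` {t. \<forall>i. t $ i \<le> 0}"
  proof (intro equalityI subsetI)
    fix t assume "t \<in> {t. \<forall>i. t $ i \<le> b $ i}"
    then show "t \<in> (\<lambda>t. t + b) ` {t. \<forall>i. t $ i \<le> 0}" by (intro image_eqI[of _ _ "t - b"]) auto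
  qed auto
  then have "persistence_prob {t. \<forall>i. t $ i \<le> b $ i} C (\<lambda>t. exp (- (h \<bullet> t))) =
     persistence_prob {t. \<forall>i. t $ i \<le> 0} C (\<lambda>t. exp (- (h \<bullet> (t + b))))"
    by (simp only: persistence_translate)
  moreover have "persistence_prob {t. \<forall>i. t $ i \<le> 0} C (\<lambda>t. exp (m - h \<bullet> t)) \<le>
     persistence_prob {t. \<forall>i. t $ i \<le> 0} C (\<lambda>t. exp (- (h \<bullet> (t + b))))"
    using assms by (intro persistence_prob_mono psd) (auto simp: inner_add_right)
  ultimately show ?thesis by simp
qed

text \<open>Coordinates are rounded up to mesh \<open>\<tau>\<close> / N. This raises h . t by at
  most half of the available margin, unless some coordinate is cut off at -P; then that coordinate
  alone makes h . b very negative.\<close>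

lemma below_wedge_cover:
  assumes \<delta>: "0 < \<delta>"
  obtains N P \<kappa> where "0 < N" "0 < \<kappa>"
    "\<And>\<tau>. 0 < \<tau> \<Longrightarrow> {t. (\<forall>i. t $ i \<le> \<tau>) \<and> h \<bullet> t \<le> - (\<delta> * \<tau>) * (h \<bullet> 1)}
       \<subseteq> (\<Union>z\<in>{z \<in> grid P N. h \<bullet> ((\<tau> / N) *\<^sub>R z) \<le> - \<kappa> * \<tau>}. {t. \<forall>i. t $ i \<le> ((\<tau> / N) *\<^sub>R z) $ i})"
proof -
  obtain N :: nat where "2 / \<delta> < N" using reals_Archimedean2 by blast
  moreover have "0 < 2 / \<delta>" using \<delta> by simp
  ultimately have "0 < real N" by linarith
  then have N: "0 < N" "1 / real N \<le> \<delta> / 2" using \<delta> \<open>2 / \<delta> < N\<close> by (simp_all add: field_simps)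
  \<comment> \<open>A coordinate that is cut off equals -Q \<open>\<tau>\<close>. Since (Q + 1) h_i
    is at least 2 H, it brings h . b down from the trivial bound \<open>\<tau>\<close> H to at most
    -\<open>\<tau>\<close> H.\<close>
  obtain Q :: nat where Q: "2 * width < Q" using reals_Archimedean2 by blast
  define P where "P = N * Q"
  \<comment> \<open>The smaller of the two rates: H when a coordinate is cut off, and
    \<open>\<delta>\<close> H / 2 when none is.\<close>
  define \<kappa> where "\<kappa> = min 1 (\<delta> / 2) * (h \<bullet> 1)"
  have \<kappa>: "0 < \<kappa>" using \<delta> h1_pos by (simp add: \<kappa>_def)
  show ?thesis
  proof (rule that[OF N(1) \<kappa>], rule subsetI)
    fix \<tau> t assume \<tau>: "0 < \<tau>" and "t \<in> {t. (\<forall>i. t $ i \<le> \<tau>) \<and> h \<bullet> t \<le> - (\<delta> * \<tau>) * (h \<bullet> 1)}"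
    then have t: "\<And>i. t $ i \<le> \<tau>" "h \<bullet> t \<le> - (\<delta> * \<tau>) * (h \<bullet> 1)" by auto
    define z where "z = (\<chi> i. real_of_int (max \<lceil>t $ i * N / \<tau>\<rceil> (- int P)))"
    define b where "b = (\<tau> / N) *\<^sub>R z"
    have b: "b $ i = \<tau> / N * real_of_int (max \<lceil>t $ i * N / \<tau>\<rceil> (- int P))" for i by (simp add: b_def z_def)
    have zN: "max \<lceil>t $ i * N / \<tau>\<rceil> (- int P) \<le> int N" for i
    proof -
      have "t $ i * N / \<tau> \<le> N" using t(1)[of i] \<tau> N by (simp add: pos_divide_le_eq mult.commute)
      then have "\<lceil>t $ i * N / \<tau>\<rceil> \<le> int N" by (simp add: ceiling_le_iff)
      then show ?thesis by simp
    qed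
    then have zg: "z \<in> grid P N" by (auto simp: grid_def z_def)
    have b\<tau>: "b $ i \<le> \<tau>" for i
    proof -
      have "\<tau> / N * real_of_int (max \<lceil>t $ i * N / \<tau>\<rceil> (- int P)) \<le> \<tau> / N * real N"
        using zN[of i] \<tau> by (intro mult_left_mono) (auto simp: of_int_le_iff[symmetric, where 'a=real] simp del: of_int_max of_int_le_iff)
      then show ?thesis using N by (simp add: b)
    qed
    have tb: "t $ i \<le> b $ i" for i
    proof -
      have "\<tau> / N * (t $ i * N / \<tau>) \<le> \<tau> / N * real_of_int (max \<lceil>t $ i * N / \<tau>\<rceil> (- int P))"
        using \<tau> by (intro mult_left_mono) (auto intro: order_trans[OF le_of_int_ceiling])
      then show ?thesis using N \<tau> by (simp add: b)
    qed
    have "h \<bullet> b \<le> - \<kappa> * \<tau>"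
    proof (cases "\<exists>i. \<lceil>t $ i * N / \<tau>\<rceil> \<le> - int P")
      case True
      then obtain i where i: "\<lceil>t $ i * N / \<tau>\<rceil> \<le> - int P" by blast
      have bi: "b $ i = - (\<tau> * Q)" using i N by (simp add: b max_absorb2 P_def)
      have "h \<bullet> b \<le> h \<bullet> (\<tau> *\<^sub>R 1 - axis i (\<tau> * (Q + 1)))"
      proof (rule inner_h_le)
        fix j show "b $ j \<le> (\<tau> *\<^sub>R 1 - axis i (\<tau> * (Q + 1))) $ j"
          using b\<tau>[of j] bi by (cases "j = i") (auto simp: axis_def algebra_simps)
      qed
      also have "\<dots> = \<tau> * (h \<bullet> 1) - \<tau> * (Q + 1) * h $ i" by (simp add: inner_diff_right inner_axis mult.commute)
      also have "\<dots> \<le> \<tau> * (h \<bullet> 1) - \<tau> * (2 * (h \<bullet> 1))"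
      proof -
        have "2 * (h \<bullet> 1) \<le> 2 * (width * h $ i)" using h1_le_width[of i] by simp
        also have "\<dots> = (2 * width) * h $ i" by simp
        also have "\<dots> \<le> (Q + 1) * h $ i" using Q h_pos[of i] by (intro mult_right_mono) auto
        finally have "\<tau> * (2 * (h \<bullet> 1)) \<le> \<tau> * ((Q + 1) * h $ i)" using \<tau> by (intro mult_left_mono) auto
        then show ?thesis by (simp add: mult.assoc)
      qed
      also have "\<dots> = - (h \<bullet> 1) * \<tau>" by simp
      also have "\<dots> \<le> - \<kappa> * \<tau>" using \<tau> h1_pos by (intro mult_right_mono) (auto simp: \<kappa>_def intro!: mult_left_le_one_le)
      finally show ?thesis .
    next
      case False
      have "h \<bullet> b \<le> h \<bullet> (t + (\<tau> / N) *\<^sub>R 1)"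
      proof (rule inner_h_le)
        fix j
        have "real_of_int (max \<lceil>t $ j * N / \<tau>\<rceil> (- int P)) \<le> t $ j * N / \<tau> + 1"
          using False[simplified, rule_format, of j] by (simp add: max_absorb1)
        then have "b $ j \<le> \<tau> / N * (t $ j * N / \<tau> + 1)" unfolding b using \<tau> by (intro mult_left_mono) auto
        also have "\<dots> = t $ j + \<tau> / N" using \<tau> N by (simp add: distrib_left)
        finally show "b $ j \<le> (t + (\<tau> / N) *\<^sub>R 1) $ j" by simp
      qed
      also have "\<dots> = h \<bullet> t + (1 / N) * (\<tau> * (h \<bullet> 1))" by (simp add: inner_add_right)
      also have "\<dots> \<le> - (\<delta> * \<tau>) * (h \<bullet> 1) + \<delta> / 2 * (\<tau> * (h \<bullet> 1))"
        using t(2) N(2) \<tau> h1_pos by (intro add_mono mult_right_mono) auto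
      also have "\<dots> = - (\<delta> / 2 * (h \<bullet> 1)) * \<tau>" by simp
      also have "\<dots> \<le> - \<kappa> * \<tau>" using \<tau> h1_pos by (intro mult_right_mono) (auto simp: \<kappa>_def)
      finally show ?thesis .
    qed
    then show "t \<in> (\<Union>z\<in>{z \<in> grid P N. h \<bullet> ((\<tau> / N) *\<^sub>R z) \<le> - \<kappa> * \<tau>}. {t. \<forall>i. t $ i \<le> ((\<tau> / N) *\<^sub>R z) $ i})"
      using zg tb unfolding b_def by blast
  qed
qed

text \<open>The region is split at h . t = -\<open>\<delta> * \<tau>\<close> H. Below, it is covered
  by boundedly many boxes, each of probability at least \<open>p0\<close> once
  \<open>\<kappa> * \<tau>\<close> exceeds m. Above, Y <= 0 is more than required, and the set is a
  copy of the simplex of size \<open>\<tau> * (1 + \<delta>)\<close>.\<close>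

lemma level_prob_lower:
  assumes \<delta>: "0 < \<delta>"
  shows "\<exists>q>0. \<forall>\<^sub>F \<tau> in at_top. q * p (corner_simplex h (\<tau> * (1 + \<delta>))) \<le> level_prob \<tau>"
proof -
  let ?u = "\<lambda>t. exp (- (h \<bullet> t))"
  obtain m where m: "0 < persistence_prob {t. \<forall>i. t $ i \<le> 0} C (\<lambda>t. exp (m - h \<bullet> t))" using posX by blast
  define p0 where "p0 = persistence_prob {t. \<forall>i. t $ i \<le> 0} C (\<lambda>t. exp (m - h \<bullet> t))"
  have p0: "0 < p0" "p0 \<le> 1" using m by (auto simp: p0_def persistence_prob_le_1)
  obtain N \<kappa> P where N: "0 < N" "0 < \<kappa>"
    and cover: "\<And>\<tau>. 0 < \<tau> \<Longrightarrow> {t. (\<forall>i. t $ i \<le> \<tau>) \<and> h \<bullet> t \<le> - (\<delta> * \<tau>) * (h \<bullet> 1)}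
       \<subseteq> (\<Union>z\<in>{z \<in> grid P N. h \<bullet> ((\<tau> / N) *\<^sub>R z) \<le> - \<kappa> * \<tau>}. {t. \<forall>i. t $ i \<le> ((\<tau> / N) *\<^sub>R z) $ i})"
    by (rule below_wedge_cover[OF \<delta>], rule that, assumption+)
  define q where "q = p0 ^ card (grid P N)"
  have "\<forall>\<^sub>F \<tau> in at_top. q * p (corner_simplex h (\<tau> * (1 + \<delta>))) \<le> level_prob \<tau>"
    using eventually_gt_at_top[of 0] eventually_gt_at_top[of "m / \<kappa>"]
  proof eventually_elim
    case (elim \<tau>)
    have m\<tau>: "- \<kappa> * \<tau> \<le> - m" using elim N by (simp add: field_simps)
    define D where "D = {t. (\<forall>i. t $ i \<le> \<tau>) \<and> - (\<delta> * \<tau>) * (h \<bullet> 1) \<le> h \<bullet> t}"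
    define E where "E = {t. (\<forall>i. t $ i \<le> \<tau>) \<and> h \<bullet> t \<le> - (\<delta> * \<tau>) * (h \<bullet> 1)}"
    define F where "F = {z \<in> grid P N. h \<bullet> ((\<tau> / N) *\<^sub>R z) \<le> - \<kappa> * \<tau>}"
    have F: "finite F" "card F \<le> card (grid P N)"
      using finite_grid by (auto simp: F_def intro!: card_mono)
    have "q \<le> p0 ^ card F" unfolding q_def using p0 F by (intro power_decreasing) auto
    also have "\<dots> \<le> persistence_prob (\<Union>z\<in>F. {t. \<forall>i. t $ i \<le> ((\<tau> / N) *\<^sub>R z) $ i}) C ?u"
    proof (rule persistence_prob_UN[OF psd nonneg F(1)])
      fix z assume "z \<in> F"
      then have "h \<bullet> ((\<tau> / N) *\<^sub>R z) \<le> - m" using m\<tau> by (simp add: F_def)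
      then show "p0 \<le> persistence_prob {t. \<forall>i. t $ i \<le> ((\<tau> / N) *\<^sub>R z) $ i} C ?u"
        unfolding p0_def by (rule persistence_box)
    qed (use p0 in auto)
    also have "\<dots> \<le> persistence_prob E C ?u"
      using cover[OF elim(1)] by (intro persistence_prob_mono psd) (auto simp: E_def F_def)
    finally have 1: "q \<le> persistence_prob E C ?u" .
    have "p (corner_simplex h (\<tau> * (1 + \<delta>))) = p D"
      using p_wedge_translate[of "\<tau> * (1 + \<delta>)" "\<delta> * \<tau>"] by (simp add: D_def algebra_simps)
    also have "\<dots> \<le> persistence_prob D C ?u" by (intro persistence_prob_mono psd) auto
    finally have 2: "p (corner_simplex h (\<tau> * (1 + \<delta>))) \<le> persistence_prob D C ?u" .
    have "q * p (corner_simplex h (\<tau> * (1 + \<delta>))) \<le> persistence_prob E C ?u * persistence_prob D C ?u"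
      using 1 2 by (intro mult_mono persistence_prob_nonneg)
    also have "\<dots> \<le> persistence_prob (E \<union> D) C ?u" by (rule persistence_prob_Un[OF psd nonneg])
    also have "E \<union> D = {t. \<forall>i. t $ i \<le> \<tau>}" by (auto simp: E_def D_def)
    finally show ?case by (simp add: level_prob_def)
  qed
  moreover have "0 < q" using p0 by (simp add: q_def)
  ultimately show ?thesis by blast
qed

lemma C_le_1: "C t s \<le> 1"
proof (cases "t = s")
  case False
  have "0 \<le> quad_form {t, s} C (\<lambda>x. if x = t then 1 else -1)" using psd[of "{t, s}"] unfolding psd_on_def by blast
  then show ?thesis using False sym[of t s] diag by (simp add: quad_form_def)
qed (simp add: diag)

text \<open>The shift direction $\sum_b Y(b)$ runs over finitely many points \<open>b\<close> with
  \<open>h \<bullet> b \<ge> 0\<close> such that every \<open>t\<close> of the region dominates one of them; the number of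
  points does not depend on \<open>\<tau>\<close>.\<close>

lemma level_prob_upper:
  assumes \<delta>: "0 < \<delta>" "\<delta> < 1"
  shows "\<exists>k\<ge>0. \<forall>\<tau>>0. \<forall>M\<ge>0. level_prob \<tau> \<le> exp (- M\<^sup>2 / 2) + exp (M * k + k\<^sup>2 / 2) * p (corner_simplex h (\<tau> * (1 - \<delta>)))"
proof -
  obtain c where c: "0 < c" "\<And>t s. (\<And>i. s $ i \<le> t $ i) \<Longrightarrow> c * exp (- (h \<bullet> (t - s))) \<le> C s t"
    using lower by blast
  obtain N :: nat where "1 / \<delta> < N" using reals_Archimedean2 by blast
  moreover have "0 < 1 / \<delta>" using \<delta> by simp
  ultimately have "0 < real N" by linarith
  then have N: "0 < N" "1 / real N \<le> \<delta>" using \<delta> \<open>1 / \<delta> < N\<close> by (simp_all add: field_simps)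
  obtain Q :: nat where Q: "width < Q" using reals_Archimedean2 by blast
  define P where "P = N * Q"
  \<comment> \<open>Bounds the shift \<open>sqrt v / c\<close> uniformly in \<open>\<tau>\<close>:
    \<open>v\<close> is a sum of at most \<open>card (grid P N)\<close> squared correlations, each
    at most 1.\<close>
  define k where "k = real (card (grid P N)) / c"
  have k0: "0 \<le> k" using c by (simp add: k_def)
  have "level_prob \<tau> \<le> exp (- M\<^sup>2 / 2) + exp (M * k + k\<^sup>2 / 2) * p (corner_simplex h (\<tau> * (1 - \<delta>)))"
    if \<tau>: "0 < \<tau>" and M: "0 \<le> M" for \<tau> M
  proof -
    define D where "D = {t. (\<forall>i. t $ i \<le> \<tau>) \<and> (\<delta> * \<tau>) * (h \<bullet> 1) \<le> h \<bullet> t}"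
    define F where "F = {b \<in> (\<lambda>z. (\<tau> / N) *\<^sub>R z) ` grid P N. 0 \<le> h \<bullet> b}"
    have F: "finite F" "card F \<le> card (grid P N)"
    proof -
      show "finite F" using finite_grid by (auto simp: F_def)
      have "card F \<le> card ((\<lambda>z. (\<tau> / N) *\<^sub>R z) ` grid P N)" using finite_grid by (auto simp: F_def intro!: card_mono)
      also have "\<dots> \<le> card (grid P N)" by (intro card_image_le finite_grid)
      finally show "card F \<le> card (grid P N)" .
    qed
    \<comment> \<open>The origin contributes \<open>C 0 0 = 1\<close> to \<open>v\<close>, which
      keeps the variance positive.\<close>
    have zF: "0 \<in> F" by (auto simp: F_def grid_def intro!: image_eqI[of _ _ 0])
    define v where "v = (\<Sum>a\<in>F. \<Sum>b\<in>F. C a b)"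
    have "C 0 0 \<le> (\<Sum>b\<in>F. C 0 b)" using F zF nonneg by (intro member_le_sum) auto
    also have "\<dots> \<le> v" unfolding v_def using F zF nonneg by (intro member_le_sum sum_nonneg) auto
    finally have v0: "0 < v" using diag[of 0] by simp
    have "v \<le> (\<Sum>a\<in>F. \<Sum>b\<in>F. 1)" unfolding v_def by (intro sum_mono C_le_1)
    also have "\<dots> = (real (card F))\<^sup>2" by (simp add: power2_eq_square)
    also have "\<dots> \<le> (real (card (grid P N)))\<^sup>2" using F by (intro power_mono) auto
    finally have "sqrt v \<le> real (card (grid P N))" by (intro real_le_lsqrt) auto
    then have vk: "sqrt v / c \<le> k" "0 \<le> sqrt v / c" unfolding k_def using c v0 by (auto intro: divide_right_mono)
    \<comment> \<open>Rounding t down to the grid gives b <= t with h . b >= 0, so one term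
      \<open>C b t\<close> is already at least c exp(-h . (t - b)) >= c exp(-h . t).\<close>
    have \<phi>: "exp (- (h \<bullet> t)) \<le> (\<Sum>b\<in>F. C b t) / c" if t: "t \<in> D" for t
    proof -
      define z where "z = (\<chi> i. real_of_int \<lfloor>t $ i * N / \<tau>\<rfloor>)"
      define b where "b = (\<tau> / N) *\<^sub>R z"
      have b: "b $ i = \<tau> / N * real_of_int \<lfloor>t $ i * N / \<tau>\<rfloor>" for i by (simp add: b_def z_def)
      have ti: "t $ i \<le> \<tau>" for i using t by (simp add: D_def)
      have ht: "(\<delta> * \<tau>) * (h \<bullet> 1) \<le> h \<bullet> t" using t by (simp add: D_def)
      \<comment> \<open>The upper bounds on all coordinates together with h . t >= 0 bound each
        coordinate from below, so the rounded point stays in the finite grid.\<close>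
      have tl: "- (\<tau> * width) \<le> t $ i" for i
      proof -
        have "h $ i * (\<tau> *\<^sub>R 1 - t) $ i \<le> h \<bullet> (\<tau> *\<^sub>R 1 - t)"
          using ti h_pos by (intro component_le_inner) (auto simp: less_imp_le)
        then have "h $ i * (\<tau> - t $ i) \<le> \<tau> * (h \<bullet> 1) - h \<bullet> t" by (simp add: inner_diff_right)
        also have "0 \<le> h \<bullet> t" using ht \<delta> \<tau> h1_pos by (meson less_imp_le mult_nonneg_nonneg order_trans)
        then have "\<tau> * (h \<bullet> 1) - h \<bullet> t \<le> \<tau> * (h \<bullet> 1)" by simp
        also have "\<dots> \<le> \<tau> * (width * h $ i)" using h1_le_width \<tau> by (intro mult_left_mono) auto
        finally have "h $ i * (\<tau> - t $ i) \<le> h $ i * (\<tau> * width)" by (simp add: mult_ac)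
        then have "\<tau> - t $ i \<le> \<tau> * width" using h_pos[of i] by simp
        then show ?thesis using \<tau> by linarith
      qed
      have zr: "- int P \<le> \<lfloor>t $ i * N / \<tau>\<rfloor>" "\<lfloor>t $ i * N / \<tau>\<rfloor> \<le> int N" for i
      proof -
        have "- (\<tau> * width) * (N / \<tau>) \<le> t $ i * (N / \<tau>)" using tl[of i] \<tau> by (intro mult_right_mono) auto
        then have "- (width * N) \<le> t $ i * N / \<tau>" using \<tau> by simp
        moreover have "width * N \<le> Q * N" using Q by (simp add: mult_right_mono)
        ultimately have "real_of_int (- int P) \<le> t $ i * N / \<tau>" by (simp add: P_def mult.commute)
        then show "- int P \<le> \<lfloor>t $ i * N / \<tau>\<rfloor>" by (simp only: le_floor_iff)
        have "t $ i * N / \<tau> \<le> N" using ti[of i] \<tau> N by (simp add: pos_divide_le_eq mult.commute)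
        then show "\<lfloor>t $ i * N / \<tau>\<rfloor> \<le> int N" by linarith
      qed
      then have "z \<in> grid P N" by (auto simp: grid_def z_def)
      moreover have bt: "b $ i \<le> t $ i" and tb: "t $ i \<le> b $ i + \<tau> / N" for i
      proof -
        have "\<tau> / N * real_of_int \<lfloor>t $ i * N / \<tau>\<rfloor> \<le> \<tau> / N * (t $ i * N / \<tau>)"
          "\<tau> / N * (t $ i * N / \<tau>) \<le> \<tau> / N * (real_of_int \<lfloor>t $ i * N / \<tau>\<rfloor> + 1)"
          using \<tau> by (intro mult_left_mono; simp; linarith)+
        then show "b $ i \<le> t $ i" "t $ i \<le> b $ i + \<tau> / N" unfolding b using \<tau> N by (auto simp: distrib_left)
      qed
      have hb: "0 \<le> h \<bullet> b"
      proof -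
        have "h \<bullet> t \<le> h \<bullet> (b + (\<tau> / N) *\<^sub>R 1)" using tb by (intro inner_h_le) simp
        then have "h \<bullet> t \<le> h \<bullet> b + 1 / N * (\<tau> * (h \<bullet> 1))" by (simp add: inner_add_right)
        moreover have "1 / N * (\<tau> * (h \<bullet> 1)) \<le> \<delta> * (\<tau> * (h \<bullet> 1))" using N \<tau> h1_pos by (intro mult_right_mono) auto
        ultimately show ?thesis using ht by (simp add: mult.assoc)
      qed
      ultimately have bF: "b \<in> F" by (auto simp: F_def b_def)
      have "c * exp (- (h \<bullet> t)) \<le> c * exp (- (h \<bullet> (t - b)))" using hb c by (simp add: inner_diff_right)
      also have "\<dots> \<le> C b t" by (rule c(2)) (rule bt)
      also have "\<dots> \<le> (\<Sum>b\<in>F. C b t)" using F bF nonneg by (intro member_le_sum) auto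
      finally show ?thesis using c by (simp add: field_simps)
    qed
    let ?B = "exp (M * k + k\<^sup>2 / 2)"
    have fin: "level_prob \<tau> \<le> exp (- M\<^sup>2 / 2) + ?B * orthant_prob J C (\<lambda>_. 0)" if J: "finite J" "J \<subseteq> D" for J
    proof -
      have "level_prob \<tau> \<le> orthant_prob J C (\<lambda>t. exp (- (h \<bullet> t)))"
        unfolding level_prob_def using J by (intro persistence_prob_le) (auto simp: D_def)
      also have "\<dots> \<le> exp (- M\<^sup>2 / 2) + exp (M * (sqrt v / c) + (sqrt v / c)\<^sup>2 / 2) * orthant_prob J C (\<lambda>_. 0)"
        unfolding v_def by (rule orthant_prob_level_change[OF psd J(1) F(1)])
          (use J F c M v0 \<phi> in \<open>auto simp: v_def subset_iff\<close>)
      also have "\<dots> \<le> exp (- M\<^sup>2 / 2) + ?B * orthant_prob J C (\<lambda>_. 0)"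
      proof -
        have "M * (sqrt v / c) + (sqrt v / c)\<^sup>2 / 2 \<le> M * k + k\<^sup>2 / 2"
          using vk M by (intro add_mono mult_left_mono divide_right_mono power_mono) auto
        then show ?thesis by (intro add_left_mono mult_right_mono orthant_prob_nonneg) simp
      qed
      finally show ?thesis .
    qed
    \<comment> \<open>The estimate is solved for the orthant probability, so that the infimum over
      \<open>J\<close> can be taken.\<close>
    have "(level_prob \<tau> - exp (- M\<^sup>2 / 2)) / ?B \<le> p D"
      by (intro persistence_prob_ge) (use fin in \<open>simp add: pos_divide_le_eq algebra_simps\<close>)
    then have "level_prob \<tau> \<le> exp (- M\<^sup>2 / 2) + ?B * p D" by (simp add: pos_divide_le_eq algebra_simps)
    moreover have "p D = p (corner_simplex h (\<tau> * (1 - \<delta>)))"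
      using p_wedge_translate[of "\<tau> * (1 - \<delta>)" "- (\<delta> * \<tau>)"] by (simp add: D_def algebra_simps)
    ultimately show ?thesis by simp
  qed
  then show ?thesis using k0 by blast
qed

lemma cost_simplex_limit_scaled:
  assumes "0 < a"
  shows "((\<lambda>\<tau>. cost (corner_simplex h (\<tau> * a)) / \<tau> ^ CARD('n)) \<longlongrightarrow> \<psi> * vol * a ^ CARD('n)) at_top"
proof -
  have "((\<lambda>\<tau>. cost (corner_simplex h (\<tau> * a)) / (\<tau> * a) ^ CARD('n)) \<longlongrightarrow> \<psi> * vol) at_top"
    using assms by (intro filterlim_compose[OF cost_simplex_limit] filterlim_at_top_mult_tendsto_pos[OF tendsto_const _ filterlim_ident])
  then have "((\<lambda>\<tau>. cost (corner_simplex h (\<tau> * a)) / (\<tau> * a) ^ CARD('n) * a ^ CARD('n)) \<longlongrightarrow> \<psi> * vol * a ^ CARD('n)) at_top"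
    by (intro tendsto_mult tendsto_const)
  then show ?thesis using assms by (simp add: power_mult_distrib)
qed

lemma filterlim_power_card: "filterlim (\<lambda>\<tau>::real. \<tau> ^ CARD('n)) at_top at_top"
  by (rule filterlim_pow_at_top[OF _ filterlim_ident]) simp

lemma tendsto_const_over_power: "((\<lambda>\<tau>::real. c / \<tau> ^ CARD('n)) \<longlongrightarrow> 0) at_top"
  by (rule tendsto_divide_0[OF tendsto_const filterlim_at_top_imp_at_infinity[OF filterlim_power_card]])

lemma level_prob_pos: "\<forall>\<^sub>F \<tau> in at_top. 0 < level_prob \<tau>"
proof -
  obtain q where q: "0 < q" "\<forall>\<^sub>F \<tau> in at_top. q * p (corner_simplex h (\<tau> * (1 + 1))) \<le> level_prob \<tau>"
    using level_prob_lower[of 1] by auto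
  from q(2) eventually_gt_at_top[of 0] show ?thesis
  proof eventually_elim
    case (elim \<tau>)
    then have "0 < p (corner_simplex h (\<tau> * (1 + 1)))" by (intro p_corner_simplex_pos) auto
    then have "0 < q * p (corner_simplex h (\<tau> * (1 + 1)))" using q by simp
    then show ?case using elim by linarith
  qed
qed

text \<open>Both bounds compare with a simplex of size \<open>\<tau>\<close> (1 +-
  \<open>\<delta>\<close>), whose cost differs from the claim by the factor (1 +-
  \<open>\<delta>\<close>)^d; then \<open>\<delta>\<close> tends to 0.\<close>

lemma level_prob_limit: "((\<lambda>\<tau>. - ln (level_prob \<tau>) / \<tau> ^ CARD('n)) \<longlongrightarrow> \<psi> * vol) at_top"
proof (rule order_tendstoI)
  fix a assume a: "\<psi> * vol < a"
  have "((\<lambda>\<delta>. \<psi> * vol * (1 + \<delta>) ^ CARD('n)) \<longlongrightarrow> \<psi> * vol * (1 + 0) ^ CARD('n)) (at_right 0)"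
    by (intro tendsto_intros)
  then have "\<forall>\<^sub>F \<delta> in at_right 0. \<psi> * vol * (1 + \<delta>) ^ CARD('n) < a" using a by (intro order_tendstoD(2)) auto
  then have "\<forall>\<^sub>F \<delta> in at_right 0. \<psi> * vol * (1 + \<delta>) ^ CARD('n) < a \<and> 0 < \<delta>"
    using eventually_at_right_less[of "0::real"] by eventually_elim auto
  then obtain \<delta> where \<delta>: "0 < \<delta>" "\<psi> * vol * (1 + \<delta>) ^ CARD('n) < a"
    using eventually_happens'[OF trivial_limit_at_right_real] by blast
  obtain q where q: "0 < q" "\<forall>\<^sub>F \<tau> in at_top. q * p (corner_simplex h (\<tau> * (1 + \<delta>))) \<le> level_prob \<tau>"
    using level_prob_lower[OF \<delta>(1)] by blast
  have "((\<lambda>\<tau>. - ln q / \<tau> ^ CARD('n) + cost (corner_simplex h (\<tau> * (1 + \<delta>))) / \<tau> ^ CARD('n)) \<longlongrightarrow> 0 + \<psi> * vol * (1 + \<delta>) ^ CARD('n)) at_top"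
    using \<delta> by (intro tendsto_add tendsto_const_over_power cost_simplex_limit_scaled) auto
  then have "\<forall>\<^sub>F \<tau> in at_top. - ln q / \<tau> ^ CARD('n) + cost (corner_simplex h (\<tau> * (1 + \<delta>))) / \<tau> ^ CARD('n) < a"
    using \<delta> by (intro order_tendstoD(2)) auto
  then show "\<forall>\<^sub>F \<tau> in at_top. - ln (level_prob \<tau>) / \<tau> ^ CARD('n) < a"
    using q(2) level_prob_pos eventually_gt_at_top[of 0]
  proof eventually_elim
    case (elim \<tau>)
    have pp: "0 < p (corner_simplex h (\<tau> * (1 + \<delta>)))" using elim \<delta> by (intro p_corner_simplex_pos) auto
    have "ln (q * p (corner_simplex h (\<tau> * (1 + \<delta>)))) \<le> ln (level_prob \<tau>)"
      using elim q pp by (subst ln_le_cancel_iff) auto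
    then have "- ln (level_prob \<tau>) \<le> - ln q + cost (corner_simplex h (\<tau> * (1 + \<delta>)))"
      using q pp by (simp add: ln_mult)
    then have "- ln (level_prob \<tau>) / \<tau> ^ CARD('n) \<le> (- ln q + cost (corner_simplex h (\<tau> * (1 + \<delta>)))) / \<tau> ^ CARD('n)"
      using elim by (intro divide_right_mono) auto
    also have "\<dots> < a" using elim(1) by (simp only: add_divide_distrib)
    finally show ?case .
  qed
next
  fix a assume a: "a < \<psi> * vol"
  have th0: "0 < \<psi> * vol" using \<psi>_pos vol_ge_1 by simp
  have "((\<lambda>\<delta>. \<psi> * vol * (1 - \<delta>) ^ CARD('n)) \<longlongrightarrow> \<psi> * vol * (1 - 0) ^ CARD('n)) (at_right 0)"
    by (intro tendsto_intros)
  then have "\<forall>\<^sub>F \<delta> in at_right 0. a < \<psi> * vol * (1 - \<delta>) ^ CARD('n)" using a by (intro order_tendstoD(1)) auto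
  then have "\<forall>\<^sub>F \<delta> in at_right 0. a < \<psi> * vol * (1 - \<delta>) ^ CARD('n) \<and> 0 < \<delta> \<and> \<delta> < 1"
    using eventually_at_right_less[of "0::real"] eventually_at_right_real[OF zero_less_one] by eventually_elim auto
  then obtain \<delta> where \<delta>: "0 < \<delta>" "\<delta> < 1" "a < \<psi> * vol * (1 - \<delta>) ^ CARD('n)"
    using eventually_happens'[OF trivial_limit_at_right_real] by blast
  define \<beta> where "\<beta> = \<psi> * vol * (1 - \<delta>) ^ CARD('n)"
  have \<beta>: "0 < \<beta>" "a < \<beta>" using th0 \<delta> by (auto simp: \<beta>_def)
  \<comment> \<open>The gap between a and a' absorbs the factor 2 that arises when two terms, each
    at most \<open>exp (- a' * w)\<close>, are added.\<close>
  define a' where "a' = (a + \<beta>) / 2"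
  have a': "a < a'" "a' < \<beta>" using \<beta> by (auto simp: a'_def)
  obtain k where k: "0 \<le> k" "\<And>\<tau> M. 0 < \<tau> \<Longrightarrow> 0 \<le> M \<Longrightarrow>
     level_prob \<tau> \<le> exp (- M\<^sup>2 / 2) + exp (M * k + k\<^sup>2 / 2) * p (corner_simplex h (\<tau> * (1 - \<delta>)))"
    using level_prob_upper[OF \<delta>(1,2)] by blast
  \<comment> \<open>With this M the truncation error exp(-M^2/2) equals exp(-\<open>\<beta>\<close>
    \<open>\<tau>\<close>^d), while the exponent M k of the shift is only of order
    \<open>\<tau>\<close>^(d/2).\<close>
  define M where "M \<tau> = sqrt (2 * \<beta> * \<tau> ^ CARD('n))" for \<tau> :: real
  define g where "g \<tau> = cost (corner_simplex h (\<tau> * (1 - \<delta>))) / \<tau> ^ CARD('n) - (M \<tau> * k + k\<^sup>2 / 2) / \<tau> ^ CARD('n)" for \<tau>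
  have "((\<lambda>\<tau>. sqrt (2 * \<beta> / \<tau> ^ CARD('n)) * k + (k\<^sup>2 / 2) / \<tau> ^ CARD('n)) \<longlongrightarrow> sqrt 0 * k + 0) at_top"
    by (intro tendsto_add tendsto_mult tendsto_real_sqrt tendsto_const_over_power tendsto_const)
  moreover have "\<forall>\<^sub>F \<tau> in at_top. sqrt (2 * \<beta> / \<tau> ^ CARD('n)) * k + (k\<^sup>2 / 2) / \<tau> ^ CARD('n) = (M \<tau> * k + k\<^sup>2 / 2) / \<tau> ^ CARD('n)"
    using eventually_gt_at_top[of 0]
  proof eventually_elim
    case (elim \<tau>)
    define w where "w = \<tau> ^ CARD('n)"
    have w: "0 < w" using elim by (simp add: w_def)
    have "sqrt (2 * \<beta> / w) = sqrt (2 * \<beta> * w) / w"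
    proof -
      have "sqrt (2 * \<beta> * w) / w = sqrt (2 * \<beta> * w) / sqrt (w\<^sup>2)" using w by simp
      also have "\<dots> = sqrt (2 * \<beta> * w / w\<^sup>2)" by (simp add: real_sqrt_divide)
      also have "2 * \<beta> * w / w\<^sup>2 = 2 * \<beta> / w" using w by (simp add: power2_eq_square)
      finally show ?thesis by simp
    qed
    then show ?case by (simp add: M_def w_def add_divide_distrib)
  qed
  ultimately have "((\<lambda>\<tau>. (M \<tau> * k + k\<^sup>2 / 2) / \<tau> ^ CARD('n)) \<longlongrightarrow> sqrt 0 * k + 0) at_top"
    by (rule Lim_transform_eventually)
  then have "(g \<longlongrightarrow> \<beta> - (sqrt 0 * k + 0)) at_top"
    unfolding g_def \<beta>_def using \<delta> by (intro tendsto_diff cost_simplex_limit_scaled) auto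
  then have "\<forall>\<^sub>F \<tau> in at_top. a' < g \<tau>" using a' by (intro order_tendstoD(1)) auto
  moreover have "\<forall>\<^sub>F \<tau> in at_top. ln 2 / \<tau> ^ CARD('n) < a' - a"
    by (rule order_tendstoD(2)[OF tendsto_const_over_power]) (use a' in simp)
  ultimately show "\<forall>\<^sub>F \<tau> in at_top. a < - ln (level_prob \<tau>) / \<tau> ^ CARD('n)"
    using level_prob_pos eventually_gt_at_top[of 0]
  proof eventually_elim
    case (elim \<tau>)
    define w where "w = \<tau> ^ CARD('n)"
    have w: "0 < w" using elim by (simp add: w_def)
    have pp: "0 < p (corner_simplex h (\<tau> * (1 - \<delta>)))" using elim \<delta> by (intro p_corner_simplex_pos) auto
    have "level_prob \<tau> \<le> exp (- (M \<tau>)\<^sup>2 / 2) + exp (M \<tau> * k + k\<^sup>2 / 2) * p (corner_simplex h (\<tau> * (1 - \<delta>)))"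
      using elim \<beta> by (intro k) (auto simp: M_def)
    also have "- (M \<tau>)\<^sup>2 / 2 = - \<beta> * w" using \<beta> elim by (simp add: M_def w_def)
    also have "exp (- \<beta> * w) \<le> exp (- a' * w)" using a' w by simp
    also have "exp (M \<tau> * k + k\<^sup>2 / 2) * p (corner_simplex h (\<tau> * (1 - \<delta>))) = exp (- g \<tau> * w)"
    proof -
      have "- g \<tau> * w = (M \<tau> * k + k\<^sup>2 / 2) - cost (corner_simplex h (\<tau> * (1 - \<delta>)))"
        using w by (simp add: g_def w_def[symmetric] field_simps)
      then show ?thesis using pp by (simp add: exp_add)
    qed
    also have "exp (- g \<tau> * w) \<le> exp (- a' * w)" using elim w by simp
    finally have "level_prob \<tau> \<le> 2 * exp (- a' * w)" by simp
    then have "ln (level_prob \<tau>) \<le> ln (2 * exp (- a' * w))" using elim by (subst ln_le_cancel_iff) auto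
    also have "\<dots> = ln 2 - a' * w" by (simp add: ln_mult)
    finally have "(a' * w - ln 2) / w \<le> - ln (level_prob \<tau>) / w" using w by (intro divide_right_mono) auto
    moreover have "(a' * w - ln 2) / w = a' - ln 2 / w" using w by (simp add: diff_divide_distrib)
    ultimately show ?case using elim by (simp add: w_def)
  qed
qed

end

section \<open>The kernel of the dual field\<close>

lemma covariance_cong_process_law:
  assumes law: "process_law M I X = process_law M I Y"
    and X: "\<And>t. t \<in> I \<Longrightarrow> X t \<in> borel_measurable M" and Y: "\<And>t. t \<in> I \<Longrightarrow> Y t \<in> borel_measurable M"
    and ts: "t \<in> I" "s \<in> I"
  shows "covariance M X t s = covariance M Y t s"
proof -
  have *: "covariance M Z t s = (LINT x|process_law M I Z. x t * x s)" if Z: "\<And>t. t \<in> I \<Longrightarrow> Z t \<in> borel_measurable M" for Z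
  proof -
    have "(\<lambda>\<omega>. \<lambda>t\<in>I. Z t \<omega>) \<in> M \<rightarrow>\<^sub>M PiM I (\<lambda>_. borel)" using Z by (intro measurable_restrict) auto
    moreover have "(\<lambda>x. x t * x s) \<in> borel_measurable (PiM I (\<lambda>_. borel :: real measure))" using ts by measurable
    ultimately show ?thesis unfolding process_law_def covariance_def using ts by (simp add: integral_distr)
  qed
  show ?thesis using *[OF X] *[OF Y] law by simp
qed

text \<open>The covariance of the Lamperti transform of a single process, as a function of the time lag.\<close>

definition dual_correlation :: "'w measure \<Rightarrow> (real \<Rightarrow> 'w \<Rightarrow> real) \<Rightarrow> real \<Rightarrow> real \<Rightarrow> real" where
  "dual_correlation M X h x = covariance M X 1 (exp x) * exp (- h * x)"

lemma covariance_commute: "covariance M X t s = covariance M X s t"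
  by (simp add: covariance_def mult.commute)

text \<open>Self-similarity with factor exp(a) brings the pair (exp a, exp b) back to (1, exp(b -
  a)), so after normalisation only the lag b - a matters.\<close>

lemma covariance_exp:
  assumes X: "centered_gaussian_process M {0..} X" and ss: "self_similar M X h"
  shows "covariance M X (exp a) (exp b) = exp (h * a) * exp (h * b) * dual_correlation M X h (b - a)"
proof -
  have m: "X t \<in> borel_measurable M" if "0 \<le> t" for t
    using centered_gaussian_process_measurable(1)[OF X] that by simp
  have "covariance M (\<lambda>t. X (exp a * t)) 1 (exp (b - a)) = covariance M (\<lambda>t \<omega>. exp a powr h * X t \<omega>) 1 (exp (b - a))"
  proof (rule covariance_cong_process_law)
    show "process_law M {0..} (\<lambda>t. X (exp a * t)) = process_law M {0..} (\<lambda>t \<omega>. exp a powr h * X t \<omega>)"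
      using ss by (simp add: self_similar_def)
    show "X (exp a * t) \<in> borel_measurable M" if "t \<in> {0..}" for t using that by (intro m) simp
    show "(\<lambda>\<omega>. exp a powr h * X t \<omega>) \<in> borel_measurable M" if "t \<in> {0..}" for t
      using m[of t] that by simp
  qed simp_all
  then have "covariance M X (exp a) (exp b) = covariance M (\<lambda>t \<omega>. exp a powr h * X t \<omega>) 1 (exp (b - a))"
    by (simp add: covariance_def exp_add[symmetric])
  also have "\<dots> = (LINT \<omega>|M. (exp (h * a) * exp (h * a)) * (X 1 \<omega> * X (exp (b - a)) \<omega>))"
    unfolding covariance_def by (intro Bochner_Integration.integral_cong refl) (simp add: powr_def mult_ac)
  also have "\<dots> = exp (h * a) * exp (h * a) * covariance M X 1 (exp (b - a))"
    by (simp add: covariance_def)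
  also have "\<dots> = exp (h * a) * exp (h * b) * dual_correlation M X h (b - a)"
  proof -
    have "exp (h * a) * exp (h * b) * exp (- h * (b - a)) = exp (h * a) * exp (h * a)"
      by (simp add: exp_add[symmetric] algebra_simps)
    then show ?thesis by (simp add: dual_correlation_def mult_ac)
  qed
  finally show ?thesis .
qed

text \<open>The symmetric covariance of the times 1 and exp(x) is expressed through lag x in one
  order and lag -x in the other.\<close>

lemma dual_correlation_minus:
  assumes X: "centered_gaussian_process M {0..} X" and ss: "self_similar M X h"
  shows "dual_correlation M X h (- x) = dual_correlation M X h x"
proof -
  have "covariance M X (exp 0) (exp x) = covariance M X (exp x) (exp 0)" by (rule covariance_commute)
  then show ?thesis unfolding covariance_exp[OF assms] by simp
qed

text \<open>Apart from the diagonal term 1, each side of a row contributes at most the sum of (L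
  m)^(-(1 + \<open>\<epsilon>\<close>)) over m >= 1, that is L^(-(1 + \<open>\<epsilon>\<close>))
  times a convergent series.\<close>

lemma lattice_row_sum_limit:
  fixes \<rho> :: "real \<Rightarrow> real"
  assumes \<rho>0: "\<rho> 0 = 1" and even: "\<And>x. \<rho> (- x) = \<rho> x" and \<epsilon>: "0 < \<epsilon>"
    and decay: "\<And>x. x0 < x \<Longrightarrow> \<rho> x \<le> x powr (- (1 + \<epsilon>))" and \<eta>: "0 < \<eta>"
  shows "\<forall>\<^sub>F L in at_top. \<forall>n. \<forall>k<n. (\<Sum>j<n. \<rho> (L * real j - L * real k)) \<le> 1 + \<eta>"
proof -
  define s where "s = - (1 + \<epsilon>)"
  define f where "f m = real m powr s" for m :: nat
  have sf: "summable f" unfolding f_def s_def using \<epsilon> by (simp add: summable_real_powr_iff)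
  have f0: "0 \<le> f m" for m by (simp add: f_def)
  define \<zeta> where "\<zeta> = suminf f"
  have "((\<lambda>L. 2 * L powr s * \<zeta>) \<longlongrightarrow> 2 * 0 * \<zeta>) at_top"
    unfolding s_def using \<epsilon> by (intro tendsto_mult tendsto_const tendsto_neg_powr filterlim_ident) auto
  then have "\<forall>\<^sub>F L in at_top. 2 * L powr s * \<zeta> < \<eta>" using \<eta> by (intro order_tendstoD(2)) auto
  then show ?thesis using eventually_gt_at_top[of x0] eventually_gt_at_top[of 0]
  proof eventually_elim
    case (elim L)
    have far: "\<rho> (L * real m) \<le> L powr s * f m" if "1 \<le> m" for m :: nat
    proof -
      have "L * 1 \<le> L * real m" using elim that by (intro mult_left_mono) auto
      then have "x0 < L * real m" using elim by linarith
      then have "\<rho> (L * real m) \<le> (L * real m) powr s" unfolding s_def by (rule decay)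
      then show ?thesis using elim by (simp add: powr_mult f_def)
    qed
    show ?case
    proof (intro allI impI)
      fix n k :: nat assume k: "k < n"
      have split: "{..<n} = {..<k} \<union> {k} \<union> {k<..<n}" using k by auto
      have "(\<Sum>j<n. \<rho> (L * real j - L * real k)) = (\<Sum>j<k. \<rho> (L * real j - L * real k)) + \<rho> 0 + (\<Sum>j\<in>{k<..<n}. \<rho> (L * real j - L * real k))"
      proof -
        have "{..<k} \<inter> {k<..<n} = {}" by auto
        then show ?thesis unfolding split by (simp add: sum.union_disjoint)
      qed
      also have "(\<Sum>j<k. \<rho> (L * real j - L * real k)) \<le> (\<Sum>j<k. L powr s * f (k - j))"
      proof (rule sum_mono)
        fix j assume "j \<in> {..<k}"
        then have "\<rho> (L * real j - L * real k) = \<rho> (L * real (k - j))"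
          using even[of "L * real (k - j)"] by (simp add: of_nat_diff right_diff_distrib)
        then show "\<rho> (L * real j - L * real k) \<le> L powr s * f (k - j)" using far[of "k - j"] \<open>j \<in> {..<k}\<close> by simp
      qed
      also have "\<dots> = L powr s * sum f ((\<lambda>j. k - j) ` {..<k})"
        by (subst sum.reindex) (auto simp: inj_on_def sum_distrib_left)
      also have "\<dots> \<le> L powr s * \<zeta>"
        unfolding \<zeta>_def using sf f0 by (intro mult_left_mono sum_le_suminf) auto
      also have "(\<Sum>j\<in>{k<..<n}. \<rho> (L * real j - L * real k)) \<le> (\<Sum>j\<in>{k<..<n}. L powr s * f (j - k))"
      proof (rule sum_mono)
        fix j assume "j \<in> {k<..<n}"
        moreover from this have "1 \<le> j - k" by auto
        ultimately show "\<rho> (L * real j - L * real k) \<le> L powr s * f (j - k)"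
          using far[of "j - k"] by (simp add: of_nat_diff right_diff_distrib)
      qed
      also have "\<dots> = L powr s * sum f ((\<lambda>j. j - k) ` {k<..<n})"
        by (subst sum.reindex) (auto simp: inj_on_def sum_distrib_left)
      also have "\<dots> \<le> L powr s * \<zeta>"
        unfolding \<zeta>_def using sf f0 by (intro mult_left_mono sum_le_suminf) auto
      finally show "(\<Sum>j<n. \<rho> (L * real j - L * real k)) \<le> 1 + \<eta>" using elim by (simp add: \<rho>0 mult_ac)
    qed
  qed
qed

lemma centered_gaussian_process_reindex:
  fixes f :: "'s \<Rightarrow> 't"
  assumes X: "centered_gaussian_process N I X" and f: "inj f" "range f \<subseteq> I"
  shows "centered_gaussian_process N UNIV (\<lambda>t \<omega>. w t * X (f t) \<omega>)"
  unfolding centered_gaussian_process_def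
proof (intro conjI allI impI)
  show "prob_space N" using X by (simp add: centered_gaussian_process_def)
  fix J :: "'s set" and a assume J: "finite J"
  have "(\<Sum>k\<in>f ` J. (a (inv f k) * w (inv f k)) * X k \<omega>) = (\<Sum>t\<in>J. a t * (w t * X (f t) \<omega>))" for \<omega>
    using f by (subst sum.reindex) (auto simp: inj_on_def mult.assoc)
  moreover have "centered_gaussian N (\<lambda>\<omega>. \<Sum>k\<in>f ` J. (a (inv f k) * w (inv f k)) * X k \<omega>)"
    using X J f unfolding centered_gaussian_process_def by (simp add: image_subset_iff)
  ultimately show "centered_gaussian N (\<lambda>\<omega>. \<Sum>t\<in>J. a t * (w t * X (f t) \<omega>))" by simp
qed

lemma std_normal_half_line_pos: "0 < measure std_normal_distribution {..x}"
proof (rule ccontr)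
  interpret S: prob_space std_normal_distribution by (rule prob_space_std_normal)
  assume "\<not> ?thesis"
  then have "S.prob {..x} = 0" using measure_nonneg[of std_normal_distribution "{..x}"] by linarith
  then have "{..x} \<in> null_sets std_normal_distribution" by (auto simp: null_sets_def S.emeasure_eq_measure)
  moreover have "std_normal_density z \<noteq> 0" for z using normal_density_pos[of 1 0 z] by simp
  ultimately have "AE z in lborel. z \<notin> {..x}"
    by (subst (asm) null_sets_density_iff) auto
  then have "emeasure lborel {..x} = 0"
    by (subst (asm) AE_iff_measurable[OF _ refl]) (auto simp: atMost_def)
  moreover have "emeasure lborel {x - 1..x} \<le> emeasure lborel {..x}" by (intro emeasure_mono) auto
  ultimately show False by simp
qed

text \<open>Stretching the axes by the intercepts H / h_i maps the standard simplex, of volume 1/d!,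
  onto this one.\<close>

lemma measure_corner_simplex_1:
  fixes h :: "real^'n"
  assumes h: "\<And>i. 0 < h $ i"
  shows "measure lborel (corner_simplex h 1) = (h \<bullet> 1) ^ CARD('n) / ((\<Prod>i\<in>UNIV. h $ i) * fact CARD('n))"
proof -
  let ?S = "convex hull (insert 0 Basis :: (real^'n) set)"
  have H: "0 < h \<bullet> 1" using h by (auto simp: inner_vec_def intro!: sum_pos)
  have S: "?S = {x. (\<forall>i. 0 \<le> x $ i) \<and> (\<Sum>i\<in>UNIV. x $ i) \<le> 1}"
  proof -
    have 1: "(\<Sum>b\<in>Basis. x \<bullet> b) = (\<Sum>i\<in>UNIV. x $ i)" for x :: "real^'n"
    proof -
      have B: "(Basis :: (real^'n) set) = (\<lambda>i. axis i 1) ` UNIV" by (auto simp: Basis_vec_def)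
      have "inj (\<lambda>i::'n. axis i (1::real))" by (simp add: inj_on_def axis_eq_axis)
      then show ?thesis unfolding B by (simp add: sum.reindex inner_axis)
    qed
    have 2: "(\<forall>b\<in>Basis. 0 \<le> x \<bullet> b) \<longleftrightarrow> (\<forall>i. 0 \<le> x $ i)" for x :: "real^'n"
      by (auto simp: Basis_vec_def inner_axis)
    show ?thesis unfolding std_simplex 1 2 ..
  qed
  have img: "(\<lambda>t. \<chi> k. (h \<bullet> 1) / h $ k * t $ k) ` ?S = corner_simplex h 1"
  proof (intro equalityI subsetI)
    fix t assume "t \<in> (\<lambda>t. \<chi> k. (h \<bullet> 1) / h $ k * t $ k) ` ?S"
    then obtain x where x: "t = (\<chi> k. (h \<bullet> 1) / h $ k * x $ k)" "\<And>i. 0 \<le> x $ i" "(\<Sum>i\<in>UNIV. x $ i) \<le> 1" unfolding S by blast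
    have hk: "h $ k \<noteq> 0" for k using h[of k] by simp
    have "h \<bullet> t = (h \<bullet> 1) * (\<Sum>i\<in>UNIV. x $ i)" by (simp add: x(1) inner_vec_def sum_distrib_left hk)
    then have "h \<bullet> t \<le> h \<bullet> 1" using x(3) H by simp
    then show "t \<in> corner_simplex h 1" using x h H by (auto simp: corner_simplex_def less_imp_le)
  next
    fix t assume t: "t \<in> corner_simplex h 1"
    define x where "x = (\<chi> k. h $ k * t $ k / (h \<bullet> 1))"
    have "(\<Sum>i\<in>UNIV. x $ i) = (h \<bullet> t) / (h \<bullet> 1)" by (simp add: x_def inner_vec_def sum_divide_distrib)
    then have "(\<Sum>i\<in>UNIV. x $ i) \<le> 1" using t H by (simp add: corner_simplex_def)
    then have "x \<in> ?S" using t h H unfolding S by (auto simp: x_def corner_simplex_def less_imp_le)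
    moreover have "t = (\<chi> k. (h \<bullet> 1) / h $ k * x $ k)"
    proof -
      have "h $ k \<noteq> 0" for k using h[of k] by simp
      then show ?thesis using H by (simp add: x_def vec_eq_iff)
    qed
    ultimately show "t \<in> (\<lambda>t. \<chi> k. (h \<bullet> 1) / h $ k * t $ k) ` ?S" by blast
  qed
  have cS: "compact ?S" by (intro finite_imp_compact_convex_hull) simp
  have "measure lebesgue ((\<lambda>t. \<chi> k. (h \<bullet> 1) / h $ k * t $ k) ` ?S) = \<bar>\<Prod>k\<in>UNIV. (h \<bullet> 1) / h $ k\<bar> * measure lebesgue ?S"
    by (rule measure_stretch) (rule lmeasurable_compact[OF cS])
  moreover have "measure lebesgue ?S = 1 / fact CARD('n)"
    using content_std_simplex[where 'a="real^'n"] borel_compact[OF cS] by simp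
  moreover have "measure lebesgue (corner_simplex h 1) = measure lborel (corner_simplex h 1)"
    by simp
  moreover have "0 < (\<Prod>k\<in>UNIV. h $ k)" using h by (intro prod_pos) auto
  ultimately show ?thesis unfolding img using H by (simp add: prod_dividef)
qed

text \<open>The lattice is a product set, so the row sum of a product kernel factorises by
  distributivity.\<close>

lemma lattice_row_sum:
  fixes g :: "'n::finite \<Rightarrow> real \<Rightarrow> real"
  assumes L: "0 < L"
  shows "(\<Sum>s\<in>lattice L n. \<Prod>i\<in>UNIV. g i (s $ i)) = (\<Prod>i\<in>UNIV. \<Sum>j<n. g i (L * real j :: real))"
proof -
  have "(\<Sum>s\<in>lattice L n. \<Prod>i\<in>UNIV. g i (s $ i)) = (\<Sum>f\<in>UNIV \<rightarrow>\<^sub>E (\<lambda>k. L * real k) ` {..<n}. \<Prod>i\<in>UNIV. g i (f i))"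
    unfolding lattice_def vec_coords_eq_image by (subst sum.reindex[OF inj_on_vec_lambda]) simp
  also have "\<dots> = (\<Prod>i\<in>UNIV. \<Sum>y\<in>(\<lambda>k. L * real k) ` {..<n}. g i y)" by (subst prod_sum_PiE) auto
  also have "\<dots> = (\<Prod>i\<in>UNIV. \<Sum>j<n. g i (L * real j))"
  proof -
    have "inj_on (\<lambda>k. L * real k) {..<n}" using L by (auto simp: inj_on_def)
    then show ?thesis by (simp add: sum.reindex)
  qed
  finally show ?thesis .
qed

definition dual_kernel :: "('n \<Rightarrow> 'w measure) \<Rightarrow> ('n \<Rightarrow> real \<Rightarrow> 'w \<Rightarrow> real) \<Rightarrow> real^'n \<Rightarrow> real^'n::finite \<Rightarrow> real^'n \<Rightarrow> real" where
  "dual_kernel M Xs h t s = (\<Prod>i\<in>UNIV. dual_correlation (M i) (Xs i) (h $ i) (s $ i - t $ i))"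

definition exp_vec :: "real^'n \<Rightarrow> real^'n" where
  "exp_vec t = (\<chi> i. exp (t $ i))"

lemma exp_vec_orthant: "exp_vec t \<in> orthant"
  by (simp add: exp_vec_def orthant_def)

lemma inj_exp_vec: "inj exp_vec"
  by (auto simp: inj_def exp_vec_def vec_eq_iff)

lemma continuous_on_exp_vec: "continuous_on S exp_vec"
  unfolding exp_vec_def by (intro continuous_intros)

section \<open>The tensor product and its exponents\<close>

locale tensor_field =
  fixes M :: "'n::finite \<Rightarrow> 'w measure"
    and Xs :: "'n \<Rightarrow> real \<Rightarrow> 'w \<Rightarrow> real"
    and h :: "real^'n"
    and N :: "'v measure"
    and X :: "real^'n \<Rightarrow> 'v \<Rightarrow> real"
  assumes gaussian: "\<And>i. centered_gaussian_process (M i) {0..} (Xs i)"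
    and h_pos: "\<And>i. h $ i > 0"
    and self_sim: "\<And>i. self_similar (M i) (Xs i) (h $ i)"
    and normalized: "\<And>i. (LINT \<omega>|M i. (Xs i 1 \<omega>)\<^sup>2) = 1"
    and cov_nonneg: "\<And>i t s. 0 \<le> t \<Longrightarrow> 0 \<le> s \<Longrightarrow> covariance (M i) (Xs i) t s \<ge> 0"
    and cov_decay: "\<And>i. \<exists>\<epsilon>>0. \<exists>s0>1. \<forall>s>s0.
       covariance (M i) (Xs i) 1 s \<le> s powr (h $ i) / (ln s) powr (1 + \<epsilon>)"
    and cov_lower: "\<And>i. \<exists>c>0. \<forall>s>0. covariance (M i) (Xs i) 1 (1 + s) \<ge> c"
    and tensor: "tensor_product M Xs N X"
    and paths: "continuous_paths N orthant X"
begin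

abbreviation C :: "real^'n \<Rightarrow> real^'n \<Rightarrow> real" where "C \<equiv> dual_kernel M Xs h"

abbreviation Y :: "real^'n \<Rightarrow> 'v \<Rightarrow> real" where "Y \<equiv> lamperti N X"

lemma corr_0: "dual_correlation (M i) (Xs i) (h $ i) 0 = 1"
  using normalized[of i] by (simp add: dual_correlation_def covariance_def power2_eq_square)

lemma C_diag: "C t t = 1"
  by (simp add: dual_kernel_def corr_0)

lemma covariance_X: "covariance N X (exp_vec t) (exp_vec s) = exp (h \<bullet> t) * exp (h \<bullet> s) * C t s"
proof -
  have "covariance N X (exp_vec t) (exp_vec s) = (\<Prod>i\<in>UNIV. covariance (M i) (Xs i) (exp (t $ i)) (exp (s $ i)))"
    using tensor exp_vec_orthant[of t] exp_vec_orthant[of s] by (simp add: tensor_product_def exp_vec_def)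
  also have "\<dots> = (\<Prod>i\<in>UNIV. exp (h $ i * t $ i) * exp (h $ i * s $ i) * dual_correlation (M i) (Xs i) (h $ i) (s $ i - t $ i))"
    by (intro prod.cong refl covariance_exp gaussian self_sim)
  finally show ?thesis by (simp add: prod.distrib dual_kernel_def inner_vec_def exp_sum)
qed

lemma Y_eq: "Y t \<omega> = exp (- (h \<bullet> t)) * X (exp_vec t) \<omega>"
proof -
  have "(LINT \<omega>'|N. (X (\<chi> i. exp (t $ i)) \<omega>')\<^sup>2) = (exp (h \<bullet> t))\<^sup>2"
    using covariance_X[of t t] by (simp add: C_diag covariance_def exp_vec_def power2_eq_square)
  then show ?thesis by (simp add: lamperti_def exp_vec_def[symmetric] exp_minus field_simps)
qed

lemma process_X: "centered_gaussian_process N orthant X"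
  using tensor by (simp add: tensor_product_def)

lemma gaussian_vector_Y: "finite J \<Longrightarrow> gaussian_vector N J Y C"
proof -
  assume J: "finite J"
  have "centered_gaussian_process N UNIV (\<lambda>t \<omega>. exp (- (h \<bullet> t)) * X (exp_vec t) \<omega>)"
    by (rule centered_gaussian_process_reindex[OF process_X inj_exp_vec]) (auto intro: exp_vec_orthant)
  then have "centered_gaussian_process N UNIV Y" by (simp add: Y_eq[abs_def])
  from gaussian_vector_of_process[OF this J] have g: "gaussian_vector N J Y (covariance N Y)" by simp
  have "covariance N Y t s = C t s" for t s
  proof -
    have "covariance N Y t s = (LINT \<omega>|N. (exp (- (h \<bullet> t)) * exp (- (h \<bullet> s))) * (X (exp_vec t) \<omega> * X (exp_vec s) \<omega>))"
      unfolding covariance_def Y_eq by (intro Bochner_Integration.integral_cong refl) (simp add: mult_ac)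
    also have "\<dots> = (exp (- (h \<bullet> t)) * exp (- (h \<bullet> s))) * covariance N X (exp_vec t) (exp_vec s)"
      by (simp add: covariance_def)
    finally show ?thesis by (simp add: covariance_X exp_minus field_simps)
  qed
  then show ?thesis by (intro gaussian_vector_cong[OF g]) auto
qed

lemma continuous_X: "\<omega> \<in> space N \<Longrightarrow> continuous_on orthant (\<lambda>t. X t \<omega>)"
  using paths by (simp add: continuous_paths_def)

lemma continuous_Y: "\<omega> \<in> space N \<Longrightarrow> continuous_on S (\<lambda>t. Y t \<omega>)"
proof -
  assume \<omega>: "\<omega> \<in> space N"
  have "continuous_on S (\<lambda>t. X (exp_vec t) \<omega>)"
    by (rule continuous_on_compose2[OF continuous_X[OF \<omega>] continuous_on_exp_vec]) (auto intro: exp_vec_orthant)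
  then show ?thesis unfolding Y_eq by (intro continuous_intros)
qed

lemma prob_N: "prob_space N"
  using process_X by (simp add: centered_gaussian_process_def)

lemma psd_C: "finite J \<Longrightarrow> psd_on J C"
  by (rule gaussian_vector_psd[OF gaussian_vector_Y])

lemma measure_Y:
  assumes "continuous_on S u"
  shows "{\<omega>\<in>space N. \<forall>t\<in>S. Y t \<omega> \<le> u t} \<in> sets N"
    and "measure N {\<omega>\<in>space N. \<forall>t\<in>S. Y t \<omega> \<le> u t} = persistence_prob S C u"
  using persistence_prob_eq[OF prob_N gaussian_vector_Y continuous_Y assms] by blast+

lemma corr_nonneg: "0 \<le> dual_correlation (M i) (Xs i) (h $ i) x"
  unfolding dual_correlation_def by (intro mult_nonneg_nonneg cov_nonneg) auto

lemma C_nonneg: "0 \<le> C t s"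
  unfolding dual_kernel_def by (intro prod_nonneg) (auto intro: corr_nonneg)

text \<open>Y(0) <= -1 has positive probability, and on this event continuity at 0 keeps Y below 0
  on some cube of side 1/(n+1). Countably many null events could not cover it.\<close>

lemma cube_pos: "\<exists>\<delta>>0. 0 < persistence_prob (cube \<delta>) C (\<lambda>_. 0)"
proof (rule ccontr)
  interpret prob_space N by (rule prob_N)
  assume neg: "\<not> ?thesis"
  define E where "E n = {\<omega>\<in>space N. \<forall>t\<in>cube (1 / real (Suc n)). Y t \<omega> \<le> 0}" for n
  have E: "E n \<in> sets N" "measure N (E n) = 0" for n
  proof -
    note m = measure_Y[OF continuous_on_const, of "cube (1 / real (Suc n))" 0]
    show "E n \<in> sets N" using m(1) by (simp add: E_def)
    have "\<not> 0 < persistence_prob (cube (1 / real (Suc n))) C (\<lambda>_. 0)" using neg by (metis of_nat_0_less_iff zero_less_Suc zero_less_divide_1_iff)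
    then show "measure N (E n) = 0"
      using m(2) persistence_prob_nonneg[of "cube (1 / real (Suc n))" C "\<lambda>_. 0"] by (simp add: E_def)
  qed
  then have "emeasure N (\<Union>n. E n) = 0" by (intro emeasure_UN_eq_0) (auto simp: emeasure_eq_measure)
  then have null: "measure N (\<Union>n. E n) = 0" by (simp add: measure_def)
  have "{\<omega>\<in>space N. \<forall>t\<in>{0}. Y t \<omega> \<le> - 1} \<subseteq> (\<Union>n. E n)"
  proof
    fix \<omega> assume "\<omega> \<in> {\<omega>\<in>space N. \<forall>t\<in>{0}. Y t \<omega> \<le> - 1}"
    then have \<omega>: "\<omega> \<in> space N" "Y 0 \<omega> \<le> - 1" by auto
    obtain d where d: "0 < d" "\<And>t. dist t 0 < d \<Longrightarrow> dist (Y t \<omega>) (Y 0 \<omega>) < 1"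
      using continuous_Y[OF \<omega>(1), of UNIV] unfolding continuous_on_iff by (metis UNIV_I zero_less_one)
    obtain n :: nat where n: "CARD('n) / d < n" using reals_Archimedean2 by blast
    have "Y t \<omega> \<le> 0" if t: "t \<in> cube (1 / real (Suc n))" for t
    proof -
      have "norm t \<le> (\<Sum>i\<in>UNIV. \<bar>t $ i\<bar>)" by (rule norm_le_l1_cart)
      also have "\<dots> \<le> (\<Sum>i\<in>(UNIV::'n set). 1 / real (Suc n))" using t by (intro sum_mono) (auto simp: cube_def)
      also have "\<dots> = CARD('n) / real (Suc n)" by simp
      also have "\<dots> < d" using n d by (simp add: field_simps)
      finally have "dist (Y t \<omega>) (Y 0 \<omega>) < 1" by (intro d(2)) simp
      then show ?thesis using \<omega>(2) by (simp add: dist_real_def)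
    qed
    then show "\<omega> \<in> (\<Union>n. E n)" using \<omega>(1) by (auto simp: E_def)
  qed
  then have "measure N {\<omega>\<in>space N. \<forall>t\<in>{0}. Y t \<omega> \<le> - 1} \<le> measure N (\<Union>n. E n)"
    using E by (intro finite_measure_mono) auto
  moreover have "measure N {\<omega>\<in>space N. \<forall>t\<in>{0}. Y t \<omega> \<le> - 1} = measure std_normal_distribution {..- 1}"
  proof -
    have "measure N {\<omega>\<in>space N. \<forall>t\<in>{0}. Y t \<omega> \<le> - 1} = orthant_prob {0 :: real^'n} C (\<lambda>_. - 1)"
      by (rule orthant_prob_eq) (rule gaussian_vector_Y, simp)
    also have "\<dots> = orthant_prob {0 :: real^'n} (\<lambda>t s. if t = s then 1\<^sup>2 else 0) (\<lambda>_. - 1)"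
      by (intro orthant_prob_cong) (auto simp: C_diag)
    also have "\<dots> = measure std_normal_distribution {..- 1}" by (subst orthant_prob_white) auto
    finally show ?thesis .
  qed
  ultimately show False using null std_normal_half_line_pos[of "- 1"] by simp
qed

text \<open>Every path of X is bounded on the compact unit cube, hence by exp(n) for some n. In
  logarithmic coordinates the events \<open>E n\<close> therefore exhaust the space and cannot all
  be null.\<close>

lemma orthant_pos: "\<exists>m. 0 < persistence_prob {t. \<forall>i. t $ i \<le> 0} C (\<lambda>t. exp (m - h \<bullet> t))"
proof (rule ccontr)
  interpret prob_space N by (rule prob_N)
  assume neg: "\<not> ?thesis"
  let ?S = "{t :: real^'n. \<forall>i. t $ i \<le> 0}"
  define E where "E n = {\<omega>\<in>space N. \<forall>t\<in>?S. Y t \<omega> \<le> exp (real n - h \<bullet> t)}" for n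
  have E: "E n \<in> sets N" "measure N (E n) = 0" for n
  proof -
    have "continuous_on ?S (\<lambda>t. exp (real n - h \<bullet> t))" by (intro continuous_intros)
    note m = measure_Y[OF this]
    show "E n \<in> sets N" using m(1) by (simp add: E_def)
    have "\<not> 0 < persistence_prob ?S C (\<lambda>t. exp (real n - h \<bullet> t))" using neg by blast
    then show "measure N (E n) = 0"
      using m(2) persistence_prob_nonneg[of ?S C "\<lambda>t. exp (real n - h \<bullet> t)"] by (simp add: E_def)
  qed
  then have null: "emeasure N (\<Union>n. E n) = 0" by (intro emeasure_UN_eq_0) (auto simp: emeasure_eq_measure)
  have "space N \<subseteq> (\<Union>n. E n)"
  proof
    fix \<omega> assume \<omega>: "\<omega> \<in> space N"
    have sub: "(cube 1 :: (real^'n) set) \<subseteq> orthant" by (auto simp: cube_def orthant_def)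
    have "compact ((\<lambda>t. X t \<omega>) ` cube 1)"
      using continuous_on_subset[OF continuous_X[OF \<omega>] sub] by (intro compact_continuous_image) (auto simp: cube_eq_cbox)
    then have "bounded ((\<lambda>t. X t \<omega>) ` cube 1)" by (rule compact_imp_bounded)
    then obtain B where B: "\<And>t. t \<in> cube 1 \<Longrightarrow> \<bar>X t \<omega>\<bar> \<le> B" by (auto simp: bounded_iff)
    obtain n :: nat where n: "B < n" using reals_Archimedean2 by blast
    have "Y t \<omega> \<le> exp (real n - h \<bullet> t)" if t: "t \<in> ?S" for t
    proof -
      have "exp_vec t \<in> cube 1" using t by (simp add: exp_vec_def cube_def)
      then have "X (exp_vec t) \<omega> \<le> B" using B by force
      also have "B \<le> exp (real n)" using n exp_ge_add_one_self[of "real n"] by linarith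
      finally have "exp (- (h \<bullet> t)) * X (exp_vec t) \<omega> \<le> exp (- (h \<bullet> t)) * exp (real n)" by simp
      then show ?thesis by (simp add: Y_eq exp_diff exp_minus field_simps)
    qed
    then show "\<omega> \<in> (\<Union>n. E n)" using \<omega> by (auto simp: E_def)
  qed
  then have "emeasure N (space N) \<le> emeasure N (\<Union>n. E n)" using E by (intro emeasure_mono) auto
  then show False using null emeasure_space_1 by simp
qed

text \<open>A constant lower bound for the covariance at (1, exp x) becomes c exp(-h_i x) after
  normalisation, and such bounds multiply over the coordinates.\<close>

lemma C_lower: "\<exists>c>0. \<forall>t s. (\<forall>i. s $ i \<le> t $ i) \<longrightarrow> c * exp (- (h \<bullet> (t - s))) \<le> C s t"
proof -
  have "\<forall>i. \<exists>c>0. \<forall>x\<ge>0. c * exp (- (h $ i) * x) \<le> dual_correlation (M i) (Xs i) (h $ i) x"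
  proof
    fix i
    obtain c where c: "0 < c" "\<And>s. 0 < s \<Longrightarrow> c \<le> covariance (M i) (Xs i) 1 (1 + s)" using cov_lower by blast
    \<comment> \<open>The hypothesis speaks of strictly positive increments; at lag zero the
      covariance is 1, hence the minimum.\<close>
    have "min c 1 \<le> covariance (M i) (Xs i) 1 (exp x)" if "0 \<le> x" for x
    proof (cases "x = 0")
      case True
      then show ?thesis using corr_0[of i] by (simp add: dual_correlation_def)
    next
      case False
      then show ?thesis using c(2)[of "exp x - 1"] that by simp
    qed
    then have "\<forall>x\<ge>0. min c 1 * exp (- (h $ i) * x) \<le> dual_correlation (M i) (Xs i) (h $ i) x"
      unfolding dual_correlation_def by (intro allI impI mult_right_mono) auto
    moreover have "0 < min c 1" using c by simp
    ultimately show "\<exists>c>0. \<forall>x\<ge>0. c * exp (- (h $ i) * x) \<le> dual_correlation (M i) (Xs i) (h $ i) x" by blast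
  qed
  then obtain c where c: "\<And>i. 0 < c i" "\<And>i x. 0 \<le> x \<Longrightarrow> c i * exp (- (h $ i) * x) \<le> dual_correlation (M i) (Xs i) (h $ i) x"
    by metis
  have "(\<Prod>i\<in>UNIV. c i) * exp (- (h \<bullet> (t - s))) \<le> C s t" if ts: "\<And>i. s $ i \<le> t $ i" for t s
  proof -
    have "(\<Prod>i\<in>UNIV. c i) * exp (- (h \<bullet> (t - s))) = (\<Prod>i\<in>UNIV. c i * exp (- (h $ i) * (t $ i - s $ i)))"
      by (simp add: prod.distrib inner_vec_def exp_sum[symmetric] sum_negf[symmetric] del: sum_negf)
    also have "\<dots> \<le> C s t"
      unfolding dual_kernel_def using c ts by (intro prod_mono conjI c(2)) (auto intro: less_imp_le)
    finally show ?thesis .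
  qed
  moreover have "0 < (\<Prod>i\<in>UNIV. c i)" using c by (intro prod_pos) auto
  ultimately show ?thesis by blast
qed

text \<open>With s = exp(x) hypothesis (d) reads as decay x^(-(1 + e)) of each factor. A common
  large L makes all one-dimensional row sums at most 1 + \<open>\<eta>\<close>, where (1 +
  \<open>\<eta>\<close>)^d is below 1 + \<open>\<epsilon>\<close>.\<close>

lemma C_decay:
  assumes \<epsilon>: "0 < \<epsilon>"
  shows "\<exists>L>0. \<forall>n. \<forall>t\<in>lattice L n. (\<Sum>s\<in>lattice L n. C t s) \<le> 1 + \<epsilon>"
proof -
  have "((\<lambda>\<eta>. (1 + \<eta>) ^ CARD('n)) \<longlongrightarrow> (1 + 0) ^ CARD('n)) (at_right (0::real))" by (intro tendsto_intros)
  then have "\<forall>\<^sub>F \<eta> in at_right (0::real). (1 + \<eta>) ^ CARD('n) < 1 + \<epsilon>" using \<epsilon> by (intro order_tendstoD(2)) auto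
  then have "\<forall>\<^sub>F \<eta> in at_right (0::real). (1 + \<eta>) ^ CARD('n) < 1 + \<epsilon> \<and> 0 < \<eta>"
    using eventually_at_right_less[of "0::real"] by eventually_elim auto
  then obtain \<eta> where \<eta>: "0 < \<eta>" "(1 + \<eta>) ^ CARD('n) < 1 + \<epsilon>"
    using eventually_happens'[OF trivial_limit_at_right_real] by blast
  let ?\<rho> = "\<lambda>i. dual_correlation (M i) (Xs i) (h $ i)"
  have "\<forall>\<^sub>F L in at_top. \<forall>n. \<forall>k<n. (\<Sum>j<n. ?\<rho> i (L * real j - L * real k)) \<le> 1 + \<eta>" for i
  proof -
    obtain e s0 where e: "0 < e" "1 < s0" "\<And>s. s0 < s \<Longrightarrow> covariance (M i) (Xs i) 1 s \<le> s powr (h $ i) / (ln s) powr (1 + e)"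
      using cov_decay[of i] by blast
    show ?thesis
    proof (rule lattice_row_sum_limit[OF corr_0 dual_correlation_minus[OF gaussian self_sim] e(1) _ \<eta>(1)])
      fix x assume x: "ln s0 < x"
      then have "s0 < exp x" using e(2) by (metis exp_less_cancel_iff exp_ln order.strict_trans zero_less_one)
      then have "covariance (M i) (Xs i) 1 (exp x) \<le> exp (h $ i * x) / x powr (1 + e)"
        using e(3)[of "exp x"] by (simp add: powr_def)
      then have "covariance (M i) (Xs i) 1 (exp x) * exp (- (h $ i) * x) \<le> exp (h $ i * x) / x powr (1 + e) * exp (- (h $ i) * x)"
        by (intro mult_right_mono) auto
      also have "\<dots> = x powr (- (1 + e))" by (simp add: powr_minus exp_minus field_simps del: minus_add_distrib)
      finally show "?\<rho> i x \<le> x powr (- (1 + e))" by (simp add: dual_correlation_def)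
    qed
  qed
  then have "\<forall>\<^sub>F L in at_top. \<forall>i. \<forall>n. \<forall>k<n. (\<Sum>j<n. ?\<rho> i (L * real j - L * real k)) \<le> 1 + \<eta>"
    by (rule eventually_all_finite)
  then have "\<forall>\<^sub>F L in at_top. 0 < L \<and> (\<forall>i. \<forall>n. \<forall>k<n. (\<Sum>j<n. ?\<rho> i (L * real j - L * real k)) \<le> 1 + \<eta>)"
    using eventually_gt_at_top[of 0] by eventually_elim auto
  then obtain L where L: "0 < L" "\<And>i n k. k < n \<Longrightarrow> (\<Sum>j<n. ?\<rho> i (L * real j - L * real k)) \<le> 1 + \<eta>"
    using eventually_happens'[OF trivial_limit_at_top_linorder] by blast
  have "(\<Sum>s\<in>lattice L n. C t s) \<le> 1 + \<epsilon>" if t: "t \<in> lattice L n" for n t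
  proof -
    have "(\<Sum>s\<in>lattice L n. C t s) = (\<Prod>i\<in>UNIV. \<Sum>j<n. ?\<rho> i (L * real j - t $ i))"
      unfolding dual_kernel_def by (rule lattice_row_sum[OF L(1), where g="\<lambda>i x. ?\<rho> i (x - t $ i)"])
    also have "\<dots> \<le> (\<Prod>i\<in>(UNIV :: 'n set). 1 + \<eta>)"
    proof (intro prod_mono conjI sum_nonneg corr_nonneg)
      fix i
      obtain k where "k < n" "t $ i = L * real k" using t unfolding lattice_def by blast
      then show "(\<Sum>j<n. ?\<rho> i (L * real j - t $ i)) \<le> 1 + \<eta>" using L(2) by simp
    qed
    finally show ?thesis using \<eta> by simp
  qed
  then show ?thesis using L(1) by blast
qed

sublocale stationary_kernel C h
proof
  show "C (t + v) (s + v) = C t s" for t s v by (simp add: dual_kernel_def)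
qed (fact psd_C C_nonneg C_diag h_pos cube_pos orthant_pos C_lower C_decay)+

lemma stays_below_Y: "stays_below_prob N Y 0 S = p S"
  unfolding stays_below_prob_def by (rule measure_Y(2)) (rule continuous_on_const)

lemma scaled_unit_cube: "0 < T \<Longrightarrow> (\<lambda>t. T *\<^sub>R t) ` (unit_cube :: (real^'n) set) = cube T"
proof (intro equalityI subsetI)
  fix t :: "real^'n" assume "0 < T" "t \<in> cube T"
  then have "(1 / T) *\<^sub>R t \<in> unit_cube" "t = T *\<^sub>R ((1 / T) *\<^sub>R t)" by (auto simp: cube_def unit_cube_def)
  then show "t \<in> (\<lambda>t. T *\<^sub>R t) ` unit_cube" by blast
qed (auto simp: cube_def unit_cube_def mult_left_le)

text \<open>Logarithmic coordinates reach only points with positive coordinates; the faces of the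
  cube through the origin are recovered by continuity of X on the closed orthant.\<close>

lemma stays_below_X:
  assumes T: "0 < T"
  shows "stays_below_prob N X 1 ((\<lambda>t. T *\<^sub>R t) ` unit_cube) = level_prob (ln T)"
proof -
  have "(\<forall>t\<in>cube T. X t \<omega> \<le> 1) \<longleftrightarrow> (\<forall>r\<in>{r. \<forall>i. r $ i \<le> ln T}. Y r \<omega> \<le> exp (- (h \<bullet> r)))" if \<omega>: "\<omega> \<in> space N" for \<omega>
  proof -
    have Yr: "Y r \<omega> \<le> exp (- (h \<bullet> r)) \<longleftrightarrow> X (exp_vec r) \<omega> \<le> 1" for r
      by (simp add: Y_eq)
    have "X t \<omega> \<le> 1" if H: "\<forall>r\<in>{r. \<forall>i. r $ i \<le> ln T}. X (exp_vec r) \<omega> \<le> 1" and t: "t \<in> cube T" for t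
    proof -
      \<comment> \<open>Lifts the vanishing coordinates of t; as T/(n+1) <= T, the points stay in
        the cube.\<close>
      define x where "x n = (\<chi> i. max (t $ i) (T / real (Suc n)))" for n
      have "(\<lambda>n. T / real (Suc n)) \<longlonglongrightarrow> 0" by (rule LIMSEQ_Suc[OF lim_const_over_n])
      then have "(\<lambda>n. max (t $ i) (T / real (Suc n))) \<longlonglongrightarrow> max (t $ i) 0" for i by (intro tendsto_max tendsto_const)
      then have "x \<longlonglongrightarrow> (\<chi> i. max (t $ i) 0)" unfolding x_def by (rule tendsto_vec_lambda)
      also have "(\<chi> i. max (t $ i) 0) = t" using t by (simp add: vec_eq_iff cube_def max_absorb1)
      finally have x: "x \<longlonglongrightarrow> t" .
      have xp: "0 < x n $ i" "x n $ i \<le> T" for n i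
        using T t by (auto simp: x_def cube_def less_max_iff_disj pos_divide_le_eq mult_le_cancel_left1)
      have xo: "x n \<in> orthant" for n using xp by (simp add: orthant_def less_imp_le)
      have "X (x n) \<omega> \<le> 1" for n
      proof -
        have "exp_vec (\<chi> i. ln (x n $ i)) = x n" using xp by (simp add: exp_vec_def vec_eq_iff)
        moreover have "(\<chi> i. ln (x n $ i)) \<in> {r. \<forall>i. r $ i \<le> ln T}" using xp T by simp
        ultimately show ?thesis using H by metis
      qed
      moreover have "(\<lambda>n. X (x n) \<omega>) \<longlonglongrightarrow> X t \<omega>"
        using continuous_on_tendsto_compose[OF continuous_X[OF \<omega>] x] xo t by (auto simp: orthant_def cube_def)
      ultimately show ?thesis by (intro LIMSEQ_le_const2) auto
    qed
    moreover have "exp_vec r \<in> cube T" if "\<forall>i. r $ i \<le> ln T" for r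
      using that T by (simp add: exp_vec_def cube_def ln_ge_iff)
    ultimately show ?thesis unfolding Yr by blast
  qed
  then have "{\<omega> \<in> space N. \<forall>t\<in>cube T. X t \<omega> \<le> 1} = {\<omega> \<in> space N. \<forall>r\<in>{r. \<forall>i. r $ i \<le> ln T}. Y r \<omega> \<le> exp (- (h \<bullet> r))}" by blast
  moreover have "continuous_on {r. \<forall>i. r $ i \<le> ln T} (\<lambda>r. exp (- (h \<bullet> r)))" by (intro continuous_intros)
  ultimately show ?thesis
    by (simp only: stays_below_prob_def scaled_unit_cube[OF T] level_prob_def measure_Y(2))
qed

lemma simplex_of_eq: "simplex_of h = corner_simplex h 1"
  by (simp add: simplex_of_def corner_simplex_def inner_vec_def mult.commute)

lemma theta_X: "has_theta_X N X unit_cube (\<psi> * vol)"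
  unfolding has_theta_X_def
proof
  have "\<forall>\<^sub>F T in at_top. 0 < level_prob (ln T)" using ln_at_top level_prob_pos by (rule eventually_compose_filterlim[rotated])
  then show "\<forall>\<^sub>F T in at_top. 0 < stays_below_prob N X 1 ((\<lambda>t. T *\<^sub>R t) ` unit_cube)"
    using eventually_gt_at_top[of 0] by eventually_elim (simp add: stays_below_X)
  have "((\<lambda>T. - ln (level_prob (ln T)) / ln T ^ CARD('n)) \<longlongrightarrow> \<psi> * vol) at_top"
    by (rule filterlim_compose[OF level_prob_limit ln_at_top])
  moreover have "\<forall>\<^sub>F T in at_top. - ln (level_prob (ln T)) / ln T ^ CARD('n) =
      - ln (stays_below_prob N X 1 ((\<lambda>t. T *\<^sub>R t) ` unit_cube)) / ln T ^ CARD('n)"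
    using eventually_gt_at_top[of 0] by eventually_elim (simp add: stays_below_X)
  ultimately show "((\<lambda>T. - ln (stays_below_prob N X 1 ((\<lambda>t. T *\<^sub>R t) ` unit_cube)) / ln T ^ CARD('n)) \<longlongrightarrow> \<psi> * vol) at_top"
    by (rule Lim_transform_eventually)
qed

lemma has_theta_Y_I:
  assumes "\<And>T. 0 < T \<Longrightarrow> (\<lambda>t. T *\<^sub>R t) ` G = F T" "\<And>T. 0 < T \<Longrightarrow> 0 < p (F T)"
    and "((\<lambda>T. cost (F T) / T ^ CARD('n)) \<longlongrightarrow> \<theta>) at_top"
  shows "has_theta_Y N Y G \<theta>"
  unfolding has_theta_Y_def stays_below_Y
proof
  show "\<forall>\<^sub>F T in at_top. 0 < p ((\<lambda>t. T *\<^sub>R t) ` G)"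
    using eventually_gt_at_top[of 0] by eventually_elim (simp add: assms)
  have "\<forall>\<^sub>F T in at_top. cost (F T) / T ^ CARD('n) = cost ((\<lambda>t. T *\<^sub>R t) ` G) / T ^ CARD('n)"
    using eventually_gt_at_top[of 0] by eventually_elim (simp add: assms)
  with assms(3) show "((\<lambda>T. cost ((\<lambda>t. T *\<^sub>R t) ` G) / T ^ CARD('n)) \<longlongrightarrow> \<theta>) at_top"
    by (rule Lim_transform_eventually)
qed

lemma theta_Y_simplex: "has_theta_Y N Y (simplex_of h) (\<psi> * vol)"
  by (rule has_theta_Y_I[OF _ _ cost_simplex_limit])
    (auto simp: simplex_of_eq corner_simplex_scale[symmetric] intro: p_corner_simplex_pos)

lemma theta_Y_cube: "has_theta_Y N Y unit_cube \<psi>"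
  by (rule has_theta_Y_I[OF scaled_unit_cube _ cost_cube_limit]) (auto intro: p_cube_pos)

lemma theta_Y_scaled_cube:
  assumes \<kappa>: "0 < \<kappa>"
  shows "has_theta_Y N Y ((\<lambda>t. \<kappa> *\<^sub>R t) ` unit_cube) (\<psi> * \<kappa> ^ CARD('n))"
proof (rule has_theta_Y_I)
  show "(\<lambda>t. T *\<^sub>R t) ` (\<lambda>t. \<kappa> *\<^sub>R t) ` (unit_cube :: (real^'n) set) = cube (T * \<kappa>)" if "0 < T" for T
    using scaled_unit_cube[of "T * \<kappa>"] that \<kappa> by (simp add: image_image)
  have "((\<lambda>T. cost (cube (T * \<kappa>)) / (T * \<kappa>) ^ CARD('n)) \<longlongrightarrow> \<psi>) at_top"
    using \<kappa> by (intro filterlim_compose[OF cost_cube_limit] filterlim_at_top_mult_tendsto_pos[OF tendsto_const _ filterlim_ident])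
  then have "((\<lambda>T. cost (cube (T * \<kappa>)) / (T * \<kappa>) ^ CARD('n) * \<kappa> ^ CARD('n)) \<longlongrightarrow> \<psi> * \<kappa> ^ CARD('n)) at_top"
    by (intro tendsto_mult tendsto_const)
  then show "((\<lambda>T. cost (cube (T * \<kappa>)) / T ^ CARD('n)) \<longlongrightarrow> \<psi> * \<kappa> ^ CARD('n)) at_top"
    using \<kappa> by (simp add: power_mult_distrib)
qed (rule p_cube_pos)

end

theorem theorem5:
  fixes M :: "'n::finite \<Rightarrow> 'w measure"
    and Xs :: "'n \<Rightarrow> real \<Rightarrow> 'w \<Rightarrow> real"
    and h :: "real^'n"
    and \<alpha> :: "'n \<Rightarrow> real"
    and N :: "'v measure"
    and X :: "real^'n \<Rightarrow> 'v \<Rightarrow> real"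
  assumes gaussian: "\<And>i. centered_gaussian_process (M i) {0..} (Xs i)"
    and h_pos: "\<And>i. h $ i > 0"
    and self_sim: "\<And>i. self_similar (M i) (Xs i) (h $ i)"
    and normalized: "\<And>i. (LINT \<omega>|M i. (Xs i 1 \<omega>)\<^sup>2) = 1"
    and time_inv: "\<And>i. time_invertible (M i) (Xs i) (h $ i)"
    and alpha: "\<And>i. 0 < \<alpha> i \<and> \<alpha> i \<le> 1"
    and hoelder: "\<And>i. \<exists>c>0. \<forall>t\<in>{0..1}. \<forall>s\<in>{0..1}.
       (LINT \<omega>|M i. \<bar>Xs i t \<omega> - Xs i s \<omega>\<bar>\<^sup>2) \<le> c * \<bar>t - s\<bar> powr (2 * \<alpha> i)"
    and cov_nonneg: "\<And>i t s. 0 \<le> t \<Longrightarrow> 0 \<le> s \<Longrightarrow> covariance (M i) (Xs i) t s \<ge> 0"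
    and cov_decay: "\<And>i. \<exists>\<epsilon>>0. \<exists>s0>1. \<forall>s>s0.
       covariance (M i) (Xs i) 1 s \<le> s powr (h $ i) / (ln s) powr (1 + \<epsilon>)"
    and cov_lower: "\<And>i. \<exists>c>0. \<forall>s>0. covariance (M i) (Xs i) 1 (1 + s) \<ge> c"
    and tensor: "tensor_product M Xs N X"
    and paths: "continuous_paths N orthant X"
  defines "Y \<equiv> lamperti N X"
  shows "\<exists>\<theta>>0. has_theta_X N X unit_cube \<theta> \<and> has_theta_Y N Y (simplex_of h) \<theta> \<and>
    (CARD('n) = 2 \<longrightarrow>
      (let h\<^sub>a = (\<Sum>i\<in>UNIV. h $ i) / 2;
           h\<^sub>g = sqrt (\<Prod>i\<in>UNIV. h $ i);
           \<kappa> = sqrt 2 * h\<^sub>a / h\<^sub>g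
       in (\<exists>\<theta>\<^sub>K. has_theta_Y N Y unit_cube \<theta>\<^sub>K \<and> \<theta> = \<theta>\<^sub>K * 2 * (h\<^sub>a / h\<^sub>g)\<^sup>2) \<and>
          has_theta_Y N Y ((\<lambda>t. \<kappa> *\<^sub>R t) ` unit_cube) \<theta>))"
proof -
  interpret tensor_field M Xs h N X
    by unfold_locales (fact gaussian h_pos self_sim normalized cov_nonneg cov_decay cov_lower tensor paths)+
  define a where "a = (\<Sum>i\<in>UNIV. h $ i) / 2"
  define g where "g = sqrt (\<Prod>i\<in>UNIV. h $ i)"
  have g: "0 < g" "g\<^sup>2 = (\<Prod>i\<in>UNIV. h $ i)"
    using prod_pos[of UNIV "\<lambda>i. h $ i"] h_pos by (auto simp: g_def less_imp_le)
  have ha: "h \<bullet> 1 = 2 * a" by (simp add: a_def inner_vec_def)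
  have a: "0 < a" using h1_pos ha by simp
  \<comment> \<open>H^2 / (2 h_1 h_2) with H = 2 a and h_1 h_2 equal to the square of g.\<close>
  have vol2: "vol = 2 * (a / g)\<^sup>2" if "CARD('n) = 2"
    using measure_corner_simplex_1[OF h_pos] g that by (simp add: vol_def ha power_divide power_mult_distrib)
  \<comment> \<open>The square of \<open>\<kappa>\<close> is 2 (a/g)^2, the volume just
    computed.\<close>
  have \<kappa>: "has_theta_Y N (lamperti N X) ((\<lambda>t. (sqrt 2 * a / g) *\<^sub>R t) ` unit_cube) (\<psi> * vol)" if "CARD('n) = 2"
    using theta_Y_scaled_cube[of "sqrt 2 * a / g"] a g that
    by (simp add: vol2 power_divide power_mult_distrib)
  have "0 < \<psi> * vol" using \<psi>_pos vol_ge_1 by simp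
  moreover have "CARD('n) = 2 \<longrightarrow> (\<exists>\<theta>\<^sub>K. has_theta_Y N (lamperti N X) unit_cube \<theta>\<^sub>K \<and> \<psi> * vol = \<theta>\<^sub>K * 2 * (a / g)\<^sup>2) \<and>
       has_theta_Y N (lamperti N X) ((\<lambda>t. (sqrt 2 * a / g) *\<^sub>R t) ` unit_cube) (\<psi> * vol)"
    using theta_Y_cube vol2 \<kappa> by auto
  ultimately show ?thesis
    using theta_X theta_Y_simplex unfolding Y_def Let_def a_def[symmetric] g_def[symmetric] by blast
qed

end
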